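(* Let $G$ be a finite group. Then $\mathcal{P}(G)$ is projective if and only if $G$ is isomorphic to one of $\mathbb{Z}_5$, $\mathbb{Z}_6$, $D_{10}$, $D_{12}$, $\mathbb{Z}_3\rtimes\mathbb{Z}_4$ or $\mathbb{Z}_5\rtimes_F\mathbb{Z}_4$.
   Context: The power graph $\mathcal{P}(G)$ of a group $G$ is the simple graph with vertex set $G$ in which two distinct vertices $x,y$ are adjacent if and only if $x\in\langle y\rangle$ or $y\in\langle x\rangle$. Let $N_k$ be the connected sum of $k$ real projective planes ($k\ge0$, with $N_0$ the sphere). The crosscap number of a graph $\Gamma$ is the minimal integer $k$ such that $\Gamma$ can be embedded in $N_k$ with edges intersecting only in endpoints; graphs of crosscap number $0$ are the planar graphs. A projective graph is a graph of crosscap number exactly $1$ (so planar graphs are not projective). $\mathbb{Z}_n$ is the cyclic group of order $n$ and $D_{2n}$ is the dihedral group of order $2n$. $\mathbb{Z}_3\rtimes\mathbb{Z}_4$ denotes the nonabelian semidirect product (the dicyclic group of order $12$). $K\rtimes_F H$ denotes a Frobenius group with kernel $K$ and complement $H$; so $\mathbb{Z}_5\rtimes_F\mathbb{Z}_4$ is the Frobenius group of order $20$. *)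

theory Defs
  imports "HOL-Analysis.Analysis" "HOL-Algebra.Elementary_Groups" "HOL-Algebra.Generated_Groups" "HOL-Library.Extended_Nat"
begin

section \<open>The surfaces $N_k$\<close>

definition real_projective_plane :: "'a topology \<Rightarrow> bool" where
  "real_projective_plane P \<longleftrightarrow>
     (\<exists>q. quotient_map (top_of_set (sphere (0 :: real^3) 1)) P q \<and>
          (\<forall>x \<in> sphere 0 1. \<forall>y \<in> sphere 0 1. q x = q y \<longleftrightarrow> x = y \<or> x = - y))"

text \<open>
  \<open>Z\<close> is a connected sum of the surfaces \<open>X\<close> and \<open>Y\<close>: the interiors of embedded closed discs
  \<open>e\<close> and \<open>f\<close> are removed, and \<open>Z\<close> is the quotient of the disjoint union of the remainders
  (tagged \<open>True\<close> and \<open>False\<close>) that identifies \<open>e u\<close> with \<open>f u\<close> for \<open>u\<close> on the unit circle.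
\<close>

definition connected_sum :: "'a topology \<Rightarrow> 'a topology \<Rightarrow> 'b topology \<Rightarrow> bool" where
  "connected_sum X Y Z \<longleftrightarrow>
     (\<exists>(e :: complex \<Rightarrow> 'a) (f :: complex \<Rightarrow> 'a) (q :: bool \<times> 'a \<Rightarrow> 'b).
        let D = sum_topology
                  (\<lambda>b. if b then subtopology X (- e ` ball 0 1) else subtopology Y (- f ` ball 0 1))
                  UNIV;
            glue = (\<lambda>p p'. \<exists>u \<in> sphere 0 1. p = (True, e u) \<and> p' = (False, f u))
        in embedding_map (top_of_set (cball 0 1)) X e \<and>
           embedding_map (top_of_set (cball 0 1)) Y f \<and>
           quotient_map D Z q \<and>
           (\<forall>p \<in> topspace D. \<forall>p' \<in> topspace D.
              q p = q p' \<longleftrightarrow> p = p' \<or> glue p p' \<or> glue p' p))"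

text \<open>
  \<open>nonorientable_surface k S\<close>: the space \<open>S\<close> is (a copy of) $N_k$. The type \<open>real^4\<close> only supplies
  points; \<open>S\<close> need not carry a subspace topology. It is large enough to house every $N_k$, since
  every closed surface embeds in 4-space.
\<close>

fun nonorientable_surface :: "nat \<Rightarrow> (real^4) topology \<Rightarrow> bool" where
  "nonorientable_surface 0 S \<longleftrightarrow> S homeomorphic_space top_of_set (sphere (0 :: real^3) 1)"
| "nonorientable_surface (Suc 0) S \<longleftrightarrow> real_projective_plane S"
| "nonorientable_surface (Suc (Suc k)) S \<longleftrightarrow>
     (\<exists>X P. nonorientable_surface (Suc k) X \<and> real_projective_plane P \<and> connected_sum X P S)"


section \<open>Graphs, embeddings and the crosscap number\<close>

text \<open>A simple graph is given by its vertex set and its set of two-element edges.\<close>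

type_synonym 'v sgraph = "'v set \<times> 'v set set"

definition graph_embeds_in :: "'v sgraph \<Rightarrow> 's topology \<Rightarrow> bool" where
  "graph_embeds_in \<Gamma> S \<longleftrightarrow>
     (case \<Gamma> of (V, E) \<Rightarrow>
        \<exists>(\<phi> :: 'v \<Rightarrow> 's) (\<gamma> :: 'v set \<Rightarrow> real \<Rightarrow> 's).
          inj_on \<phi> V \<and> \<phi> ` V \<subseteq> topspace S \<and>
          (\<forall>e \<in> E. embedding_map (top_of_set {0..1}) S (\<gamma> e) \<and>
                   {\<gamma> e 0, \<gamma> e 1} = \<phi> ` e \<and>
                   \<gamma> e ` {0<..<1} \<inter> \<phi> ` V = {}) \<and>
          (\<forall>e \<in> E. \<forall>e' \<in> E. e \<noteq> e' \<longrightarrow> \<gamma> e ` {0<..<1} \<inter> \<gamma> e' ` {0<..<1} = {}))"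

text \<open>The value is \<open>\<infinity>\<close> for a graph that embeds in none of the $N_k$.\<close>

definition crosscap_number :: "'v sgraph \<Rightarrow> enat" where
  "crosscap_number \<Gamma> =
     Inf {enat k | k. \<exists>S. nonorientable_surface k S \<and> graph_embeds_in \<Gamma> S}"

definition projective_graph :: "'v sgraph \<Rightarrow> bool" where
  "projective_graph \<Gamma> \<longleftrightarrow> crosscap_number \<Gamma> = 1"


section \<open>Power graphs and the groups of the classification\<close>

definition power_graph :: "('a, 'b) monoid_scheme \<Rightarrow> 'a sgraph" where
  "power_graph G =
     (carrier G,
      {{x, y} | x y. x \<in> carrier G \<and> y \<in> carrier G \<and> x \<noteq> y \<and>
                     (x \<in> generate G {y} \<or> y \<in> generate G {x})})"

definition semidirect_product ::
  "('a, 'c) monoid_scheme \<Rightarrow> ('b, 'd) monoid_scheme \<Rightarrow> ('b \<Rightarrow> 'a \<Rightarrow> 'a) \<Rightarrow> ('a \<times> 'b) monoid" where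
  "semidirect_product K H \<theta> =
     \<lparr>carrier = carrier K \<times> carrier H,
      monoid.mult = (\<lambda>(k, h) (k', h'). (k \<otimes>\<^bsub>K\<^esub> \<theta> h k', h \<otimes>\<^bsub>H\<^esub> h')),
      one = (\<one>\<^bsub>K\<^esub>, \<one>\<^bsub>H\<^esub>)\<rparr>"

text \<open>The action of $\mathbb{Z}_m$, $m$ even, on $\mathbb{Z}_n$ in which the generator 1 inverts.\<close>

definition inversion_action :: "nat \<Rightarrow> int \<Rightarrow> int \<Rightarrow> int" where
  "inversion_action n h k = (if even h then k else inv\<^bsub>integer_mod_group n\<^esub> k)"

text \<open>The argument \<open>n\<close> is half the group order: this is $D_{2n}$ of order $2n$.\<close>

definition dihedral_group :: "nat \<Rightarrow> (int \<times> int) monoid" where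
  "dihedral_group n =
     semidirect_product (integer_mod_group n) (integer_mod_group 2) (inversion_action n)"

text \<open>
  Inversion is the only nontrivial automorphism of $\mathbb{Z}_3$, so this is the only nonabelian
  semidirect product $\mathbb{Z}_3 \rtimes \mathbb{Z}_4$.
\<close>

definition Z3_semidirect_Z4 :: "(int \<times> int) monoid" where
  "Z3_semidirect_Z4 =
     semidirect_product (integer_mod_group 3) (integer_mod_group 4) (inversion_action 3)"

text \<open>
  \<open>H\<close> is a Frobenius complement of \<open>G\<close>, i.e. a proper nontrivial subgroup meeting each of its
  conjugates by elements outside \<open>H\<close> trivially, and \<open>K\<close> is the corresponding Frobenius kernel.
\<close>

definition frobenius_group :: "('a, 'b) monoid_scheme \<Rightarrow> 'a set \<Rightarrow> 'a set \<Rightarrow> bool" where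
  "frobenius_group G K H \<longleftrightarrow>
     group G \<and> subgroup H G \<and> H \<noteq> {\<one>\<^bsub>G\<^esub>} \<and> H \<noteq> carrier G \<and>
     (\<forall>g \<in> carrier G - H. H \<inter> (\<lambda>h. g \<otimes>\<^bsub>G\<^esub> h \<otimes>\<^bsub>G\<^esub> inv\<^bsub>G\<^esub> g) ` H = {\<one>\<^bsub>G\<^esub>}) \<and>
     K = insert \<one>\<^bsub>G\<^esub>
           (carrier G - (\<Union>g \<in> carrier G. (\<lambda>h. g \<otimes>\<^bsub>G\<^esub> h \<otimes>\<^bsub>G\<^esub> inv\<^bsub>G\<^esub> g) ` H))"

text \<open>\<open>G\<close> is a Frobenius group $A \rtimes_F B$: its kernel is a copy of \<open>A\<close>, its complement one of \<open>B\<close>.\<close>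

definition is_frobenius_product ::
  "('a, 'b) monoid_scheme \<Rightarrow> ('c, 'd) monoid_scheme \<Rightarrow> ('e, 'f) monoid_scheme \<Rightarrow> bool" where
  "is_frobenius_product G A B \<longleftrightarrow>
     (\<exists>K H. frobenius_group G K H \<and> subgroup K G \<and>
            G\<lparr>carrier := K\<rparr> \<cong> A \<and> G\<lparr>carrier := H\<rparr> \<cong> B)"

end

theory Submission
  imports Defs "HOL-Algebra.Multiplicative_Group"
begin

text \<open>
  Both sides are equivalent to: some \<open>g\<close> of order 5 or 6 generates a subgroup outside which all
  orders are at most 4.

  Obstructions. Lift an embedding to the sphere covering the projective plane. The double cover
  splits over a spanning star, and for two disjoint edges the change of angle of their difference
  along the drawing gives an integer that must satisfy parity conditions. These conditions are
  unsatisfiable for \<open>K\<^sub>5\<close> on the sphere, and for \<open>K\<^sub>7\<close> minus a 4-cycle and two copies of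
  \<open>K\<^sub>5\<close> sharing a vertex on the projective plane. Hence orders are at most 6 and elements of
  order 5 or 6 lie in a single cyclic subgroup.

  Embeddings. Elements of order at most 4 outside the core form a fan around the identity, with
  triangles joining \<open>x\<close>, its inverse and (for order 4) its square; the core \<open>K\<^sub>5\<close> of the cyclic subgroup
  is a pentagon with its diagonals passing through infinity.

  The group theory is an analysis of the action of \<open>G\<close> by conjugation on that cyclic subgroup.
\<close>

text \<open>Embedded edges are arbitrary topological arcs, so nothing polygonal and no face count is
  at hand; angle integers replace them. Modulo 2 they form van Kampen's obstruction. Up to
  correction terms \<open>c i j k\<close>, one for each edge and vertex off it, two disjoint edges
  behave like chords of a convex curve, which cross when their ends interleave, with one more
  crossing if both pass through the crosscap: the intersection form of the projective plane. Summing
  over the K4's in a K5, or over the nine edge pairs of two disjoint triangles, uses each correction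
  an even number of times and leaves conditions on the twists alone. The forbidden graphs come from
  exponents: powers of g are adjacent as soon as one exponent divides the other, so 0, 1, -1, 2, -2
  give K5, and adding 3, -3 misses only the 4-cycle between 2, -2 and 3, -3. In the drawing for g of
  order 6 the involution g^3 is kept out of the core: elements of order 4 may have it as their
  square, so it must be a hub of the fan, and from there it still sees g and its inverse inside the
  pentagon.\<close>

section \<open>Angle change of nonvanishing paths in the plane\<close>

text \<open>Counted in full turns, so that a closed path gets its winding number.\<close>

definition angle_change :: "(real \<Rightarrow> complex) \<Rightarrow> real" where
  "angle_change g = (let L = SOME L. continuous_on {0..1} L \<and> (\<forall>t\<in>{0..1}. g t = exp (L t))
                     in Im (L 1 - L 0) / (2 * pi))"

text \<open>Two continuous logarithms of one path differ by a continuous function with values in 2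
  pi i Z, hence by a constant; so the choice made by \<open>SOME\<close> does not matter.\<close>

lemma angle_change_eq:
  assumes L: "continuous_on {0..1} L" and e: "\<And>t. t \<in> {0..1} \<Longrightarrow> g t = exp (L t)"
  shows "angle_change g = Im (L 1 - L 0) / (2 * pi)"
proof -
  define M where "M = (SOME L. continuous_on {0..1} L \<and> (\<forall>t\<in>{0..1}. g t = exp (L t)))"
  have "continuous_on {0..1} M \<and> (\<forall>t\<in>{0..1}. g t = exp (M t))"
    unfolding M_def by (rule someI[of _ L]) (use assms in auto)
  then have M: "continuous_on {0..1} M" "\<And>t. t \<in> {0..1} \<Longrightarrow> g t = exp (M t)" by auto
  have "(\<lambda>t. L t - M t) constant_on {0..1}"
  proof (rule continuous_discrete_range_constant)
    show "connected {0..1::real}" by simp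
    show "continuous_on {0..1} (\<lambda>t. L t - M t)" using L M by (intro continuous_intros)
    fix x :: real assume x: "x \<in> {0..1}"
    show "\<exists>e>0. \<forall>y. y \<in> {0..1} \<and> L y - M y \<noteq> L x - M x \<longrightarrow> e \<le> cmod (L y - M y - (L x - M x))"
    proof (intro exI[of _ "2*pi"] conjI allI impI)
      show "2 * pi > 0" by simp
      fix y assume y: "y \<in> {0..1} \<and> L y - M y \<noteq> L x - M x"
      have "exp (L y - M y) = exp (L x - M x)" using x y e M(2) by (simp add: exp_diff)
      then obtain n :: int where n: "L y - M y = L x - M x + of_int (2 * n) * of_real pi * \<i>"
        by (auto simp: exp_eq)
      then have "n \<noteq> 0" using y by auto
      then have "1 \<le> \<bar>real_of_int n\<bar>" by linarith
      then have "2 * pi \<le> 2 * pi * \<bar>real_of_int n\<bar>" by simp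
      then show "2 * pi \<le> cmod (L y - M y - (L x - M x))" using n
        by (simp add: norm_mult mult_ac)
    qed
  qed
  then obtain c where "\<And>t. t \<in> {0..1} \<Longrightarrow> L t - M t = c" unfolding constant_on_def by blast
  from this[of 0] this[of 1] have "L 1 - L 0 = M 1 - M 0" by (simp add: algebra_simps)
  then show ?thesis unfolding angle_change_def M_def Let_def by simp
qed

lemma continuous_log_exists:
  fixes g :: "real \<Rightarrow> complex"
  assumes "continuous_on {0..1} g" "\<And>t. t \<in> {0..1} \<Longrightarrow> g t \<noteq> 0"
  obtains L where "continuous_on {0..1} L" "\<And>t. t \<in> {0..1} \<Longrightarrow> g t = exp (L t)"
  by (rule continuous_logarithm_on_contractible[OF assms(1)])
     (use assms(2) in \<open>auto intro: convex_imp_contractible\<close>)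

lemma angle_change_cong:
  assumes "\<And>t. t \<in> {0..1} \<Longrightarrow> f t = g t"
  shows "angle_change f = angle_change g"
proof -
  have "(\<lambda>L. continuous_on {0..1} L \<and> (\<forall>t\<in>{0..1}. f t = exp (L t))) =
        (\<lambda>L. continuous_on {0..1} L \<and> (\<forall>t\<in>{0..1}. g t = exp (L t)))"
    using assms by auto
  then show ?thesis unfolding angle_change_def by simp
qed

lemma angle_change_cnj:
  assumes "continuous_on {0..1} g" "\<And>t. t \<in> {0..1} \<Longrightarrow> g t \<noteq> 0"
  shows "angle_change (\<lambda>t. cnj (g t)) = - angle_change g"
proof -
  obtain L where L: "continuous_on {0..1} L" "\<And>t. t \<in> {0..1} \<Longrightarrow> g t = exp (L t)"
    using continuous_log_exists[OF assms] by blast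
  have "angle_change (\<lambda>t. cnj (g t)) = Im (cnj (L 1) - cnj (L 0)) / (2 * pi)"
    by (rule angle_change_eq[where L="\<lambda>t. cnj (L t)"]) (use L in \<open>auto intro!: continuous_intros simp: exp_cnj\<close>)
  also have "\<dots> = - angle_change g"
    using angle_change_eq[where L=L and g=g] L by (simp add: minus_divide_left)
  finally show ?thesis .
qed

lemma angle_change_const_mult:
  assumes "continuous_on {0..1} g" "\<And>t. t \<in> {0..1} \<Longrightarrow> g t \<noteq> 0" "c \<noteq> 0"
  shows "angle_change (\<lambda>t. c * g t) = angle_change g"
proof -
  obtain L where L: "continuous_on {0..1} L" "\<And>t. t \<in> {0..1} \<Longrightarrow> g t = exp (L t)"
    using continuous_log_exists[OF assms(1,2)] by blast
  have "angle_change (\<lambda>t. c * g t) = Im ((Ln c + L 1) - (Ln c + L 0)) / (2 * pi)"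
    by (rule angle_change_eq[where L="\<lambda>t. Ln c + L t"])
       (use L assms in \<open>auto intro!: continuous_intros simp: exp_add\<close>)
  also have "\<dots> = angle_change g" using angle_change_eq[where L=L and g=g] L by simp
  finally show ?thesis .
qed

definition has_angle :: "complex \<Rightarrow> real \<Rightarrow> bool" where
  "has_angle z a \<longleftrightarrow> (\<exists>r>0. z = rcis r (2 * pi * a))"

lemma has_angle_Arg: "z \<noteq> 0 \<Longrightarrow> has_angle z (Arg z / (2 * pi))"
  unfolding has_angle_def by (rule exI[of _ "cmod z"]) (simp add: rcis_cmod_Arg)

lemma has_angle_mult:
  assumes "has_angle z a" "has_angle w b" shows "has_angle (z * w) (a + b)"
proof -
  obtain r s where "r > 0" "s > 0" "z = rcis r (2 * pi * a)" "w = rcis s (2 * pi * b)"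
    using assms by (auto simp: has_angle_def)
  then show ?thesis unfolding has_angle_def
    by (intro exI[of _ "r * s"]) (simp add: rcis_mult algebra_simps)
qed

lemma has_angle_uminus: "has_angle z a \<Longrightarrow> has_angle (- z) (a + 1/2)"
  unfolding has_angle_def
  proof (elim exE conjE)
  fix r :: real assume "r > 0" "z = rcis r (2 * pi * a)"
  moreover have "rcis r (2 * pi * (a + 1/2)) = rcis r (2 * pi * a) * rcis 1 pi"
    by (simp add: rcis_mult algebra_simps)
  ultimately show "\<exists>r>0. - z = rcis r (2 * pi * (a + 1 / 2))"
    by (intro exI[of _ r]) (simp add: rcis_def)
qed

lemma has_angle_cnj: "has_angle z a \<Longrightarrow> has_angle (cnj z) (- a)"
  unfolding has_angle_def by (auto simp: rcis_def cis_cnj)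

lemma has_angle_inverse: "has_angle z a \<Longrightarrow> has_angle (inverse z) (- a)"
  unfolding has_angle_def
  proof (elim exE conjE)
  fix r :: real assume "r > 0" "z = rcis r (2 * pi * a)"
  then show "\<exists>r>0. inverse z = rcis r (2 * pi * - a)"
    by (intro exI[of _ "1 / r"]) (simp add: rcis_inverse)
qed

lemma has_angle_divide: "has_angle z a \<Longrightarrow> has_angle w b \<Longrightarrow> has_angle (z / w) (a - b)"
  using has_angle_mult[OF _ has_angle_inverse, of z a w b] by (simp add: divide_inverse)

lemma has_angle_unique:
  assumes "has_angle z a" "has_angle z b" shows "a - b \<in> \<int>"
proof -
  obtain r s where rs: "r > 0" "s > 0" "z = rcis r (2 * pi * a)" "z = rcis s (2 * pi * b)"
    using assms by (auto simp: has_angle_def)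
  then have "r = s" by (metis abs_of_pos complex_mod_rcis)
  then have "cis (2 * pi * a) = cis (2 * pi * b)" using rs by (simp add: rcis_def)
  then have "cis (2 * pi * (a - b)) = 1" by (simp add: right_diff_distrib cis_divide[symmetric])
  then have "cos (2 * pi * (a - b)) = 1" by (metis Re_complex_of_real cis.sel(1) of_real_1)
  then obtain n :: int where "2 * pi * (a - b) = real_of_int n * 2 * pi"
    by (auto simp: cos_one_2pi_int)
  then have "a - b = real_of_int n" by simp
  then show ?thesis by simp
qed

text \<open>This is where integers come from: the end values fix the change of angle up to whole
  turns.\<close>

lemma angle_change_ends:
  assumes g: "continuous_on {0..1} g" "\<And>t. t \<in> {0..1} \<Longrightarrow> g t \<noteq> 0"
    and a: "has_angle (g 0) a" and b: "has_angle (g 1) b"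
  shows "angle_change g - (b - a) \<in> \<int>"
proof -
  obtain L where L: "continuous_on {0..1} L" "\<And>t. t \<in> {0..1} \<Longrightarrow> g t = exp (L t)"
    using continuous_log_exists[OF g] by blast
  have *: "has_angle (g t) (Im (L t) / (2 * pi))" if "t \<in> {0..1}" for t
    unfolding has_angle_def using L(2)[OF that]
    by (intro exI[of _ "exp (Re (L t))"]) (simp add: rcis_def exp_eq_polar)
  have "Im (L 1) / (2 * pi) - b \<in> \<int>" "Im (L 0) / (2 * pi) - a \<in> \<int>"
    using has_angle_unique[OF *[of 1] b] has_angle_unique[OF *[of 0] a] by auto
  then have "(Im (L 1) / (2 * pi) - b) - (Im (L 0) / (2 * pi) - a) \<in> \<int>" by (rule Ints_diff)
  moreover have "angle_change g = Im (L 1) / (2 * pi) - Im (L 0) / (2 * pi)"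
    using angle_change_eq[where L=L and g=g] L by (simp add: diff_divide_distrib)
  then have "angle_change g - (b - a) = (Im (L 1) / (2 * pi) - b) - (Im (L 0) / (2 * pi) - a)"
    by linarith
  ultimately show ?thesis by (simp only:)
qed

text \<open>A continuous logarithm exists on the contractible square, so both ways along its
  boundary from (0, 0) to (1, 1) turn by the same amount.\<close>

lemma angle_change_square:
  fixes F :: "real \<Rightarrow> real \<Rightarrow> complex"
  assumes F: "continuous_on ({0..1} \<times> {0..1}) (\<lambda>(s, t). F s t)"
    and nz: "\<And>s t. s \<in> {0..1} \<Longrightarrow> t \<in> {0..1} \<Longrightarrow> F s t \<noteq> 0"
  shows "angle_change (\<lambda>s. F s 0) + angle_change (F 1) =
         angle_change (\<lambda>s. F s 1) + angle_change (F 0)"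
proof -
  obtain L where L: "continuous_on ({0..1} \<times> {0..1}) L"
      "\<And>z. z \<in> {0..1} \<times> {0..1} \<Longrightarrow> (\<lambda>(s, t). F s t) z = exp (L z)"
    by (rule continuous_logarithm_on_contractible[OF F])
       (use nz in \<open>auto intro!: convex_imp_contractible convex_Times\<close>)
  have L1: "continuous_on {0..1} (\<lambda>s. L (s, t))" if "t \<in> {0..1}" for t
    by (rule continuous_on_compose2[OF L(1)]) (use that in \<open>auto intro!: continuous_intros\<close>)
  have L2: "continuous_on {0..1} (\<lambda>t. L (s, t))" if "s \<in> {0..1}" for s
    by (rule continuous_on_compose2[OF L(1)]) (use that in \<open>auto intro!: continuous_intros\<close>)
  have e: "F s t = exp (L (s, t))" if "s \<in> {0..1}" "t \<in> {0..1}" for s t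
    using L(2)[of "(s, t)"] that by simp
  have 1: "angle_change (\<lambda>s. F s t) = Im (L (1, t) - L (0, t)) / (2 * pi)" if "t \<in> {0..1}" for t
    by (rule angle_change_eq[OF L1]) (use that e in auto)
  have 2: "angle_change (F s) = Im (L (s, 1) - L (s, 0)) / (2 * pi)" if "s \<in> {0..1}" for s
    by (rule angle_change_eq[OF L2]) (use that e in auto)
  show ?thesis by (simp add: 1 2 add_divide_distrib[symmetric])
qed

section \<open>Drawings lifted to the double cover, and their parity conditions\<close>

text \<open>The antipodal map of the sphere in stereographic coordinates. At 0 the division yields 0
  instead of infinity, which is why vertices are kept away from 0.\<close>

definition antipode :: "complex \<Rightarrow> complex" where "antipode z = - 1 / cnj z"

definition twist :: "bool \<Rightarrow> complex \<Rightarrow> complex" where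
  "twist b z = (if b then antipode z else z)"

text \<open>A drawing on the projective plane, seen through one chosen lift \<open>p i\<close> of
  each vertex. \<open>y i j\<close> records whether the lift of the edge that starts at
  \<open>p i\<close> ends at the antipode of \<open>p j\<close>. For two edges, being antipodal is
  written as \<open>1 + cnj u * w = 0\<close>, which has no pole and so can be fed to the square
  relation.\<close>

definition projective_drawing ::
  "nat \<Rightarrow> (nat \<Rightarrow> nat \<Rightarrow> bool) \<Rightarrow> (nat \<Rightarrow> complex) \<Rightarrow> (nat \<Rightarrow> nat \<Rightarrow> bool) \<Rightarrow>
    (nat \<Rightarrow> nat \<Rightarrow> real \<Rightarrow> complex) \<Rightarrow> bool" where
  "projective_drawing n adj p y e \<longleftrightarrow>
     (\<forall>i<n. p i \<noteq> 0) \<and>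
     (\<forall>i<n. \<forall>k<n. i \<noteq> k \<longrightarrow> p i \<noteq> p k \<and> p i \<noteq> antipode (p k)) \<and>
     (\<forall>i j. i < j \<and> j < n \<and> adj i j \<longrightarrow>
        continuous_on {0..1} (e i j) \<and> e i j 0 = p i \<and> e i j 1 = twist (y i j) (p j) \<and>
        (\<forall>t\<in>{0..1}. \<forall>k<n. k \<noteq> i \<and> k \<noteq> j \<longrightarrow> e i j t \<noteq> p k \<and> e i j t \<noteq> antipode (p k))) \<and>
     (\<forall>i j k l. i < j \<and> j < n \<and> adj i j \<and> k < l \<and> l < n \<and> adj k l \<and> {i, j} \<inter> {k, l} = {} \<longrightarrow>
        (\<forall>s\<in>{0..1}. \<forall>t\<in>{0..1}. e i j s \<noteq> e k l t \<and> 1 + cnj (e i j s) * e k l t \<noteq> 0))"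

lemma eq_antipode_iff: "u \<noteq> 0 \<Longrightarrow> x = antipode u \<longleftrightarrow> 1 + cnj x * u = 0"
proof -
  assume u: "u \<noteq> 0"
  have "1 + cnj x * u = 0 \<longleftrightarrow> cnj (1 + cnj x * u) = 0" by (metis complex_cnj_zero_iff)
  also have "\<dots> \<longleftrightarrow> 1 + x * cnj u = 0" by simp
  also have "\<dots> \<longleftrightarrow> x * cnj u = - 1" by (metis add_eq_0_iff)
  also have "\<dots> \<longleftrightarrow> x = antipode u" using u by (auto simp: antipode_def field_simps)
  finally show ?thesis by simp
qed

text \<open>Summed over the four pairs of ends of two disjoint edges this is odd exactly if the
  edges interleave in the order of indices.\<close>

definition pos_after :: "nat \<Rightarrow> nat \<Rightarrow> int" where "pos_after i k = (if k < i then 1 else 0)"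

context
  fixes p :: "nat \<Rightarrow> complex"
begin

text \<open>The argument is measured once per unordered pair and the reversed difference gets
  exactly half a turn more, so that swapping \<open>i\<close> and \<open>k\<close> costs a known
  half turn and a known integer.\<close>

definition angle_diff :: "nat \<Rightarrow> nat \<Rightarrow> real" where
  "angle_diff i k = (if i < k then Arg (p i - p k) / (2 * pi) else Arg (p k - p i) / (2 * pi) + 1 / 2)"

definition angle_anti :: "nat \<Rightarrow> nat \<Rightarrow> real" where
  "angle_anti i k = (if i < k then Arg (1 + cnj (p i) * p k) / (2 * pi)
                     else - (Arg (1 + cnj (p k) * p i) / (2 * pi)))"

lemma has_angle_diff: "p i \<noteq> p k \<Longrightarrow> has_angle (p i - p k) (angle_diff i k)"
  using has_angle_Arg[of "p i - p k"] has_angle_uminus[OF has_angle_Arg, of "p k - p i"]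
  by (auto simp: angle_diff_def)

lemma angle_diff_swap: "i \<noteq> k \<Longrightarrow> angle_diff k i = angle_diff i k + 1 / 2 - of_int (pos_after i k)"
  by (auto simp: angle_diff_def pos_after_def)

lemma has_angle_anti:
  assumes "1 + cnj (p i) * p k \<noteq> 0" shows "has_angle (1 + cnj (p i) * p k) (angle_anti i k)"
proof -
  have "cnj (1 + cnj (p i) * p k) \<noteq> 0" using assms by (metis complex_cnj_zero_iff)
  then have "1 + cnj (p k) * p i \<noteq> 0" by (simp add: mult.commute)
  then show ?thesis
    using has_angle_Arg[OF assms] has_angle_cnj[OF has_angle_Arg, of "1 + cnj (p k) * p i"]
    by (auto simp: angle_anti_def mult.commute)
qed

lemma angle_anti_swap: "i \<noteq> k \<Longrightarrow> angle_anti k i = - angle_anti i k"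
  by (auto simp: angle_anti_def)

end

text \<open>The square relation is applied to \<open>e i j s - e k l t\<close> and to
  \<open>1 + cnj (e i j s) * e k l t\<close>. Replacing a base point by its antipode turns
  \<open>XA\<close> into \<open>- XB\<close> and \<open>XB\<close> into \<open>- XA\<close>. Hence
  \<open>XA - XB\<close> does not feel the twist of \<open>k l\<close>, while \<open>XA + XB\<close>
  changes sign with the twist of \<open>i j\<close>; this dictates the combination.\<close>

lemma drawing_equation:
  assumes d: "projective_drawing n adj p y e"
  defines "XA \<equiv> \<lambda>i j k. angle_change (\<lambda>t. e i j t - p k)"
    and "XB \<equiv> \<lambda>i j k. angle_change (\<lambda>t. 1 + cnj (e i j t) * p k)"
  assumes ij: "i < j" "j < n" "adj i j" and kl: "k < l" "l < n" "adj k l"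
    and dis: "{i, j} \<inter> {k, l} = {}"
  shows "(XA k l i + XB k l i) - (if y i j then -1 else 1) * (XA k l j + XB k l j)
         - (XA i j k + XB i j k) + (XA i j l + XB i j l) + 2 * (XB i j k - XB i j l) = 0"
proof -
  have nz: "p a \<noteq> 0" if "a < n" for a using d that unfolding projective_drawing_def by auto
  have cont: "continuous_on {0..1} (e i j)" "continuous_on {0..1} (e k l)"
    and ends: "e i j 0 = p i" "e i j 1 = twist (y i j) (p j)" "e k l 0 = p k" "e k l 1 = twist (y k l) (p l)"
    using d ij kl unfolding projective_drawing_def by blast+
  have "e i j t \<noteq> p a \<and> 1 + cnj (e i j t) * p a \<noteq> 0" if "t \<in> {0..1}" "a < n" "a \<notin> {i, j}" for t a
    using d ij that eq_antipode_iff[OF nz[OF that(2)], of "e i j t"] unfolding projective_drawing_def by blast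
  moreover have "e k l t \<noteq> p a \<and> 1 + cnj (e k l t) * p a \<noteq> 0" if "t \<in> {0..1}" "a < n" "a \<notin> {k, l}" for t a
    using d kl that eq_antipode_iff[OF nz[OF that(2)], of "e k l t"] unfolding projective_drawing_def by blast
  moreover have "i < n" "k < n" "k \<notin> {i, j}" "l \<notin> {i, j}" "i \<notin> {k, l}" "j \<notin> {k, l}" using ij kl dis by auto
  ultimately have av: "e i j t \<noteq> p k" "e i j t \<noteq> p l" "e k l t \<noteq> p i" "e k l t \<noteq> p j"
     "1 + cnj (e i j t) * p k \<noteq> 0" "1 + cnj (e i j t) * p l \<noteq> 0"
     "1 + cnj (e k l t) * p i \<noteq> 0" "1 + cnj (e k l t) * p j \<noteq> 0" if "t \<in> {0..1}" for t
    using that ij(2) kl(2) by blast+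
  have "\<forall>i j k l. i < j \<and> j < n \<and> adj i j \<and> k < l \<and> l < n \<and> adj k l \<and> {i, j} \<inter> {k, l} = {} \<longrightarrow>
        (\<forall>s\<in>{0..1}. \<forall>t\<in>{0..1}. e i j s \<noteq> e k l t \<and> 1 + cnj (e i j s) * e k l t \<noteq> 0)"
    using d unfolding projective_drawing_def by (elim conjE)
  then have ind: "e i j s \<noteq> e k l t" "1 + cnj (e i j s) * e k l t \<noteq> 0" if "s \<in> {0..1}" "t \<in> {0..1}" for s t
    using ij kl dis that by auto
  \<comment> \<open>The difference f - antipode u equals cnj (1 + cnj f * u) / cnj u, so it turns
    like a conjugate.\<close>
  have twA: "angle_change (\<lambda>s. f s - twist b u) =
      (if b then - angle_change (\<lambda>s. 1 + cnj (f s) * u) else angle_change (\<lambda>s. f s - u))"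
    if "continuous_on {0..1} f" "u \<noteq> 0" "\<And>s. s \<in> {0..1} \<Longrightarrow> 1 + cnj (f s) * u \<noteq> 0" for f b u
  proof (cases b)
    case True
    have "angle_change (\<lambda>s. f s - twist b u) = angle_change (\<lambda>s. (1 / cnj u) * cnj (1 + cnj (f s) * u))"
      by (rule angle_change_cong) (use True that in \<open>simp add: twist_def antipode_def field_simps\<close>)
    also have "\<dots> = angle_change (\<lambda>s. cnj (1 + cnj (f s) * u))"
      by (rule angle_change_const_mult)
         (use that in \<open>auto intro!: continuous_intros simp del: complex_cnj_add complex_cnj_mult\<close>)
    also have "\<dots> = - angle_change (\<lambda>s. 1 + cnj (f s) * u)"
      by (rule angle_change_cnj) (use that in \<open>auto intro!: continuous_intros\<close>)
    finally show ?thesis using True by simp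
  qed (simp add: twist_def)
  have twB: "angle_change (\<lambda>s. 1 + cnj (f s) * twist b u) =
      (if b then - angle_change (\<lambda>s. f s - u) else angle_change (\<lambda>s. 1 + cnj (f s) * u))"
    if "continuous_on {0..1} f" "u \<noteq> 0" "\<And>s. s \<in> {0..1} \<Longrightarrow> f s \<noteq> u" for f b u
  proof (cases b)
    case True
    have "angle_change (\<lambda>s. 1 + cnj (f s) * twist b u) = angle_change (\<lambda>s. (- 1 / cnj u) * cnj (f s - u))"
      by (rule angle_change_cong) (use True that in \<open>simp add: twist_def antipode_def field_simps\<close>)
    also have "\<dots> = angle_change (\<lambda>s. cnj (f s - u))"
      by (rule angle_change_const_mult)
         (use that in \<open>auto intro!: continuous_intros simp del: complex_cnj_diff\<close>)
    also have "\<dots> = - angle_change (\<lambda>s. f s - u)"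
      by (rule angle_change_cnj) (use that in \<open>auto intro!: continuous_intros\<close>)
    finally show ?thesis using True by simp
  qed (simp add: twist_def)
  have c1: "continuous_on ({0..1} \<times> {0..1}) (\<lambda>z. e i j (fst z))"
    by (rule continuous_on_compose2[OF cont(1)]) (auto intro!: continuous_intros)
  have c2: "continuous_on ({0..1} \<times> {0..1}) (\<lambda>z. e k l (snd z))"
    by (rule continuous_on_compose2[OF cont(2)]) (auto intro!: continuous_intros)
  have sqA: "angle_change (\<lambda>s. e i j s - e k l 0) + angle_change (\<lambda>t. e i j 1 - e k l t) =
     angle_change (\<lambda>s. e i j s - e k l 1) + angle_change (\<lambda>t. e i j 0 - e k l t)"
    by (rule angle_change_square[where F="\<lambda>s t. e i j s - e k l t"])
       (use c1 c2 ind in \<open>auto simp: case_prod_unfold intro!: continuous_intros\<close>)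
  have sqB: "angle_change (\<lambda>s. 1 + cnj (e i j s) * e k l 0) + angle_change (\<lambda>t. 1 + cnj (e i j 1) * e k l t) =
     angle_change (\<lambda>s. 1 + cnj (e i j s) * e k l 1) + angle_change (\<lambda>t. 1 + cnj (e i j 0) * e k l t)"
    by (rule angle_change_square[where F="\<lambda>s t. 1 + cnj (e i j s) * e k l t"])
       (use c1 c2 ind in \<open>auto simp: case_prod_unfold intro!: continuous_intros\<close>)
  have swA: "angle_change (\<lambda>t. u - e k l t) = angle_change (\<lambda>t. e k l t - u)"
    if "\<And>t. t \<in> {0..1} \<Longrightarrow> e k l t \<noteq> u" for u
  proof -
    have "angle_change (\<lambda>t. (- 1) * (e k l t - u)) = angle_change (\<lambda>t. e k l t - u)"
      by (rule angle_change_const_mult) (use that cont in \<open>auto intro!: continuous_intros\<close>)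
    then show ?thesis by simp
  qed
  have swB: "angle_change (\<lambda>t. 1 + cnj u * e k l t) = - angle_change (\<lambda>t. 1 + cnj (e k l t) * u)"
    if "\<And>t. t \<in> {0..1} \<Longrightarrow> 1 + cnj u * e k l t \<noteq> 0" for u
  proof -
    have "1 + cnj (e k l t) * u \<noteq> 0" if t: "t \<in> {0..1}" for t
    proof
      assume "1 + cnj (e k l t) * u = 0"
      then have "cnj (1 + cnj (e k l t) * u) = 0" by simp
      then show False using \<open>\<And>t. t \<in> {0..1} \<Longrightarrow> 1 + cnj u * e k l t \<noteq> 0\<close>[OF t] by (simp add: mult.commute)
    qed
    then have "angle_change (\<lambda>t. cnj (1 + cnj (e k l t) * u)) = - angle_change (\<lambda>t. 1 + cnj (e k l t) * u)"
      by (intro angle_change_cnj) (use cont in \<open>auto intro!: continuous_intros\<close>)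
    then show ?thesis by (simp add: mult.commute)
  qed
  have nz4: "p i \<noteq> 0" "p j \<noteq> 0" "p k \<noteq> 0" "p l \<noteq> 0" using nz ij kl by auto
  \<comment> \<open>The values of \<open>XA\<close> and \<open>XB\<close> when the base point is
    replaced by its antipode in case \<open>b\<close>.\<close>
  define A where "A = (\<lambda>b i j k. if b then - XB i j k else XA i j k)"
  define B where "B = (\<lambda>b i j k. if b then - XA i j k else XB i j k)"
  have tA: "angle_change (\<lambda>s. e i j s - twist b (p l)) = A b i j l"
     "angle_change (\<lambda>t. e k l t - twist b (p j)) = A b k l j" for b
    unfolding A_def XA_def XB_def by (rule twA; use cont nz4 av in simp)+
  have tB: "angle_change (\<lambda>s. 1 + cnj (e i j s) * twist b (p l)) = B b i j l"
     "angle_change (\<lambda>t. 1 + cnj (e k l t) * twist b (p j)) = B b k l j" for b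
    unfolding B_def XA_def XB_def by (rule twB; use cont nz4 av in simp)+
  have "angle_change (\<lambda>t. e i j 1 - e k l t) = A (y i j) k l j"
    "angle_change (\<lambda>t. e i j 0 - e k l t) = XA k l i"
    using swA[of "e i j 1"] swA[of "e i j 0"] ind(1)[of 1] ind(1)[of 0] tA(2)
    by (auto simp: ends XA_def dest: not_sym)
  moreover have "angle_change (\<lambda>t. 1 + cnj (e i j 1) * e k l t) = - B (y i j) k l j"
    "angle_change (\<lambda>t. 1 + cnj (e i j 0) * e k l t) = - XB k l i"
    using swB[of "e i j 1"] swB[of "e i j 0"] ind(2)[of 1] ind(2)[of 0] tB(2)
    by (auto simp: ends XB_def)
  ultimately have eA: "XA i j k + A (y i j) k l j = A (y k l) i j l + XA k l i"
    and eB: "XB i j k - B (y i j) k l j = B (y k l) i j l - XB k l i"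
    using sqA sqB tA(1) tB(1) by (simp_all add: ends XA_def XB_def)
  \<comment> \<open>This is \<open>eB\<close> minus \<open>eA\<close>: the terms with base point
    \<open>l\<close> enter as A - B, those with base point \<open>j\<close> as A + B.\<close>
  show ?thesis using eA eB by (auto simp: A_def B_def split: if_splits)
qed

lemma even_rearrange:
  fixes a b c d e p q r t u s :: int
  assumes "a - s * (b + p - q) - c + d + 2 * e - r + t + u = 0" "s = 1 \<or> s = - 1"
  shows "even (c + d + a + b + u + (t + r + p + q))"
  using assms(2)
proof
  assume "s = 1"
  then have "c + d + a + b + u + (t + r + p + q) = 2 * (c - e + r + p + b)" using assms(1) by simp
  then show ?thesis by (simp only: dvd_triv_left)
next
  assume "s = - 1"
  then have "c + d + a + b + u + (t + r + p + q) = 2 * (c - e + r + q)" using assms(1) by simp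
  then show ?thesis by (simp only: dvd_triv_left)
qed

text \<open>\<open>c i j k\<close> is the sum of two integers by which the angle changes of edge
  \<open>i j\<close>, seen from vertex \<open>k\<close> and from its antipode, deviate from fixed
  reference angles. In \<open>drawing_equation\<close> the reference angles telescope. What survives
  modulo 2 are the integers from swapping, giving \<open>pos_after\<close>, and, if both edges are
  twisted, a unit from the minus sign in \<open>antipode\<close>.\<close>

theorem drawing_parity:
  assumes d: "projective_drawing n adj p y e"
  obtains c :: "nat \<Rightarrow> nat \<Rightarrow> nat \<Rightarrow> int" where
    "\<And>i j k l. i < j \<Longrightarrow> j < n \<Longrightarrow> adj i j \<Longrightarrow> k < l \<Longrightarrow> l < n \<Longrightarrow> adj k l \<Longrightarrow> {i, j} \<inter> {k, l} = {} \<Longrightarrow>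
       even (c i j k + c i j l + c k l i + c k l j + of_bool (y i j \<and> y k l)
             + (pos_after i k + pos_after i l + pos_after j k + pos_after j l))"
proof -
  define XA where "XA = (\<lambda>i j k. angle_change (\<lambda>t. e i j t - p k))"
  define XB where "XB = (\<lambda>i j k. angle_change (\<lambda>t. 1 + cnj (e i j t) * p k))"
  define a where "a = angle_diff p"
  define b where "b = angle_anti p"
  define \<beta> where "\<beta> j = Arg (p j) / (2 * pi)" for j
  have nz: "p i \<noteq> 0" if "i < n" for i using d that unfolding projective_drawing_def by auto
  have pp: "p i \<noteq> p k" "p i \<noteq> antipode (p k)" if "i < n" "k < n" "i \<noteq> k" for i k
    using d that unfolding projective_drawing_def by auto
  have pp2: "1 + cnj (p i) * p k \<noteq> 0" if "i < n" "k < n" "i \<noteq> k" for i k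
    using pp(2)[OF that] eq_antipode_iff[OF nz[OF that(2)]] by blast
  \<comment> \<open>The floor merely names an integer: \<open>angle_change_ends\<close> shows its
    argument to be one already.\<close>
  define m where "m i j k = \<lfloor>XA i j k - ((if y i j then 1 / 2 + b j k + \<beta> j else a j k) - a i k)\<rfloor>" for i j k
  define m' where "m' i j k = \<lfloor>XB i j k - ((if y i j then a j k - \<beta> j else b j k) - b i k)\<rfloor>" for i j k
  have m: "XA i j k = (if y i j then 1 / 2 + b j k + \<beta> j else a j k) - a i k + of_int (m i j k)"
      "XB i j k = (if y i j then a j k - \<beta> j else b j k) - b i k + of_int (m' i j k)"
    if ij: "i < j" "j < n" "adj i j" "k < n" "k \<noteq> i" "k \<noteq> j" for i j k
  proof -
    have cont: "continuous_on {0..1} (e i j)" and ends: "e i j 0 = p i" "e i j 1 = twist (y i j) (p j)"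
      and av: "\<And>t. t \<in> {0..1} \<Longrightarrow> e i j t \<noteq> p k" "\<And>t. t \<in> {0..1} \<Longrightarrow> e i j t \<noteq> antipode (p k)"
      using d ij unfolding projective_drawing_def by auto
    have av2: "1 + cnj (e i j t) * p k \<noteq> 0" if "t \<in> {0..1}" for t
      using av(2)[OF that] eq_antipode_iff[OF nz[OF ij(4)]] by blast
    have neq: "i < n" "k < n" "i \<noteq> k" "j \<noteq> k" using ij by auto
    have hb: "has_angle (p j) (\<beta> j)" unfolding \<beta>_def by (rule has_angle_Arg) (rule nz[OF ij(2)])
    have ha: "has_angle (p j - p k) (a j k)" unfolding a_def by (rule has_angle_diff) (rule pp(1)[OF ij(2) neq(2) neq(4)])
    have hB: "has_angle (1 + cnj (p j) * p k) (b j k)" unfolding b_def by (rule has_angle_anti) (rule pp2[OF ij(2) neq(2) neq(4)])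
    have nzj: "p j \<noteq> 0" using nz ij by auto
    have "antipode (p j) - p k = - ((1 + cnj (p j) * p k) / cnj (p j))"
      using nzj by (simp add: antipode_def field_simps)
    then have "has_angle (antipode (p j) - p k) (b j k - - \<beta> j + 1 / 2)"
      using has_angle_uminus[OF has_angle_divide[OF hB has_angle_cnj[OF hb]]] by simp
    then have 1: "has_angle (twist (y i j) (p j) - p k) (if y i j then 1 / 2 + b j k + \<beta> j else a j k)"
      using ha by (auto simp: twist_def algebra_simps)
    have "1 + cnj (antipode (p j)) * p k = (p j - p k) / p j"
      using nzj by (simp add: antipode_def field_simps)
    then have "has_angle (1 + cnj (antipode (p j)) * p k) (a j k - \<beta> j)"
      using has_angle_divide[OF ha hb] by simp
    then have 2: "has_angle (1 + cnj (twist (y i j) (p j)) * p k) (if y i j then a j k - \<beta> j else b j k)"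
      using hB by (auto simp: twist_def)
    have 3: "has_angle (p i - p k) (a i k)" unfolding a_def by (rule has_angle_diff) (rule pp(1)[OF neq(1-3)])
    have 4: "has_angle (1 + cnj (p i) * p k) (b i k)" unfolding b_def by (rule has_angle_anti) (rule pp2[OF neq(1-3)])
    have "XA i j k - ((if y i j then 1 / 2 + b j k + \<beta> j else a j k) - a i k) \<in> \<int>"
      unfolding XA_def by (rule angle_change_ends) (use cont av 1 3 in \<open>auto intro!: continuous_intros simp: ends\<close>)
    moreover have "XB i j k - ((if y i j then a j k - \<beta> j else b j k) - b i k) \<in> \<int>"
      unfolding XB_def by (rule angle_change_ends) (use cont av2 2 4 in \<open>auto intro!: continuous_intros simp: ends\<close>)
    ultimately show "XA i j k = (if y i j then 1 / 2 + b j k + \<beta> j else a j k) - a i k + of_int (m i j k)"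
      "XB i j k = (if y i j then a j k - \<beta> j else b j k) - b i k + of_int (m' i j k)"
      unfolding m_def m'_def by (simp_all only: of_int_floor)
  qed
  show ?thesis
  proof (rule that[of "\<lambda>i j k. m i j k + m' i j k"])
    fix i j k l assume ij: "i < j" "j < n" "adj i j" and kl: "k < l" "l < n" "adj k l"
      and dis: "{i, j} \<inter> {k, l} = {}"
    have ne: "i < n" "k < n" "i \<noteq> k" "i \<noteq> l" "j \<noteq> k" "j \<noteq> l" using ij kl dis by auto
    have sa: "a k i = a i k + 1 / 2 - of_int (pos_after i k)" "a l i = a i l + 1 / 2 - of_int (pos_after i l)"
      "a k j = a j k + 1 / 2 - of_int (pos_after j k)" "a l j = a j l + 1 / 2 - of_int (pos_after j l)"
      unfolding a_def by (rule angle_diff_swap; use ne in simp)+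
    have sb: "b k i = - b i k" "b l i = - b i l" "b k j = - b j k" "b l j = - b j l"
      unfolding b_def by (rule angle_anti_swap; use ne in simp)+
    have eq: "(XA k l i + XB k l i) - (if y i j then -1 else 1) * (XA k l j + XB k l j)
         - (XA i j k + XB i j k) + (XA i j l + XB i j l) + 2 * (XB i j k - XB i j l) = 0"
      using drawing_equation[OF d ij kl dis] by (simp only: XA_def XB_def)
    have mm: "XA i j k = (if y i j then 1 / 2 + b j k + \<beta> j else a j k) - a i k + of_int (m i j k)"
      "XB i j k = (if y i j then a j k - \<beta> j else b j k) - b i k + of_int (m' i j k)"
      "XA i j l = (if y i j then 1 / 2 + b j l + \<beta> j else a j l) - a i l + of_int (m i j l)"
      "XB i j l = (if y i j then a j l - \<beta> j else b j l) - b i l + of_int (m' i j l)"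
      "XA k l i = (if y k l then 1 / 2 + b l i + \<beta> l else a l i) - a k i + of_int (m k l i)"
      "XB k l i = (if y k l then a l i - \<beta> l else b l i) - b k i + of_int (m' k l i)"
      "XA k l j = (if y k l then 1 / 2 + b l j + \<beta> l else a l j) - a k j + of_int (m k l j)"
      "XB k l j = (if y k l then a l j - \<beta> l else b l j) - b k j + of_int (m' k l j)"
      by (rule m; use ij kl ne in simp)+
    define M where "M i j k = m i j k + m' i j k" for i j k
    have "real_of_int (M k l i - (if y i j then -1 else 1) * (M k l j + pos_after j k - pos_after j l)
            - M i j k + M i j l + 2 * (m' i j k - m' i j l)
            - pos_after i l + pos_after i k + of_bool (y i j \<and> y k l)) = 0"
      using eq unfolding mm sa sb M_def
      by (cases "y i j"; cases "y k l"; simp add: algebra_simps)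
    then have *: "M k l i - (if y i j then -1 else 1) * (M k l j + pos_after j k - pos_after j l)
            - M i j k + M i j l + 2 * (m' i j k - m' i j l)
            - pos_after i l + pos_after i k + of_bool (y i j \<and> y k l) = 0"
      by (simp only: of_int_eq_0_iff)
    have "even (M i j k + M i j l + M k l i + M k l j + of_bool (y i j \<and> y k l)
             + (pos_after i k + pos_after i l + pos_after j k + pos_after j l))"
      by (rule even_rearrange[OF *]) simp
    then show "even (m i j k + m' i j k + (m i j l + m' i j l) + (m k l i + m' k l i) + (m k l j + m' k l j) +
              of_bool (y i j \<and> y k l) + (pos_after i k + pos_after i l + pos_after j k + pos_after j l))"
      unfolding M_def .
  qed
qed

section \<open>Parity contradictions for K5, K7 minus a 4-cycle, and two K5's\<close>

lemma odd_of_bool3: "odd (of_bool a + of_bool b + of_bool d :: int) \<longleftrightarrow> ((a \<noteq> b) \<noteq> d)"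
  by (cases a; cases b; cases d; simp)

context
  fixes c :: "nat \<Rightarrow> nat \<Rightarrow> nat \<Rightarrow> int" and y adj :: "nat \<Rightarrow> nat \<Rightarrow> bool" and n :: nat
  assumes parity: "\<And>i j k l. i < j \<Longrightarrow> j < n \<Longrightarrow> adj i j \<Longrightarrow> k < l \<Longrightarrow> l < n \<Longrightarrow> adj k l \<Longrightarrow>
      {i, j} \<inter> {k, l} = {} \<Longrightarrow>
      even (c i j k + c i j l + c k l i + c k l j + of_bool (y i j \<and> y k l)
             + (pos_after i k + pos_after i l + pos_after j k + pos_after j l))"
begin

text \<open>Of the three perfect matchings on four ordered vertices exactly one interleaves,
  \<open>i k\<close> with \<open>j l\<close>; this is the final 1.\<close>

lemma parity_K4:
  assumes "i < j" "j < k" "k < l" "l < n"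
    and "adj i j" "adj i k" "adj i l" "adj j k" "adj j l" "adj k l"
  shows "even ((c i j k + c i j l + c k l i + c k l j) + (c i k j + c i k l + c j l i + c j l k)
    + (c i l j + c i l k + c j k i + c j k l)
    + (of_bool (y i j \<and> y k l) + of_bool (y i k \<and> y j l) + of_bool (y i l \<and> y j k)) + 1)"
proof -
  have 1: "even (c i j k + c i j l + c k l i + c k l j + of_bool (y i j \<and> y k l) + 0)"
    using parity[of i j k l] assms by (simp add: pos_after_def)
  have 2: "even (c i k j + c i k l + c j l i + c j l k + of_bool (y i k \<and> y j l) + 1)"
    using parity[of i k j l] assms by (simp add: pos_after_def)
  have 3: "even (c i l j + c i l k + c j k i + c j k l + of_bool (y i l \<and> y j k) + 0)"
    using parity[of i l j k] assms by (simp add: pos_after_def)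
  have "(c i j k + c i j l + c k l i + c k l j) + (c i k j + c i k l + c j l i + c j l k)
    + (c i l j + c i l k + c j k i + c j k l)
    + (of_bool (y i j \<and> y k l) + of_bool (y i k \<and> y j l) + of_bool (y i l \<and> y j k)) + 1 =
     (c i j k + c i j l + c k l i + c k l j + of_bool (y i j \<and> y k l) + 0) +
     (c i k j + c i k l + c j l i + c j l k + of_bool (y i k \<and> y j l) + 1) +
     (c i l j + c i l k + c j k i + c j k l + of_bool (y i l \<and> y j k) + 0)"
    by (simp only: algebra_simps add_0_right add_0_left)
  then show ?thesis using dvd_add[OF dvd_add[OF 1 2] 3] by (simp only:)
qed

text \<open>The five K4's are added up. An edge and a vertex off it lie together in two of them, so
  every \<open>c\<close> cancels modulo 2, and the five crossings leave 1. Edges at \<open>v\<close>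
  are untwisted, so products of twists survive only in the K4 that avoids \<open>v\<close>.\<close>

lemma parity_K5:
  assumes ord: "v < i" "i < j" "j < k" "k < l" "l < n"
    and adj: "adj v i" "adj v j" "adj v k" "adj v l"
      "adj i j" "adj i k" "adj i l" "adj j k" "adj j l" "adj k l"
    and y: "\<not> y v i" "\<not> y v j" "\<not> y v k" "\<not> y v l"
  shows "odd (of_bool (y i j \<and> y k l) + of_bool (y i k \<and> y j l) + of_bool (y i l \<and> y j k) :: int)"
proof -
  let ?Y = "of_bool (y i j \<and> y k l) + of_bool (y i k \<and> y j l) + of_bool (y i l \<and> y j k) :: int"
  let ?q = "\<lambda>i j k l. c i j k + c i j l + c k l i + c k l j"
  let ?Q = "\<lambda>i j k l. ?q i j k l + ?q i k j l + ?q i l j k"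
  have 1: "even (?Q i j k l + ?Y + 1)"
    using parity_K4[of i j k l] assms by (simp only:) 
  have 2: "even (?Q v j k l + 0 + 1)" using parity_K4[of v j k l] assms by simp
  have 3: "even (?Q v i k l + 0 + 1)" using parity_K4[of v i k l] assms by simp
  have 4: "even (?Q v i j l + 0 + 1)" using parity_K4[of v i j l] assms by simp
  have 5: "even (?Q v i j k + 0 + 1)" using parity_K4[of v i j k] assms by simp
  define D where "D = c i j k + c i j l + c i k j + c i k l + c i l j + c i l k + c j k i + c j k l
     + c j l i + c j l k + c k l i + c k l j + c i j v + c i k v + c i l v + c j k v + c j l v + c k l v
     + c v i j + c v i k + c v i l + c v j i + c v j k + c v j l + c v k i + c v k j + c v k l
     + c v l i + c v l j + c v l k + 2"
  have "(?Q i j k l + ?Y + 1) + (?Q v j k l + 0 + 1) + (?Q v i k l + 0 + 1) + (?Q v i j l + 0 + 1)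
     + (?Q v i j k + 0 + 1) = 2 * D + (?Y + 1)"
    unfolding D_def by simp
  then have "even (2 * D + (?Y + 1))"
    using dvd_add[OF dvd_add[OF dvd_add[OF dvd_add[OF 1 2] 3] 4] 5] by (simp only:)
  then have "even (?Y + 1)" by (metis dvd_add_right_iff dvd_triv_left)
  then show ?thesis using even_plus_one_iff by blast
qed

text \<open>Two disjoint closed curves in the projective plane cannot both be one-sided. Over the
  nine pairs of edges every \<open>c\<close> occurs twice and every position term four times, and
  the products of twists add up to the product of the two total twists.\<close>

lemma parity_triangles:
  assumes "i < j" "j < k" "k < n" "adj i j" "adj i k" "adj j k"
    and "p < q" "q < r" "r < n" "adj p q" "adj p r" "adj q r"
    and dis: "{i, j, k} \<inter> {p, q, r} = {}"
  shows "\<not> ((y i j \<noteq> y i k) \<noteq> y j k) \<or> \<not> ((y p q \<noteq> y p r) \<noteq> y q r)"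
proof -
  define P where "P i p = pos_after i p" for i p
  let ?e = "\<lambda>i j k l. c i j k + c i j l + c k l i + c k l j + of_bool (y i j \<and> y k l)
             + (P i k + P i l + P j k + P j l)"
  have e: "even (?e a b d e)" if "(a, b) \<in> {(i, j), (i, k), (j, k)}" "(d, e) \<in> {(p, q), (p, r), (q, r)}" for a b d e
  proof -
    have "a < b \<and> b < n \<and> adj a b \<and> {a, b} \<subseteq> {i, j, k}"
      using that(1) \<open>i < j\<close> \<open>j < k\<close> \<open>k < n\<close> \<open>adj i j\<close> \<open>adj i k\<close> \<open>adj j k\<close> by auto
    moreover have "d < e \<and> e < n \<and> adj d e \<and> {d, e} \<subseteq> {p, q, r}"
      using that(2) \<open>p < q\<close> \<open>q < r\<close> \<open>r < n\<close> \<open>adj p q\<close> \<open>adj p r\<close> \<open>adj q r\<close> by auto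
    ultimately have "a < b" "b < n" "adj a b" "d < e" "e < n" "adj d e" "{a, b} \<inter> {d, e} = {}"
      using dis by blast+
    then show ?thesis unfolding P_def by (rule parity)
  qed
  let ?T = "\<lambda>d e. ?e i j d e + ?e i k d e + ?e j k d e"
  have e3: "even (?T d e)" if "(d, e) \<in> {(p, q), (p, r), (q, r)}" for d e
    by (rule dvd_add[OF dvd_add]; rule e; use that in simp)
  have T: "even (?T p q + ?T p r + ?T q r)"
    by (rule dvd_add[OF dvd_add]; rule e3; simp)
  define C where "C v = c i j v + c i k v + c j k v" for v
  define R where "R d e = c d e i + c d e j + c d e k + (P i d + P j d + P k d) + (P i e + P j e + P k e)" for d e
  define Z :: "nat \<Rightarrow> nat \<Rightarrow> int" where
    "Z d e = of_bool (y i j \<and> y d e) + of_bool (y i k \<and> y d e) + of_bool (y j k \<and> y d e)" for d e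
  define D where "D = C p + C q + C r + R p q + R p r + R q r"
  define Y where "Y = Z p q + Z p r + Z q r"
  have "?T d e = C d + C e + 2 * R d e + Z d e" for d e
    unfolding C_def R_def Z_def by (simp only: algebra_simps mult_2)
  then have "?T p q + ?T p r + ?T q r = 2 * D + Y" unfolding D_def Y_def by simp
  then have "even (2 * D + Y)" using T by (simp only:)
  then have "even Y" by (metis dvd_add_right_iff dvd_triv_left)
  then show ?thesis unfolding Y_def Z_def
    by (cases "y i j"; cases "y i k"; cases "y j k"; cases "y p q"; cases "y p r"; cases "y q r"; simp)
qed

end

text \<open>The absent edges join 3, 4 to 5, 6. \<open>parity_K5\<close> on 0, 1, 2, 3, 4 and on 0,
  1, 2, 5, 6 contradicts the listed pairs of disjoint triangles, as a propositional formula in the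
  twists.\<close>

theorem no_projective_drawing_K7_minus_C4:
  assumes d: "projective_drawing 7 adj p y e"
    and y: "\<And>j. 0 < j \<Longrightarrow> j < 7 \<Longrightarrow> \<not> y 0 j"
    and adj: "\<And>i j. i < j \<Longrightarrow> j < 7 \<Longrightarrow> \<not> (i \<in> {3, 4} \<and> j \<in> {5, 6}) \<Longrightarrow> adj i j"
  shows False
proof -
  obtain c :: "nat \<Rightarrow> nat \<Rightarrow> nat \<Rightarrow> int" where c:
    "\<And>i j k l. i < j \<Longrightarrow> j < 7 \<Longrightarrow> adj i j \<Longrightarrow> k < l \<Longrightarrow> l < 7 \<Longrightarrow> adj k l \<Longrightarrow> {i, j} \<inter> {k, l} = {} \<Longrightarrow>
       even (c i j k + c i j l + c k l i + c k l j + of_bool (y i j \<and> y k l)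
             + (pos_after i k + pos_after i l + pos_after j k + pos_after j l))"
    using drawing_parity[OF d] by blast
  have K: "odd (of_bool (y 1 2 \<and> y 3 4) + of_bool (y 1 3 \<and> y 2 4) + of_bool (y 1 4 \<and> y 2 3) :: int)"
     "odd (of_bool (y 1 2 \<and> y 5 6) + of_bool (y 1 5 \<and> y 2 6) + of_bool (y 1 6 \<and> y 2 5) :: int)"
    using parity_K5[where c=c and y=y and adj=adj and n=7, OF c, of 0 1 2 3 4]
      parity_K5[where c=c and y=y and adj=adj and n=7, OF c, of 0 1 2 5 6] by (simp_all add: y adj)
  have T: "\<not> ((y i j \<noteq> y i k) \<noteq> y j k) \<or> \<not> ((y p q \<noteq> y p r) \<noteq> y q r)"
    if "i < j" "j < k" "k < 7" "p < q" "q < r" "r < 7" "{i, j, k} \<inter> {p, q, r} = {}"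
       "\<not> (i \<in> {3, 4} \<and> j \<in> {5, 6})" "\<not> (i \<in> {3, 4} \<and> k \<in> {5, 6})" "\<not> (j \<in> {3, 4} \<and> k \<in> {5, 6})"
       "\<not> (p \<in> {3, 4} \<and> q \<in> {5, 6})" "\<not> (p \<in> {3, 4} \<and> r \<in> {5, 6})" "\<not> (q \<in> {3, 4} \<and> r \<in> {5, 6})" for i j k p q r
  proof -
    note that(1-7)
    moreover have "j < 7" "i < 7" "p < 7" "q < 7" "i < k" "p < r" using that(1-6) by linarith+
    moreover have "adj i j" "adj i k" "adj j k" "adj p q" "adj p r" "adj q r"
      by (rule adj; (rule that calculation)+)+
    ultimately show ?thesis
      by (intro parity_triangles[where c=c and y=y and adj=adj and n=7, OF c])
  qed
  have "\<not> y 0 1" "\<not> y 0 2" "\<not> y 0 3" "\<not> y 0 4" "\<not> y 0 5" "\<not> y 0 6" using y by simp_all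
  moreover have "\<not> ((y 0 1 \<noteq> y 0 3) \<noteq> y 1 3) \<or> \<not> ((y 2 5 \<noteq> y 2 6) \<noteq> y 5 6)"
    "\<not> ((y 0 1 \<noteq> y 0 4) \<noteq> y 1 4) \<or> \<not> ((y 2 5 \<noteq> y 2 6) \<noteq> y 5 6)"
    "\<not> ((y 0 1 \<noteq> y 0 5) \<noteq> y 1 5) \<or> \<not> ((y 2 3 \<noteq> y 2 4) \<noteq> y 3 4)"
    "\<not> ((y 0 1 \<noteq> y 0 6) \<noteq> y 1 6) \<or> \<not> ((y 2 3 \<noteq> y 2 4) \<noteq> y 3 4)"
    "\<not> ((y 0 2 \<noteq> y 0 3) \<noteq> y 2 3) \<or> \<not> ((y 1 5 \<noteq> y 1 6) \<noteq> y 5 6)"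
    "\<not> ((y 0 2 \<noteq> y 0 4) \<noteq> y 2 4) \<or> \<not> ((y 1 5 \<noteq> y 1 6) \<noteq> y 5 6)"
    "\<not> ((y 0 2 \<noteq> y 0 5) \<noteq> y 2 5) \<or> \<not> ((y 1 3 \<noteq> y 1 4) \<noteq> y 3 4)"
    "\<not> ((y 0 2 \<noteq> y 0 6) \<noteq> y 2 6) \<or> \<not> ((y 1 3 \<noteq> y 1 4) \<noteq> y 3 4)"
    "\<not> ((y 0 3 \<noteq> y 0 4) \<noteq> y 3 4) \<or> \<not> ((y 1 2 \<noteq> y 1 5) \<noteq> y 2 5)"
    "\<not> ((y 0 3 \<noteq> y 0 4) \<noteq> y 3 4) \<or> \<not> ((y 1 2 \<noteq> y 1 6) \<noteq> y 2 6)"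
    "\<not> ((y 0 3 \<noteq> y 0 4) \<noteq> y 3 4) \<or> \<not> ((y 1 5 \<noteq> y 1 6) \<noteq> y 5 6)"
    "\<not> ((y 0 3 \<noteq> y 0 4) \<noteq> y 3 4) \<or> \<not> ((y 2 5 \<noteq> y 2 6) \<noteq> y 5 6)"
    "\<not> ((y 0 5 \<noteq> y 0 6) \<noteq> y 5 6) \<or> \<not> ((y 1 2 \<noteq> y 1 3) \<noteq> y 2 3)"
    "\<not> ((y 0 5 \<noteq> y 0 6) \<noteq> y 5 6) \<or> \<not> ((y 1 2 \<noteq> y 1 4) \<noteq> y 2 4)"
    "\<not> ((y 0 5 \<noteq> y 0 6) \<noteq> y 5 6) \<or> \<not> ((y 1 3 \<noteq> y 1 4) \<noteq> y 3 4)"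
    "\<not> ((y 0 5 \<noteq> y 0 6) \<noteq> y 5 6) \<or> \<not> ((y 2 3 \<noteq> y 2 4) \<noteq> y 3 4)"
    "\<not> ((y 1 3 \<noteq> y 1 4) \<noteq> y 3 4) \<or> \<not> ((y 2 5 \<noteq> y 2 6) \<noteq> y 5 6)"
    "\<not> ((y 1 5 \<noteq> y 1 6) \<noteq> y 5 6) \<or> \<not> ((y 2 3 \<noteq> y 2 4) \<noteq> y 3 4)"
    by (rule T; simp)+
  moreover note K[unfolded odd_of_bool3]
  ultimately show False by sat
qed

text \<open>If all triangles of a K4 are two-sided, its twisted edges form a cut, and a cut contains
  both edges of an even number of matchings, against \<open>parity_K5\<close>. So each of the K4's
  on 1 to 4 and on 5 to 8 has a one-sided triangle, and these two are disjoint.\<close>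

theorem no_projective_drawing_two_K5:
  assumes d: "projective_drawing 9 adj p y e"
    and y: "\<And>j. 0 < j \<Longrightarrow> j < 9 \<Longrightarrow> \<not> y 0 j"
    and adj: "\<And>i j. i < j \<Longrightarrow> j < 9 \<Longrightarrow> i = 0 \<or> j \<le> 4 \<or> 5 \<le> i \<Longrightarrow> adj i j"
  shows False
proof -
  obtain c :: "nat \<Rightarrow> nat \<Rightarrow> nat \<Rightarrow> int" where c:
    "\<And>i j k l. i < j \<Longrightarrow> j < 9 \<Longrightarrow> adj i j \<Longrightarrow> k < l \<Longrightarrow> l < 9 \<Longrightarrow> adj k l \<Longrightarrow> {i, j} \<inter> {k, l} = {} \<Longrightarrow>
       even (c i j k + c i j l + c k l i + c k l j + of_bool (y i j \<and> y k l)
             + (pos_after i k + pos_after i l + pos_after j k + pos_after j l))"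
    using drawing_parity[OF d] by blast
  have K: "odd (of_bool (y 1 2 \<and> y 3 4) + of_bool (y 1 3 \<and> y 2 4) + of_bool (y 1 4 \<and> y 2 3) :: int)"
     "odd (of_bool (y 5 6 \<and> y 7 8) + of_bool (y 5 7 \<and> y 6 8) + of_bool (y 5 8 \<and> y 6 7) :: int)"
    using parity_K5[where c=c and y=y and adj=adj and n=9, OF c, of 0 1 2 3 4]
      parity_K5[where c=c and y=y and adj=adj and n=9, OF c, of 0 5 6 7 8] by (simp_all add: y adj)
  have T: "\<not> ((y i j \<noteq> y i k) \<noteq> y j k) \<or> \<not> ((y p q \<noteq> y p r) \<noteq> y q r)"
    if "i < j" "j < k" "k < 5" "5 \<le> p" "p < q" "q < r" "r < 9" for i j k p q r
  proof -
    note that(1,2,5-7)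
    moreover have "k < 9" "{i, j, k} \<inter> {p, q, r} = {}" using that by auto
    moreover have "adj i j" "adj i k" "adj j k" "adj p q" "adj p r" "adj q r"
      by (rule adj; use that in linarith)+
    ultimately show ?thesis
      by (intro parity_triangles[where c=c and y=y and adj=adj and n=9, OF c])
  qed
  have "\<not> ((y 1 2 \<noteq> y 1 3) \<noteq> y 2 3) \<or> \<not> ((y 5 6 \<noteq> y 5 7) \<noteq> y 6 7)"
    "\<not> ((y 1 2 \<noteq> y 1 3) \<noteq> y 2 3) \<or> \<not> ((y 5 6 \<noteq> y 5 8) \<noteq> y 6 8)"
    "\<not> ((y 1 2 \<noteq> y 1 3) \<noteq> y 2 3) \<or> \<not> ((y 5 7 \<noteq> y 5 8) \<noteq> y 7 8)"
    "\<not> ((y 1 2 \<noteq> y 1 3) \<noteq> y 2 3) \<or> \<not> ((y 6 7 \<noteq> y 6 8) \<noteq> y 7 8)"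
    "\<not> ((y 1 2 \<noteq> y 1 4) \<noteq> y 2 4) \<or> \<not> ((y 5 6 \<noteq> y 5 7) \<noteq> y 6 7)"
    "\<not> ((y 1 2 \<noteq> y 1 4) \<noteq> y 2 4) \<or> \<not> ((y 5 6 \<noteq> y 5 8) \<noteq> y 6 8)"
    "\<not> ((y 1 2 \<noteq> y 1 4) \<noteq> y 2 4) \<or> \<not> ((y 5 7 \<noteq> y 5 8) \<noteq> y 7 8)"
    "\<not> ((y 1 2 \<noteq> y 1 4) \<noteq> y 2 4) \<or> \<not> ((y 6 7 \<noteq> y 6 8) \<noteq> y 7 8)"
    "\<not> ((y 1 3 \<noteq> y 1 4) \<noteq> y 3 4) \<or> \<not> ((y 5 6 \<noteq> y 5 7) \<noteq> y 6 7)"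
    "\<not> ((y 1 3 \<noteq> y 1 4) \<noteq> y 3 4) \<or> \<not> ((y 5 6 \<noteq> y 5 8) \<noteq> y 6 8)"
    "\<not> ((y 1 3 \<noteq> y 1 4) \<noteq> y 3 4) \<or> \<not> ((y 5 7 \<noteq> y 5 8) \<noteq> y 7 8)"
    "\<not> ((y 1 3 \<noteq> y 1 4) \<noteq> y 3 4) \<or> \<not> ((y 6 7 \<noteq> y 6 8) \<noteq> y 7 8)"
    "\<not> ((y 2 3 \<noteq> y 2 4) \<noteq> y 3 4) \<or> \<not> ((y 5 6 \<noteq> y 5 7) \<noteq> y 6 7)"
    "\<not> ((y 2 3 \<noteq> y 2 4) \<noteq> y 3 4) \<or> \<not> ((y 5 6 \<noteq> y 5 8) \<noteq> y 6 8)"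
    "\<not> ((y 2 3 \<noteq> y 2 4) \<noteq> y 3 4) \<or> \<not> ((y 5 7 \<noteq> y 5 8) \<noteq> y 7 8)"
    "\<not> ((y 2 3 \<noteq> y 2 4) \<noteq> y 3 4) \<or> \<not> ((y 6 7 \<noteq> y 6 8) \<noteq> y 7 8)"
    by (rule T; simp)+
  moreover note K[unfolded odd_of_bool3]
  ultimately show False by sat
qed

text \<open>Without twists the sum that \<open>parity_K5\<close> declares odd is 0.\<close>

theorem no_untwisted_drawing_K5:
  assumes d: "projective_drawing 5 adj p y e"
    and y: "\<And>i j. \<not> y i j" and adj: "\<And>i j. i < j \<Longrightarrow> j < 5 \<Longrightarrow> adj i j"
  shows False
proof -
  obtain c :: "nat \<Rightarrow> nat \<Rightarrow> nat \<Rightarrow> int" where c: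
    "\<And>i j k l. i < j \<Longrightarrow> j < 5 \<Longrightarrow> adj i j \<Longrightarrow> k < l \<Longrightarrow> l < 5 \<Longrightarrow> adj k l \<Longrightarrow> {i, j} \<inter> {k, l} = {} \<Longrightarrow>
       even (c i j k + c i j l + c k l i + c k l j + of_bool (y i j \<and> y k l)
             + (pos_after i k + pos_after i l + pos_after j k + pos_after j l))"
    using drawing_parity[OF d] by blast
  show False
    using parity_K5[where c=c and y=y and adj=adj and n=5, OF c, of 0 1 2 3 4] by (simp add: y adj)
qed

section \<open>From topological embeddings to lifted drawings\<close>

text \<open>The shape in which an embedding is handed to the covering argument: vertices are
  numbered, edges run from the lower to the higher index, and disjointness is recorded for edges
  without common ends, end points included.\<close>

definition arc_system ::
  "nat \<Rightarrow> (nat \<Rightarrow> nat \<Rightarrow> bool) \<Rightarrow> 'x::topological_space set \<Rightarrow> (nat \<Rightarrow> 'x) \<Rightarrow>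
    (nat \<Rightarrow> nat \<Rightarrow> real \<Rightarrow> 'x) \<Rightarrow> bool" where
  "arc_system n adj X w g \<longleftrightarrow>
     inj_on w {..<n} \<and> w ` {..<n} \<subseteq> X \<and>
     (\<forall>i j. i < j \<and> j < n \<and> adj i j \<longrightarrow>
        continuous_on {0..1} (g i j) \<and> inj_on (g i j) {0..1} \<and> g i j ` {0..1} \<subseteq> X \<and>
        g i j 0 = w i \<and> g i j 1 = w j \<and> (\<forall>k<n. k \<noteq> i \<and> k \<noteq> j \<longrightarrow> w k \<notin> g i j ` {0..1})) \<and>
     (\<forall>i j k l. i < j \<and> j < n \<and> adj i j \<and> k < l \<and> l < n \<and> adj k l \<and> {i, j} \<inter> {k, l} = {} \<longrightarrow>
        g i j ` {0..1} \<inter> g k l ` {0..1} = {})"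

text \<open>\<open>S\<close> is an abstract topology; an injective continuous \<open>H\<close>
  carries the drawing of a subgraph into a subset of a concrete space, where paths can be
  lifted.\<close>

lemma graph_arc_system:
  fixes v :: "nat \<Rightarrow> 'v" and H :: "'s \<Rightarrow> 'x::topological_space"
  assumes emb: "graph_embeds_in (V, E) S"
    and H: "continuous_map S (top_of_set X) H" "inj_on H (topspace S)"
    and v: "inj_on v {..<n}" "v ` {..<n} \<subseteq> V"
  obtains w g where "arc_system n (\<lambda>i j. {v i, v j} \<in> E) X w g"
proof -
  obtain \<phi> \<gamma> where raw: "inj_on \<phi> V \<and> \<phi> ` V \<subseteq> topspace S \<and>
          (\<forall>e \<in> E. embedding_map (top_of_set {0..1}) S (\<gamma> e) \<and>
                   {\<gamma> e 0, \<gamma> e 1} = \<phi> ` e \<and>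
                   \<gamma> e ` {0<..<1::real} \<inter> \<phi> ` V = {}) \<and>
          (\<forall>e \<in> E. \<forall>e' \<in> E. e \<noteq> e' \<longrightarrow> \<gamma> e ` {0<..<1} \<inter> \<gamma> e' ` {0<..<1} = {})"
    using emb unfolding graph_embeds_in_def prod.case by (elim exE) (rule that)
  then have \<phi>: "inj_on \<phi> V" "\<phi> ` V \<subseteq> topspace S" by blast+
  have \<gamma>: "embedding_map (top_of_set {0..1}) S (\<gamma> e)" "{\<gamma> e 0, \<gamma> e 1} = \<phi> ` e"
      "\<gamma> e ` {0<..<1::real} \<inter> \<phi> ` V = {}" if "e \<in> E" for e
    using raw that by blast+
  have \<gamma>4: "\<gamma> e ` {0<..<1} \<inter> \<gamma> e' ` {0<..<1} = {}" if "e \<in> E" "e' \<in> E" "e \<noteq> e'" for e e'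
    using raw that by blast
  have HX: "H x \<in> X" if "x \<in> topspace S" for x
    using H(1) that by (force simp: continuous_map_def)
  \<comment> \<open>An embedding does not tell at which end of the edge its arc starts, so arcs are
    reversed where necessary.\<close>
  define r where "r i j t = (if \<gamma> {v i, v j} 0 = \<phi> (v i) then t else 1 - t)" for i j and t :: real
  define w where "w i = H (\<phi> (v i))" for i
  define g where "g i j t = H (\<gamma> {v i, v j} (r i j t))" for i j t
  have vV: "v i \<in> V" if "i < n" for i using v that by auto
  have \<phi>S: "\<phi> (v i) \<in> topspace S" if "i < n" for i using \<phi>(2) vV[OF that] by blast
  have \<phi>eq: "\<phi> (v i) = \<phi> (v j) \<longleftrightarrow> i = j" if "i < n" "j < n" for i j
    using \<phi>(1) v vV that by (metis inj_on_contraD lessThan_iff)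
  have Heq: "H x = H y \<longleftrightarrow> x = y" if "x \<in> topspace S" "y \<in> topspace S" for x y
    using H(2) that by (auto dest: inj_onD)
  have cont: "continuous_map (top_of_set {0..1}) S (\<gamma> e)" and inj: "inj_on (\<gamma> e) {0..1}" if "e \<in> E" for e
  proof -
    have h: "homeomorphic_map (top_of_set {0..1}) (subtopology S (\<gamma> e ` {0..1})) (\<gamma> e)"
      using \<gamma>(1)[OF that] by (simp add: embedding_map_def)
    show "continuous_map (top_of_set {0..1}) S (\<gamma> e)"
      by (rule continuous_map_into_fulltopology[OF homeomorphic_imp_continuous_map[OF h]])
    show "inj_on (\<gamma> e) {0..1}" using homeomorphic_imp_injective_map[OF h] by simp
  qed
  have \<gamma>S: "\<gamma> e t \<in> topspace S" if "e \<in> E" "t \<in> {0..1}" for e t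
    using continuous_map_image_subset_topspace[OF cont[OF that(1)]] that(2) by auto
  have r: "r i j ` {0..1} = {0..1}" "inj_on (r i j) {0..1}" "continuous_on {0..1} (r i j)" for i j
  proof -
    have *: "r i j = (\<lambda>t. t) \<or> r i j = (\<lambda>t. 1 - t)"
      unfolding r_def by (cases "\<gamma> {v i, v j} 0 = \<phi> (v i)") auto
    have "(\<lambda>t. 1 - t) ` {0..1::real} = {0..1}" by simp
    with * show "r i j ` {0..1} = {0..1}" by (elim disjE) simp_all
    from * show "inj_on (r i j) {0..1}" by (elim disjE) (simp_all add: inj_on_def)
    from * show "continuous_on {0..1} (r i j)" by (elim disjE) (auto intro!: continuous_intros)
  qed
  have r01: "r i j t \<in> {0..1}" if "t \<in> {0..1}" for i j t using r(1) that by blast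
  have pts: "\<gamma> {v i, v j} t \<in> \<gamma> {v i, v j} ` {0<..<1} \<or> \<gamma> {v i, v j} t \<in> {\<phi> (v i), \<phi> (v j)}"
    if "{v i, v j} \<in> E" "t \<in> {0..1}" for i j t
  proof -
    have "t = 0 \<or> t = 1 \<or> t \<in> {0<..<1}" using that by auto
    moreover have "\<gamma> {v i, v j} 0 \<in> {\<phi> (v i), \<phi> (v j)}" "\<gamma> {v i, v j} 1 \<in> {\<phi> (v i), \<phi> (v j)}"
      using \<gamma>(2)[OF that(1)] by auto
    ultimately show ?thesis by blast
  qed
  show ?thesis
  proof (rule that[of w g], unfold arc_system_def, intro conjI allI impI; (elim conjE)?)
    show "inj_on w {..<n}" unfolding w_def inj_on_def using Heq \<phi>S \<phi>eq by simp
    show "w ` {..<n} \<subseteq> X" unfolding w_def using HX \<phi>S by auto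
    fix i j assume ij: "i < j" "j < n" "{v i, v j} \<in> E"
    then have ine: "i < n" "i \<noteq> j" by auto
    have "continuous_map (top_of_set {0..1}) (top_of_set X) (H \<circ> \<gamma> {v i, v j})"
      using cont[OF ij(3)] H(1) by (rule continuous_map_compose)
    then have "continuous_on {0..1} (H \<circ> \<gamma> {v i, v j})" by simp
    then show "continuous_on {0..1} (g i j)"
      unfolding g_def using continuous_on_compose2[OF _ r(3), of "{0..1}" "H \<circ> \<gamma> {v i, v j}"] r(1) by auto
    show "inj_on (g i j) {0..1}"
      unfolding g_def inj_on_def using Heq \<gamma>S[OF ij(3)] inj[OF ij(3)] r(2) r01 by (metis inj_on_eq_iff)
    show "g i j ` {0..1} \<subseteq> X" unfolding g_def using HX \<gamma>S[OF ij(3)] r01 by blast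
    have e: "\<gamma> {v i, v j} (r i j 0) = \<phi> (v i) \<and> \<gamma> {v i, v j} (r i j 1) = \<phi> (v j)"
      using \<gamma>(2)[OF ij(3)] \<phi>eq[OF ine(1) ij(2)] ine by (auto simp: r_def doubleton_eq_iff)
    then show "g i j 0 = w i" "g i j 1 = w j" unfolding g_def w_def by auto
    show "w k \<notin> g i j ` {0..1}" if k: "k < n" "k \<noteq> i" "k \<noteq> j" for k
    proof
      assume "w k \<in> g i j ` {0..1}"
      then obtain t where t: "t \<in> {0..1}" "H (\<phi> (v k)) = H (\<gamma> {v i, v j} (r i j t))" unfolding w_def g_def by auto
      then have "\<phi> (v k) = \<gamma> {v i, v j} (r i j t)" using Heq \<phi>S \<gamma>S[OF ij(3)] r01 k by simp
      then have "\<phi> (v k) \<in> \<gamma> {v i, v j} ` {0<..<1} \<or> \<phi> (v k) \<in> {\<phi> (v i), \<phi> (v j)}"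
        using pts[OF ij(3) r01[OF t(1)]] by simp
      moreover have "\<phi> (v k) \<notin> \<gamma> {v i, v j} ` {0<..<1}" using \<gamma>(3)[OF ij(3)] vV[OF k(1)] by blast
      ultimately show False using \<phi>eq[OF k(1) ine(1)] \<phi>eq[OF k(1) ij(2)] k by simp
    qed
  next
    fix i j k l assume ij: "i < j" "j < n" "{v i, v j} \<in> E" and kl: "k < l" "l < n" "{v k, v l} \<in> E"
      and dis: "{i, j} \<inter> {k, l} = {}"
    have lt: "i < n" "k < n" using ij kl by auto
    have ne: "{v i, v j} \<noteq> {v k, v l}"
      using inj_on_eq_iff[OF v(1), of i k] inj_on_eq_iff[OF v(1), of i l] ij kl dis lt
      by (auto simp: doubleton_eq_iff)
    show "g i j ` {0..1} \<inter> g k l ` {0..1} = {}"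
    proof (rule ccontr)
      assume "g i j ` {0..1} \<inter> g k l ` {0..1} \<noteq> {}"
      then obtain s t where st: "s \<in> {0..1}" "t \<in> {0..1}" "H (\<gamma> {v i, v j} (r i j s)) = H (\<gamma> {v k, v l} (r k l t))"
        unfolding g_def by blast
      then have eq: "\<gamma> {v i, v j} (r i j s) = \<gamma> {v k, v l} (r k l t)"
        using Heq \<gamma>S[OF ij(3)] \<gamma>S[OF kl(3)] r01 by simp
      have c: "({\<phi> (v i), \<phi> (v j)} \<union> {\<phi> (v k), \<phi> (v l)}) \<inter> \<gamma> e ` {0<..<1} = {}" if "e \<in> E" for e
        using \<gamma>(3)[OF that] vV[OF lt(1)] vV[OF lt(2)] vV[OF ij(2)] vV[OF kl(2)] by blast
      have d: "{\<phi> (v i), \<phi> (v j)} \<inter> {\<phi> (v k), \<phi> (v l)} = {}"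
        using \<phi>eq lt ij(2) kl(2) dis by auto
      have "False" if "x \<in> A \<or> x \<in> P" "x \<in> B \<or> x \<in> Q" "P \<inter> Q = {}"
          "(P \<union> Q) \<inter> A = {}" "(P \<union> Q) \<inter> B = {}" "A \<inter> B = {}" for x :: 's and A B P Q
        using that by blast
      from this[OF pts[OF ij(3) r01[OF st(1), of i j]] pts[OF kl(3) r01[OF st(2), of k l], folded eq] d
        c[OF ij(3)] c[OF kl(3)] \<gamma>4[OF ij(3) kl(3) ne]]
      show False .
    qed
  qed
qed

text \<open>An arc has empty interior in a surface: otherwise its inverse would inject an open set
  of the plane continuously into the line, against invariance of dimension. Finite unions of closed
  sets with empty interior keep this property.\<close>

lemma arcs_not_cover_sphere:
  fixes \<G> :: "(real \<Rightarrow> real^3) set"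
  assumes "finite \<G>" and arcs: "\<And>g. g \<in> \<G> \<Longrightarrow> continuous_on {0..1} g \<and> inj_on g {0..1}"
  obtains N where "N \<in> sphere 0 1" "\<And>g. g \<in> \<G> \<Longrightarrow> N \<notin> g ` {0..1}"
proof -
  \<comment> \<open>Central projection from the plane at height 1 onto the open upper hemisphere; a
    missed point is sought there.\<close>
  define a :: "complex \<Rightarrow> real^3" where "a z = Re z *\<^sub>R axis 1 1 + Im z *\<^sub>R axis 2 1 + axis 3 1" for z
  define h where "h z = a z /\<^sub>R norm (a z)" for z
  have a3: "a z $ 1 = Re z" "a z $ 2 = Im z" "a z $ 3 = 1" for z unfolding a_def by (simp_all add: axis_def)
  then have a0: "norm (a z) > 0" for z by (metis zero_index zero_less_norm_iff zero_neq_one)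
  have ca: "continuous_on UNIV a"
    unfolding a_def by (intro continuous_intros)
  have ch: "continuous_on UNIV h"
    unfolding h_def using a0 by (intro continuous_intros ca) (metis less_irrefl)
  have hs: "h z \<in> sphere 0 1" for z using a0[of z] by (simp add: h_def)
  have hinj: "inj h"
  proof (rule injI)
    fix z u assume eq: "h z = h u"
    then have "h z $ 3 = h u $ 3" by simp
    then have "norm (a z) = norm (a u)" using a0[of z] a0[of u] by (simp add: h_def a3 field_simps)
    then have "a z = a u" using eq a0[of u] by (simp add: h_def)
    then show "z = u" by (metis a3 complex_eqI)
  qed
  define K where "K g = h -` (g ` {0..1})" for g :: "real \<Rightarrow> real^3"
  have K: "closed (K g)" "interior (K g) = {}" if g: "g \<in> \<G>" for g
  proof -
    have "compact (g ` {0..1})" using arcs[OF g] by (intro compact_continuous_image) auto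
    then have "closed (g ` {0..1})" by (rule compact_imp_closed)
    then show "closed (K g)" unfolding K_def using ch by (simp add: continuous_closed_vimage continuous_on_eq_continuous_at)
    show "interior (K g) = {}"
    proof (rule ccontr)
      assume ne: "interior (K g) \<noteq> {}"
      have "continuous_on (g ` {0..1}) (inv_into {0..1} g)"
        using arcs[OF g] by (intro continuous_on_inv) simp_all
      then have "continuous_on (interior (K g)) (inv_into {0..1} g \<circ> h)"
        using ch interior_subset[of "K g"]
        by (intro continuous_on_compose) (auto simp: K_def intro: continuous_on_subset)
      moreover have "inj_on (inv_into {0..1} g \<circ> h) (interior (K g))"
      proof (rule comp_inj_on)
        show "inj_on h (interior (K g))" using hinj by (simp add: inj_on_def)
        show "inj_on (inv_into {0..1} g) (h ` interior (K g))"
          using interior_subset[of "K g"] by (intro inj_on_inv_into) (auto simp: K_def)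
      qed
      ultimately have "DIM(complex) \<le> DIM(real)"
        using invariance_of_dimension[OF _ open_interior _ ne] by blast
      then show False by simp
    qed
  qed
  have "finite \<F> \<Longrightarrow> \<F> \<subseteq> \<G> \<Longrightarrow> interior (\<Union> (K ` \<F>)) = {} \<and> closed (\<Union> (K ` \<F>))" for \<F>
  proof (induction \<F> rule: finite_induct)
    case (insert g \<F>)
    then show ?case using K[of g] by (simp add: interior_closed_Un_empty_interior closed_Un)
  qed simp
  then have "interior (\<Union> (K ` \<G>)) = {}" using \<open>finite \<G>\<close> by blast
  then have "\<Union> (K ` \<G>) \<noteq> UNIV" by (metis UNIV_not_empty interior_UNIV)
  then obtain z where "z \<notin> \<Union> (K ` \<G>)" by blast
  then show ?thesis using hs by (intro that[of "h z"]) (auto simp: K_def)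
qed

text \<open>A line through the north pole meets the sphere in at most one further point:
  \<open>r\<close> is the ratio of two such points, measured from the pole.\<close>

lemma stereographic_scale:
  fixes r x y z :: real
  assumes "(r * x)\<^sup>2 + (r * y)\<^sup>2 + (1 - r * (1 - z))\<^sup>2 = 1" and "x\<^sup>2 + y\<^sup>2 + z\<^sup>2 = 1"
  shows "2 * r * (1 - z) * (r - 1) = 0"
proof -
  have "2 * r * (1 - z) * (r - 1) =
      ((r * x)\<^sup>2 + (r * y)\<^sup>2 + (1 - r * (1 - z))\<^sup>2 - 1) - r\<^sup>2 * (x\<^sup>2 + y\<^sup>2 + z\<^sup>2 - 1)"
    by (simp add: power2_eq_square algebra_simps)
  then show ?thesis unfolding assms by simp
qed

text \<open>The centre \<open>N\<close> of projection is chosen off the arcs and off their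
  antipodes, so that \<open>N\<close> and \<open>- N\<close> are both missed. Then \<open>st\<close>
  is finite and nonzero on \<open>A\<close>, and \<open>A\<close> is closed under the antipodal
  map.\<close>

lemma stereographic_coordinates:
  fixes \<G> :: "(real \<Rightarrow> real^3) set"
  assumes fin: "finite \<G>" and arcs: "\<And>g. g \<in> \<G> \<Longrightarrow> continuous_on {0..1} g \<and> inj_on g {0..1} \<and> g ` {0..1} \<subseteq> sphere 0 1"
  obtains A and st :: "real^3 \<Rightarrow> complex" where
    "\<And>g. g \<in> \<G> \<Longrightarrow> g ` {0..1} \<subseteq> A" "A \<subseteq> sphere 0 1" "\<And>x. x \<in> A \<Longrightarrow> - x \<in> A"
    "continuous_on A st" "inj_on st A" "\<And>x. x \<in> A \<Longrightarrow> st x \<noteq> 0 \<and> st (- x) = antipode (st x)"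
proof -
  define \<H> where "\<H> = \<G> \<union> (\<lambda>g t. - g t) ` \<G>"
  have "finite \<H>" using fin by (simp add: \<H>_def)
  moreover have "continuous_on {0..1} g \<and> inj_on g {0..1}" if "g \<in> \<H>" for g
    using that arcs unfolding \<H>_def by (auto intro!: continuous_on_minus simp: inj_on_def)
  ultimately obtain N where N: "N \<in> sphere 0 1" "\<And>g. g \<in> \<H> \<Longrightarrow> N \<notin> g ` {0..1}"
    using arcs_not_cover_sphere[of \<H>] by blast
  define A where "A = sphere 0 1 - {N, - N}"
  have "norm N = norm (axis 3 1 :: real^3)" using N(1) by simp
  then obtain f :: "real^3 \<Rightarrow> real^3" where f: "orthogonal_transformation f" "f N = axis 3 1"
    by (rule orthogonal_transformation_exists)
  have lin: "linear f" and nf: "norm (f x) = norm x" for x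
    using f(1) by (simp_all add: orthogonal_transformation_def orthogonal_transformation_norm[OF f(1)])
  have fneg: "f (- x) = - f x" for x using lin by (simp add: linear_neg)
  have finj: "f x = f y \<longleftrightarrow> x = y" for x y using orthogonal_transformation_inj[OF f(1)] by (auto dest: injD)
  have n3: "(u $ 1)\<^sup>2 + (u $ 2)\<^sup>2 + (u $ 3)\<^sup>2 = 1" if "norm u = 1" for u :: "real^3"
    using that by (simp add: norm_eq_1 inner_vec_def sum_3 power2_eq_square)
  define st where "st x = Complex (f x $ 1) (f x $ 2) / of_real (1 - f x $ 3)" for x
  have A3: "f x $ 3 \<noteq> 1 \<and> f x $ 3 \<noteq> - 1" if "x \<in> A" for x
  proof -
    have n: "(f x $ 1)\<^sup>2 + (f x $ 2)\<^sup>2 + (f x $ 3)\<^sup>2 = 1" using n3[of "f x"] that nf by (simp add: A_def)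
    have "f x = axis 3 1" if "f x $ 3 = 1"
      using n that by (simp add: vec_eq_iff forall_3 axis_def sum_power2_eq_zero_iff)
    moreover have "f x = - axis 3 1" if "f x $ 3 = - 1"
      using n that by (simp add: vec_eq_iff forall_3 axis_def sum_power2_eq_zero_iff)
    ultimately show ?thesis using that f(2) finj[of x N] finj[of x "- N"] fneg[of N] by (auto simp: A_def)
  qed
  have neg: "- x \<in> A" if "x \<in> A" for x using that by (auto simp: A_def)
  show ?thesis
  proof (rule that[of A st])
    show "g ` {0..1} \<subseteq> A" if "g \<in> \<G>" for g
    proof -
      have "g \<in> \<H>" "(\<lambda>t. - g t) \<in> \<H>" using that by (auto simp: \<H>_def)
      note N(2)[OF this(1)] N(2)[OF this(2)]
      moreover have "N \<in> (\<lambda>t. - g t) ` {0..1}" if m: "- N \<in> g ` {0..1}"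
      proof -
        obtain t where "t \<in> {0..1}" "- N = g t" using m by blast
        then have "t \<in> {0..1}" "N = - g t" by (simp_all add: equation_minus_iff[of N])
        then show ?thesis by blast
      qed
      ultimately have "N \<notin> g ` {0..1}" "- N \<notin> g ` {0..1}" by blast+
      then show ?thesis using arcs[OF that] unfolding A_def by blast
    qed
    show "A \<subseteq> sphere 0 1" by (auto simp: A_def)
    show "- x \<in> A" if "x \<in> A" for x using neg[OF that] .
    have cf: "continuous_on A f" using lin by (simp add: linear_continuous_on linear_conv_bounded_linear)
    show "continuous_on A st"
      unfolding st_def Complex_eq using A3 by (intro continuous_intros cf) auto
    show "inj_on st A"
    proof (rule inj_onI)
      fix x y assume xy: "x \<in> A" "y \<in> A" "st x = st y"
      define a b where "a = f x" and "b = f y"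
      have n: "(a $ 1)\<^sup>2 + (a $ 2)\<^sup>2 + (a $ 3)\<^sup>2 = 1" "(b $ 1)\<^sup>2 + (b $ 2)\<^sup>2 + (b $ 3)\<^sup>2 = 1"
        using n3 nf xy by (simp_all add: A_def a_def b_def)
      have ne: "1 - a $ 3 \<noteq> 0" "1 - b $ 3 \<noteq> 0" using A3 xy by (auto simp: a_def b_def)
      define r where "r = (1 - a $ 3) / (1 - b $ 3)"
      have div: "u = p / q * v" if "u / p = v / q" "p \<noteq> 0" "q \<noteq> 0" for u p v q :: real
        using that by (simp add: field_simps)
      have e: "a $ 1 = r * b $ 1" "a $ 2 = r * b $ 2" "1 - a $ 3 = r * (1 - b $ 3)"
        using div[of "a $ 1" "1 - a $ 3" "b $ 1" "1 - b $ 3"] div[of "a $ 2" "1 - a $ 3" "b $ 2" "1 - b $ 3"]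
          arg_cong[OF xy(3), of Re] arg_cong[OF xy(3), of Im] ne
        unfolding st_def r_def a_def[symmetric] b_def[symmetric]
        by (simp_all add: Re_divide_of_real Im_divide_of_real)
      then have "a $ 3 = 1 - r * (1 - b $ 3)" by simp
      then have "2 * r * (1 - b $ 3) * (r - 1) = 0" using n e(1,2) by - (rule stereographic_scale[of r "b $ 1" "b $ 2" "b $ 3"]; (simp; fail | simp))
      moreover have "r \<noteq> 0" using ne by (simp add: r_def)
      ultimately have "r = 1" using ne by simp
      then have "a = b" using e by (simp add: vec_eq_iff forall_3)
      then show "x = y" using finj by (simp add: a_def b_def)
    qed
    show "st x \<noteq> 0 \<and> st (- x) = antipode (st x)" if x: "x \<in> A" for x
    proof -
      define a where "a = f x"
      have n: "(a $ 1)\<^sup>2 + (a $ 2)\<^sup>2 + (a $ 3)\<^sup>2 = 1" using n3 nf x by (simp_all add: A_def a_def)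
      have ne: "1 - a $ 3 \<noteq> 0" "1 + a $ 3 \<noteq> 0" using A3[OF x] by (auto simp: a_def)
      define c where "c = Complex (a $ 1) (a $ 2)"
      have "c * cnj c = of_real ((a $ 1)\<^sup>2 + (a $ 2)\<^sup>2)"
        by (simp add: c_def complex_eq_iff power2_eq_square)
      \<comment> \<open>On the unit sphere |c|^2 factors as (1 - z)(1 + z); this matches the
        denominators of \<open>st x\<close> and \<open>st (- x)\<close>.\<close>
      also have "(a $ 1)\<^sup>2 + (a $ 2)\<^sup>2 = (1 - a $ 3) * (1 + a $ 3)" using n by (simp add: power2_eq_square algebra_simps)
      finally have cc: "c * cnj c = of_real (1 - a $ 3) * of_real (1 + a $ 3)" by simp
      have ne': "of_real (1 - a $ 3) \<noteq> (0::complex)" "of_real (1 + a $ 3) \<noteq> (0::complex)"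
        using ne by (simp_all only: of_real_eq_0_iff not_False_eq_True)
      then have c0: "c \<noteq> 0" using cc by auto
      have s: "st x = c / of_real (1 - a $ 3)" "st (- x) = - c / of_real (1 + a $ 3)"
        unfolding st_def fneg c_def a_def by (simp_all add: complex_eq_iff)
      have "antipode (st x) = - of_real (1 - a $ 3) / cnj c"
        unfolding s antipode_def by simp
      also have "\<dots> = - c / of_real (1 + a $ 3)" using cc ne' c0 by (simp add: frac_eq_eq field_simps)
      finally show ?thesis using s c0 ne' by simp
    qed
  qed
qed

text \<open>For unit vectors this is the projective plane as the set of rank-one projections: x and
  -x give the same matrix x x^T. The quotient becomes a subset of a Euclidean space, where covering
  maps between sets are available.\<close>

definition veronese :: "real^3 \<Rightarrow> real^3^3" where "veronese x = (\<chi> i j. x $ i * x $ j)"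

lemma veronese_mult: "veronese y *v x = (y \<bullet> x) *\<^sub>R y"
  by (simp add: veronese_def vec_eq_iff matrix_vector_mult_def inner_vec_def sum_distrib_left mult_ac)

lemma veronese_minus [simp]: "veronese (- x) = veronese x"
  by (simp add: veronese_def)

lemma veronese_eq_iff:
  assumes "norm x = 1" "norm y = 1" shows "veronese x = veronese y \<longleftrightarrow> x = y \<or> x = - y"
proof
  assume eq: "veronese x = veronese y"
  have xx: "x \<bullet> x = 1" "y \<bullet> y = 1" using assms by (simp_all add: norm_eq_1)
  have x: "x = (y \<bullet> x) *\<^sub>R y"
    using veronese_mult[of x x] veronese_mult[of y x] eq xx by simp
  then have "norm x = \<bar>y \<bullet> x\<bar> * norm y" by (metis norm_scaleR)
  then have "\<bar>y \<bullet> x\<bar> = 1" using assms by simp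
  then have "y \<bullet> x = 1 \<or> y \<bullet> x = - 1" by linarith
  then show "x = y \<or> x = - y" using x by (metis scaleR_minus1_left scaleR_one)
qed auto

lemma continuous_on_veronese: "continuous_on A veronese"
  unfolding veronese_def by (intro continuous_on_vec_lambda continuous_intros)

text \<open>Near the image of \<open>a\<close> the two sheets are the open hemispheres centred at
  \<open>a\<close> and at \<open>- a\<close>. For M = y y^T one has M a = (y . a) y and a . M a = (y
  . a)^2, so M a / sqrt (a . M a) recovers y up to the sign \<open>s\<close> of the sheet.\<close>

lemma covering_space_veronese: "covering_space (sphere 0 1) veronese (veronese ` sphere 0 1)"
proof
  show "continuous_on (sphere 0 1) veronese" by (rule continuous_on_veronese)
  show "veronese ` sphere 0 1 = veronese ` sphere 0 1" ..
  fix M assume "M \<in> veronese ` sphere 0 1"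
  then obtain a where a: "norm a = 1" "M = veronese a" by auto
  define T where "T = veronese ` sphere 0 1 \<inter> {M. a \<bullet> (M *v a) > 0}"
  define U where "U s = sphere 0 1 \<inter> {y. s * (y \<bullet> a) > 0}" for s :: real
  have cM: "continuous_on B (\<lambda>M::real^3^3. M *v a)" for B
    unfolding matrix_vector_mult_def by (intro continuous_on_vec_lambda continuous_intros)
  have inner_a: "a \<bullet> (veronese y *v a) = (y \<bullet> a)\<^sup>2" for y
    by (simp add: veronese_mult power2_eq_square inner_commute)
  have vT: "veronese y \<in> T \<longleftrightarrow> norm y = 1 \<and> y \<bullet> a \<noteq> 0" for y
  proof -
    note inner_a
    moreover have "norm y = 1" if "veronese y = veronese z" "norm z = 1" for z
    proof -
      have "(norm y)\<^sup>2 = (\<Sum>i\<in>UNIV. veronese y $ i $ i)"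
        by (simp add: veronese_def power2_norm_eq_inner inner_vec_def)
      also have "\<dots> = (norm z)\<^sup>2"
        unfolding that(1) by (simp add: veronese_def power2_norm_eq_inner inner_vec_def)
      finally have "(norm y)\<^sup>2 = (norm z)\<^sup>2" .
      then have "norm y = norm z" by (rule power2_eq_imp_eq) simp_all
      then show ?thesis using that(2) by simp
    qed
    ultimately show ?thesis unfolding T_def by auto
  qed
  have homeo: "\<exists>q. homeomorphism (U s) T veronese q" if s: "s = 1 \<or> s = - 1" for s
  proof
    let ?q = "\<lambda>M. s *\<^sub>R ((M *v a) /\<^sub>R sqrt (a \<bullet> (M *v a)))"
    have q: "?q (veronese y) = y" if y: "y \<in> U s" for y
    proof -
      have "sqrt (a \<bullet> (veronese y *v a)) = \<bar>y \<bullet> a\<bar>"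
        by (simp add: inner_a)
      moreover have "s * (y \<bullet> a) = \<bar>y \<bullet> a\<bar>" "y \<bullet> a \<noteq> 0" using y s by (auto simp: U_def)
      then have "s * (y \<bullet> a) / \<bar>y \<bullet> a\<bar> = 1" by simp
      ultimately show ?thesis by (simp add: veronese_mult divide_inverse mult_ac)
    qed
    have im: "veronese ` U s = T"
    proof
      show "veronese ` U s \<subseteq> T"
      proof (rule image_subsetI)
        fix y assume "y \<in> U s"
        then have "norm y = 1" "y \<bullet> a \<noteq> 0" by (auto simp: U_def)
        then show "veronese y \<in> T" by (simp add: vT)
      qed
      show "T \<subseteq> veronese ` U s"
      proof
        fix N assume "N \<in> T"
        then obtain y where "N = veronese y" unfolding T_def by blast
        then have y: "norm y = 1" "N = veronese y" "y \<bullet> a \<noteq> 0" using \<open>N \<in> T\<close> by (simp_all add: vT)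
        then have "y \<in> U s \<or> - y \<in> U s" using s by (auto simp: U_def)
        moreover have "N = veronese (- y)" using y(2) by simp
        ultimately show "N \<in> veronese ` U s" using y(2) by blast
      qed
    qed
    show "homeomorphism (U s) T veronese ?q"
      unfolding homeomorphism_def
    proof (intro conjI ballI)
      show "veronese ` U s = T" by (rule im)
      show "continuous_on (U s) veronese" by (rule continuous_on_veronese)
      show "continuous_on T ?q" by (intro continuous_intros cM) (auto simp: T_def)
      show "?q (veronese y) = y" if "y \<in> U s" for y by (rule q[OF that])
      then show "?q ` T = U s" using im by force
      show "veronese (?q N) = N" if N: "N \<in> T" for N
      proof -
        obtain y where "y \<in> U s" "N = veronese y" using N im by blast
        then show ?thesis using q by simp
      qed
    qed
  qed
  have op: "openin (top_of_set (sphere 0 1)) (U s)" for s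
    unfolding U_def by (intro openin_open_Int open_Collect_less continuous_intros)
  show "\<exists>T. M \<in> T \<and> openin (top_of_set (veronese ` sphere 0 1)) T \<and>
           (\<exists>v. \<Union> v = sphere 0 1 \<inter> veronese -` T \<and>
                (\<forall>u\<in>v. openin (top_of_set (sphere 0 1)) u) \<and>
                pairwise disjnt v \<and> (\<forall>u\<in>v. \<exists>q. homeomorphism u T veronese q))"
  proof (intro exI[of _ T] conjI exI[of _ "{U 1, U (- 1)}"])
    have "a \<bullet> a = 1" using a(1) by (simp add: norm_eq_1)
    then show "M \<in> T" using a vT[of a] by simp
    show "openin (top_of_set (veronese ` sphere 0 1)) T"
      unfolding T_def by (intro openin_open_Int open_Collect_less continuous_intros cM)
    show "\<Union> {U 1, U (- 1)} = sphere 0 1 \<inter> veronese -` T"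
      by (intro equalityI subsetI) (auto simp: U_def vT neq_iff)
    show "pairwise disjnt {U 1, U (- 1)}" by (auto simp: pairwise_def disjnt_def U_def)
    show "\<forall>u\<in>{U 1, U (- 1)}. \<exists>q. homeomorphism u T veronese q" using homeo by simp
    show "\<forall>u\<in>{U 1, U (- 1)}. openin (top_of_set (sphere 0 1)) u" using op by simp
  qed
qed

lemma arc_systemD:
  assumes "arc_system n adj X w g"
  shows "inj_on w {..<n}" "w ` {..<n} \<subseteq> X"
    and "\<And>i j. i < j \<Longrightarrow> j < n \<Longrightarrow> adj i j \<Longrightarrow> continuous_on {0..1} (g i j)"
    and "\<And>i j. i < j \<Longrightarrow> j < n \<Longrightarrow> adj i j \<Longrightarrow> inj_on (g i j) {0..1}"
    and "\<And>i j. i < j \<Longrightarrow> j < n \<Longrightarrow> adj i j \<Longrightarrow> g i j ` {0..1} \<subseteq> X"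
    and "\<And>i j. i < j \<Longrightarrow> j < n \<Longrightarrow> adj i j \<Longrightarrow> g i j 0 = w i"
    and "\<And>i j. i < j \<Longrightarrow> j < n \<Longrightarrow> adj i j \<Longrightarrow> g i j 1 = w j"
    and "\<And>i j k t. i < j \<Longrightarrow> j < n \<Longrightarrow> adj i j \<Longrightarrow> k < n \<Longrightarrow> k \<noteq> i \<Longrightarrow> k \<noteq> j \<Longrightarrow> t \<in> {0..1} \<Longrightarrow> g i j t \<noteq> w k"
    and "\<And>i j k l s t. i < j \<Longrightarrow> j < n \<Longrightarrow> adj i j \<Longrightarrow> k < l \<Longrightarrow> l < n \<Longrightarrow> adj k l \<Longrightarrow> {i, j} \<inter> {k, l} = {} \<Longrightarrow>
      s \<in> {0..1} \<Longrightarrow> t \<in> {0..1} \<Longrightarrow> g i j s \<noteq> g k l t"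
proof -
  have A: "inj_on w {..<n}" "w ` {..<n} \<subseteq> X"
    "\<forall>i j. i < j \<and> j < n \<and> adj i j \<longrightarrow>
        continuous_on {0..1} (g i j) \<and> inj_on (g i j) {0..1} \<and> g i j ` {0..1} \<subseteq> X \<and>
        g i j 0 = w i \<and> g i j 1 = w j \<and> (\<forall>k<n. k \<noteq> i \<and> k \<noteq> j \<longrightarrow> w k \<notin> g i j ` {0..1})"
    "\<forall>i j k l. i < j \<and> j < n \<and> adj i j \<and> k < l \<and> l < n \<and> adj k l \<and> {i, j} \<inter> {k, l} = {} \<longrightarrow>
        g i j ` {0..1} \<inter> g k l ` {0..1} = {}"
    using assms unfolding arc_system_def by simp_all
  show "inj_on w {..<n}" "w ` {..<n} \<subseteq> X" by (rule A)+
  fix i j assume ij: "i < j" "j < n" "adj i j"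
  then have B: "continuous_on {0..1} (g i j) \<and> inj_on (g i j) {0..1} \<and> g i j ` {0..1} \<subseteq> X \<and>
        g i j 0 = w i \<and> g i j 1 = w j \<and> (\<forall>k<n. k \<noteq> i \<and> k \<noteq> j \<longrightarrow> w k \<notin> g i j ` {0..1})"
    using A(3) by simp
  then show "continuous_on {0..1} (g i j)" "inj_on (g i j) {0..1}" "g i j ` {0..1} \<subseteq> X"
        "g i j 0 = w i" "g i j 1 = w j" by simp_all
  show "g i j t \<noteq> w k" if k: "k < n" "k \<noteq> i" "k \<noteq> j" and t: "t \<in> {0..1}" for k t
  proof -
    have "w k \<notin> g i j ` {0..1}" using B k by simp
    moreover have "g i j t \<in> g i j ` {0..1}" using t by (rule imageI)
    ultimately show ?thesis by metis
  qed
  show "g i j s \<noteq> g k l t" if kl: "k < l" "l < n" "adj k l" "{i, j} \<inter> {k, l} = {}"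
    and st: "s \<in> {0..1}" "t \<in> {0..1}" for k l s t
  proof -
    have "g i j ` {0..1} \<inter> g k l ` {0..1} = {}" using A(4) ij kl by blast
    moreover have "g i j s \<in> g i j ` {0..1}" "g k l t \<in> g k l ` {0..1}" using st by (simp_all only: imageI)
    ultimately show ?thesis by (metis IntI emptyE)
  qed
qed

text \<open>The arcs are lifted through the double cover. As lift of vertex \<open>j\<close> the end
  point of the lifted star edge from 0 to \<open>j\<close> is taken, which makes all star edges
  untwisted.\<close>

theorem projective_plane_drawing:
  fixes v :: "nat \<Rightarrow> 'v"
  assumes P: "real_projective_plane S" and emb: "graph_embeds_in (V, E) S"
    and v: "inj_on v {..<n}" "v ` {..<n} \<subseteq> V" and n: "2 \<le> n"
    and star: "\<And>j. 0 < j \<Longrightarrow> j < n \<Longrightarrow> {v 0, v j} \<in> E"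
  obtains p y e where "projective_drawing n (\<lambda>i j. {v i, v j} \<in> E) p y e"
    "\<And>j. 0 < j \<Longrightarrow> j < n \<Longrightarrow> \<not> y 0 j"
proof -
  obtain q where q: "quotient_map (top_of_set (sphere (0 :: real^3) 1)) S q"
    and qeq: "\<And>x y. x \<in> sphere 0 1 \<Longrightarrow> y \<in> sphere 0 1 \<Longrightarrow> q x = q y \<longleftrightarrow> x = y \<or> x = - y"
    using P unfolding real_projective_plane_def by blast
  let ?X = "veronese ` sphere 0 1"
  have qS: "q ` sphere 0 1 = topspace S" using quotient_imp_surjective_map[OF q] by simp
  \<comment> \<open>\<open>inv_into\<close> picks one of two antipodal preimages, and
    \<open>veronese\<close> does not see which; hence \<open>H\<close> composed with
    \<open>q\<close> is \<open>veronese\<close>, and \<open>H\<close> is continuous by the quotient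
    property.\<close>
  define H where "H x = veronese (inv_into (sphere 0 1) q x)" for x
  have Hq: "H (q x) = veronese x" if x: "x \<in> sphere 0 1" for x
  proof -
    define z where "z = inv_into (sphere 0 1) q (q x)"
    have "q x \<in> q ` sphere 0 1" using x by (rule imageI)
    then have "z \<in> sphere 0 1" "q z = q x"
      unfolding z_def by (rule inv_into_into, rule f_inv_into_f)
    then have "z = x \<or> z = - x" using qeq[of z x] x by blast
    then show ?thesis unfolding H_def z_def[symmetric] by auto
  qed
  have "continuous_map (top_of_set (sphere 0 1)) (top_of_set ?X) veronese"
    using continuous_on_veronese by auto
  then have "continuous_map (top_of_set (sphere 0 1)) (top_of_set ?X) (H \<circ> q)"
    by (rule continuous_map_eq) (simp add: Hq)
  then have Hc: "continuous_map S (top_of_set ?X) H" using continuous_compose_quotient_map[OF q] by blast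
  have Hinj: "inj_on H (topspace S)"
  proof (rule inj_onI)
    fix a b assume "a \<in> topspace S" "b \<in> topspace S" "H a = H b"
    moreover from this obtain x z where x: "x \<in> sphere 0 1" "a = q x" and z: "z \<in> sphere 0 1" "b = q z"
      using qS by blast
    ultimately have "veronese x = veronese z" by (simp add: Hq)
    then have "x = z \<or> x = - z" using veronese_eq_iff x(1) z(1) by simp
    then show "a = b" using qeq[OF x(1) z(1)] x z by simp
  qed
  let ?adj = "\<lambda>i j. {v i, v j} \<in> E"
  obtain w g where sys: "arc_system n ?adj ?X w g"
    using graph_arc_system[OF emb Hc Hinj v] by blast
  note winj = arc_systemD(1)[OF sys] and wX = arc_systemD(2)[OF sys]
  note gs = arc_systemD(3-7)[OF sys] and gs6 = arc_systemD(8)[OF sys] and dis = arc_systemD(9)[OF sys]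
  define lift where "lift i j a = (SOME h. continuous_on {0..1} h \<and> h ` {0..1} \<subseteq> sphere 0 1 \<and> h 0 = a \<and>
      (\<forall>t\<in>{0..1}. veronese (h t) = g i j t))" for i j a
  have lift: "continuous_on {0..1} (lift i j a) \<and> lift i j a ` {0..1} \<subseteq> sphere 0 1 \<and> lift i j a 0 = a \<and>
      (\<forall>t\<in>{0..1}. veronese (lift i j a t) = g i j t)"
    if ij: "i < j" "j < n" "?adj i j" "a \<in> sphere 0 1" "veronese a = w i" for i j a
  proof -
    obtain h where "path h" "path_image h \<subseteq> sphere 0 1" "pathstart h = a"
        "\<And>t. t \<in> {0..1} \<Longrightarrow> veronese (h t) = g i j t"
      by (rule covering_space_lift_path_strong[OF covering_space_veronese ij(4), of "g i j"])
         (use gs[OF ij(1-3)] ij in \<open>auto simp: path_def path_image_def pathstart_def\<close>)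
    then have "continuous_on {0..1} h \<and> h ` {0..1} \<subseteq> sphere 0 1 \<and> h 0 = a \<and>
      (\<forall>t\<in>{0..1}. veronese (h t) = g i j t)" by (simp add: path_def path_image_def pathstart_def)
    then show ?thesis unfolding lift_def
      by (rule someI[where P = "\<lambda>h. continuous_on {0..1} h \<and> h ` {0..1} \<subseteq> sphere 0 1 \<and> h 0 = a \<and>
        (\<forall>t\<in>{0..1}. veronese (h t) = g i j t)"])
  qed
  have "w 0 \<in> ?X" using wX n by auto
  then obtain a0 where a0: "a0 \<in> sphere 0 1" "w 0 = veronese a0" by blast
  define a where "a i = (if i = 0 then a0 else lift 0 i a0 1)" for i
  have a: "a i \<in> sphere 0 1 \<and> veronese (a i) = w i" if i: "i < n" for i
  proof (cases "i = 0")
    case False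
    then have i: "0 < i" "i < n" "?adj 0 i" using i star by auto
    have "lift 0 i a0 ` {0..1} \<subseteq> sphere 0 1" "\<forall>t\<in>{0..1}. veronese (lift 0 i a0 t) = g 0 i t"
      using lift[OF i a0(1) a0(2)[symmetric]] by blast+
    moreover have "lift 0 i a0 1 \<in> lift 0 i a0 ` {0..1}" by (rule imageI) simp
    ultimately have "lift 0 i a0 1 \<in> sphere 0 1" "veronese (lift 0 i a0 1) = w i"
      using gs(5)[OF i] by (blast, simp)
    then show ?thesis using False by (simp add: a_def)
  next
    case True
    then show ?thesis using a0 by (simp add: a_def)
  qed
  define l where "l i j = lift i j (a i)" for i j
  have l: "continuous_on {0..1} (l i j)" "l i j ` {0..1} \<subseteq> sphere 0 1" "l i j 0 = a i"
      "\<And>t. t \<in> {0..1} \<Longrightarrow> veronese (l i j t) = g i j t" if ij: "i < j" "j < n" "?adj i j" for i j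
  proof -
    have "i < n" using ij by linarith
    from a[OF this] have "a i \<in> sphere 0 1" "veronese (a i) = w i" by blast+
    note L = lift[OF ij this, folded l_def]
    show "continuous_on {0..1} (l i j)" "l i j ` {0..1} \<subseteq> sphere 0 1" "l i j 0 = a i"
      "\<And>t. t \<in> {0..1} \<Longrightarrow> veronese (l i j t) = g i j t" using L by blast+
  qed
  have linj: "inj_on (l i j) {0..1}" if ij: "i < j" "j < n" "?adj i j" for i j
    using gs(2)[OF ij] l(4)[OF ij] by (intro inj_onI) (metis inj_onD)
  define I where "I = {(i, j). i < j \<and> j < n \<and> ?adj i j}"
  have "I \<subseteq> {..<n} \<times> {..<n}" by (auto simp: I_def)
  then have fin: "finite ((\<lambda>(i, j). l i j) ` I)" using finite_subset by blast
  have arcs: "continuous_on {0..1} h \<and> inj_on h {0..1} \<and> h ` {0..1} \<subseteq> sphere 0 1"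
    if hI: "h \<in> (\<lambda>(i, j). l i j) ` I" for h
  proof -
    obtain i j where ij: "i < j" "j < n" "?adj i j" and h: "h = l i j" using hI by (auto simp: I_def)
    show ?thesis unfolding h using l(1)[OF ij] linj[OF ij] l(2)[OF ij] by (intro conjI)
  qed
  obtain A and st :: "real^3 \<Rightarrow> complex" where
    lA: "\<And>h. h \<in> (\<lambda>(i, j). l i j) ` I \<Longrightarrow> h ` {0..1} \<subseteq> A" and A: "A \<subseteq> sphere 0 1" "\<And>x. x \<in> A \<Longrightarrow> - x \<in> A"
    and st: "continuous_on A st" "inj_on st A" "\<And>x. x \<in> A \<Longrightarrow> st x \<noteq> 0 \<and> st (- x) = antipode (st x)"
    by (rule stereographic_coordinates[OF fin], erule arcs, rule that)
  have lA: "l i j t \<in> A" if "i < j" "j < n" "?adj i j" "t \<in> {0..1}" for i j t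
  proof -
    have "l i j \<in> (\<lambda>(i, j). l i j) ` I" using that by (auto simp: I_def)
    then show ?thesis using lA that(4) by blast
  qed
  have aA: "a i \<in> A" if "i < n" for i
  proof (cases "i = 0")
    case True
    then show ?thesis using lA[of 0 1 0] l(3)[of 0 1] star[of 1] n by simp
  next
    case False
    then show ?thesis using lA[of 0 i 1] star[of i] that by (simp add: l_def a_def)
  qed
  have st_eq: "veronese x = veronese z" if "x \<in> A" "z \<in> A" "st x = st z \<or> st x = antipode (st z)" for x z
  proof -
    have "st x = st z \<or> st x = st (- z)" using st(3)[OF that(2)] that(3) by auto
    then have "x = z \<or> x = - z" using inj_onD[OF st(2)] that(1,2) A(2) by blast
    then show ?thesis by auto
  qed
  \<comment> \<open>The lifted edge ends over vertex \<open>j\<close>, so the only other possibility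
    is \<open>- a j\<close>.\<close>
  define y where "y i j \<longleftrightarrow> l i j 1 \<noteq> a j" for i j
  have drawing: "projective_drawing n ?adj (\<lambda>i. st (a i)) y (\<lambda>i j t. st (l i j t))"
    unfolding projective_drawing_def
  proof (intro conjI allI impI ballI; (elim conjE)?)
    show "st (a i) \<noteq> 0" if "i < n" for i using st(3) aA[OF that] by blast
    have ak: "\<not> (st (a i) = st (a k) \<or> st (a i) = antipode (st (a k)))" if "i < n" "k < n" "i \<noteq> k" for i k
    proof
      assume "st (a i) = st (a k) \<or> st (a i) = antipode (st (a k))"
      then have "veronese (a i) = veronese (a k)" by (rule st_eq[OF aA[OF that(1)] aA[OF that(2)]])
      then have "w i = w k" using a[OF that(1)] a[OF that(2)] by simp
      then show False using inj_onD[OF winj] that by simp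
    qed
    then show "st (a i) \<noteq> st (a k)" "st (a i) \<noteq> antipode (st (a k))" if "i < n" "k < n" "i \<noteq> k" for i k
      using that by blast+
    fix i j assume ij: "i < j" "j < n" "?adj i j"
    show "continuous_on {0..1} (\<lambda>t. st (l i j t))"
      by (rule continuous_on_compose2[OF st(1) l(1)[OF ij]]) (use lA[OF ij] in blast)
    show "st (l i j 0) = st (a i)" by (simp add: l(3)[OF ij])
    have "veronese (l i j 1) = veronese (a j)" using l(4)[OF ij, of 1] gs(5)[OF ij] a[OF ij(2)] by simp
    moreover have "norm (l i j 1) = 1" "norm (a j) = 1" using lA[OF ij, of 1] aA[OF ij(2)] A(1) by auto
    ultimately have "l i j 1 = a j \<or> l i j 1 = - a j" using veronese_eq_iff by blast
    then show "st (l i j 1) = twist (y i j) (st (a j))"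
      using st(3)[OF aA[OF ij(2)]] by (auto simp: twist_def y_def)
    fix t :: real and k assume t: "t \<in> {0..1}" and k: "k < n" "k \<noteq> i" "k \<noteq> j"
    have "\<not> (st (l i j t) = st (a k) \<or> st (l i j t) = antipode (st (a k)))"
    proof
      assume "st (l i j t) = st (a k) \<or> st (l i j t) = antipode (st (a k))"
      then have "veronese (l i j t) = veronese (a k)" by (rule st_eq[OF lA[OF ij t] aA[OF k(1)]])
      then have "g i j t = w k" using l(4)[OF ij t] a[OF k(1)] by simp
      then show False using gs6[OF ij k t] by simp
    qed
    then show "st (l i j t) \<noteq> st (a k)" "st (l i j t) \<noteq> antipode (st (a k))" by blast+
  next
    fix i j k m and s t :: real assume ij: "i < j" "j < n" "?adj i j" and km: "k < m" "m < n" "?adj k m"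
      and d: "{i, j} \<inter> {k, m} = {}" and s: "s \<in> {0..1}" and t: "t \<in> {0..1}"
    have "\<not> (st (l i j s) = st (l k m t) \<or> st (l i j s) = antipode (st (l k m t)))"
    proof
      assume "st (l i j s) = st (l k m t) \<or> st (l i j s) = antipode (st (l k m t))"
      then have "veronese (l i j s) = veronese (l k m t)" by (rule st_eq[OF lA[OF ij s] lA[OF km t]])
      then have "g i j s = g k m t" using l(4)[OF ij s] l(4)[OF km t] by simp
      then show False using dis[OF ij km d s t] by simp
    qed
    then show "st (l i j s) \<noteq> st (l k m t)" "1 + cnj (st (l i j s)) * st (l k m t) \<noteq> 0"
      using eq_antipode_iff[of "st (l k m t)"] st(3)[OF lA[OF km t]] by blast+
  qed
  show ?thesis
  proof (rule that[OF drawing])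
    show "\<not> y 0 j" if "0 < j" "j < n" for j using that by (simp add: y_def l_def a_def)
  qed
qed

text \<open>A plane drawing becomes an untwisted projective one after the plane is shrunk into the
  open unit disc by z / (1 + |z|): antipodes of nonzero points of the disc lie outside it, so no two
  points are antipodal.\<close>

theorem sphere_drawing:
  fixes v :: "nat \<Rightarrow> 'v"
  assumes P: "S homeomorphic_space top_of_set (sphere (0 :: real^3) 1)" and emb: "graph_embeds_in (V, E) S"
    and v: "inj_on v {..<n}" "v ` {..<n} \<subseteq> V" and n: "2 \<le> n"
    and star: "\<And>j. 0 < j \<Longrightarrow> j < n \<Longrightarrow> {v 0, v j} \<in> E"
  obtains p e where "projective_drawing n (\<lambda>i j. {v i, v j} \<in> E) p (\<lambda>_ _. False) e"
proof -
  let ?X = "sphere (0 :: real^3) 1"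
  obtain H where "homeomorphic_map S (top_of_set ?X) H" using P homeomorphic_space by blast
  then have Hc: "continuous_map S (top_of_set ?X) H" and Hinj: "inj_on H (topspace S)"
    by (simp_all add: homeomorphic_imp_continuous_map homeomorphic_imp_injective_map)
  let ?adj = "\<lambda>i j. {v i, v j} \<in> E"
  obtain w g where sys: "arc_system n ?adj ?X w g"
    using graph_arc_system[OF emb Hc Hinj v] by blast
  note winj = arc_systemD(1)[OF sys] and wX = arc_systemD(2)[OF sys]
  note gs = arc_systemD(3-7)[OF sys] and gs6 = arc_systemD(8)[OF sys] and dis = arc_systemD(9)[OF sys]
  define I where "I = {(i, j). i < j \<and> j < n \<and> ?adj i j}"
  have "I \<subseteq> {..<n} \<times> {..<n}" by (auto simp: I_def)
  then have fin: "finite ((\<lambda>(i, j). g i j) ` I)" using finite_subset by blast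
  have arcs: "continuous_on {0..1} h \<and> inj_on h {0..1} \<and> h ` {0..1} \<subseteq> sphere 0 1"
    if hI: "h \<in> (\<lambda>(i, j). g i j) ` I" for h
  proof -
    obtain i j where ij: "i < j" "j < n" "?adj i j" and h: "h = g i j" using hI by (auto simp: I_def)
    show ?thesis unfolding h using gs(1)[OF ij] gs(2)[OF ij] gs(3)[OF ij] by (intro conjI)
  qed
  obtain A and st :: "real^3 \<Rightarrow> complex" where
    gA: "\<And>h. h \<in> (\<lambda>(i, j). g i j) ` I \<Longrightarrow> h ` {0..1} \<subseteq> A" and A: "A \<subseteq> sphere 0 1" "\<And>x. x \<in> A \<Longrightarrow> - x \<in> A"
    and st: "continuous_on A st" "inj_on st A" "\<And>x. x \<in> A \<Longrightarrow> st x \<noteq> 0 \<and> st (- x) = antipode (st x)"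
    by (rule stereographic_coordinates[OF fin], erule arcs, rule that)
  have gA: "g i j t \<in> A" if "i < j" "j < n" "?adj i j" "t \<in> {0..1}" for i j t
  proof -
    have "g i j \<in> (\<lambda>(i, j). g i j) ` I" using that by (auto simp: I_def)
    then show ?thesis using gA that(4) by blast
  qed
  have wA: "w i \<in> A" if "i < n" for i
  proof (cases "i = 0")
    case True
    then show ?thesis using gA[of 0 1 0] gs(4)[of 0 1] star[of 1] n by simp
  next
    case False
    then show ?thesis using gA[of 0 i 1] gs(5)[of 0 i] star[of i] that by simp
  qed
  define r where "r z = (1 / (1 + cmod z)) *\<^sub>R z" for z
  have pos: "1 + cmod z > 0" for z by (simp add: add_pos_nonneg)
  have nr: "cmod (r z) = cmod z / (1 + cmod z)" for z
    using pos[of z] by (simp add: r_def)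
  then have r1: "cmod (r z) < 1" for z using pos[of z] by (simp add: nr)
  have r_eq: "z = u" if "r z = r u" for z u
  proof -
    have "cmod z / (1 + cmod z) = cmod u / (1 + cmod u)" using that nr by metis
    then have "cmod z = cmod u" using pos[of z] pos[of u] by (simp add: field_simps)
    then show ?thesis using that pos[of u] by (simp add: r_def)
  qed
  have r_0: "r z \<noteq> 0" if "z \<noteq> 0" for z using r_eq[of z 0] that by (auto simp: r_def)
  have r_ne: "r z \<noteq> antipode (r u)" if "u \<noteq> 0" for z u
  proof
    assume "r z = antipode (r u)"
    then have "cmod (r z) = 1 / cmod (r u)" by (simp add: antipode_def norm_divide)
    moreover have "1 < 1 / cmod (r u)" using r_0[OF that] r1[of u] by simp
    ultimately have "1 < cmod (r z)" by simp
    then show False using r1[of z] by simp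
  qed
  have cr: "continuous_on B r" for B
    unfolding r_def by (intro continuous_intros) (metis less_irrefl pos)
  have "projective_drawing n ?adj (\<lambda>i. r (st (w i))) (\<lambda>_ _. False) (\<lambda>i j t. r (st (g i j t)))"
    unfolding projective_drawing_def
  proof (intro conjI allI impI ballI; (elim conjE)?)
    show "r (st (w i)) \<noteq> 0" if "i < n" for i using st(3) wA[OF that] r_0 by blast
    show "r (st (w i)) \<noteq> r (st (w k))" if "i < n" "k < n" "i \<noteq> k" for i k
      using r_eq inj_onD[OF st(2) _ wA[OF that(1)] wA[OF that(2)]] inj_onD[OF winj, of i k] that by auto
    show "r (st (w i)) \<noteq> antipode (r (st (w k)))" if "i < n" "k < n" "i \<noteq> k" for i k
      using r_ne st(3)[OF wA[OF that(2)]] by blast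
    fix i j assume ij: "i < j" "j < n" "?adj i j"
    have "continuous_on {0..1} (\<lambda>t. st (g i j t))"
      by (rule continuous_on_compose2[OF st(1) gs(1)[OF ij]]) (use gA[OF ij] in blast)
    then show "continuous_on {0..1} (\<lambda>t. r (st (g i j t)))"
      by (rule continuous_on_compose2[OF cr[of UNIV]]) simp
    show "r (st (g i j 0)) = r (st (w i))" "r (st (g i j 1)) = twist False (r (st (w j)))"
      by (simp_all add: gs[OF ij] twist_def)
    fix t :: real and k assume t: "t \<in> {0..1}" and k: "k < n" "k \<noteq> i" "k \<noteq> j"
    have "g i j t \<noteq> w k" using gs6[OF ij k t] by simp
    then show "r (st (g i j t)) \<noteq> r (st (w k))"
      using r_eq inj_onD[OF st(2) _ gA[OF ij t] wA[OF k(1)]] by blast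
    show "r (st (g i j t)) \<noteq> antipode (r (st (w k)))" using r_ne st(3)[OF wA[OF k(1)]] by blast
  next
    fix i j k m and s t :: real assume ij: "i < j" "j < n" "?adj i j" and km: "k < m" "m < n" "?adj k m"
      and d: "{i, j} \<inter> {k, m} = {}" and s: "s \<in> {0..1}" and t: "t \<in> {0..1}"
    have "g i j s \<noteq> g k m t" using dis[OF ij km d s t] .
    then show "r (st (g i j s)) \<noteq> r (st (g k m t))"
      using r_eq inj_onD[OF st(2) _ gA[OF ij s] gA[OF km t]] by blast
    show "1 + cnj (r (st (g i j s))) * r (st (g k m t)) \<noteq> 0"
      using eq_antipode_iff[OF r_0] r_ne st(3)[OF gA[OF km t]] by blast
  qed
  then show ?thesis by (rule that)
qed

section \<open>Drawings by radial projection from 3-space\<close>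

text \<open>Vectors serve as homogeneous coordinates, and an edge is the radial projection of the
  segment between its end vectors \<open>A\<close> and \<open>B\<close>. If \<open>\<Phi>\<close>
  identifies antipodes, \<open>B\<close> may be negated, which draws the edge along the
  complementary segment of the projective line, through infinity. Meetings are excluded up to sign,
  so one criterion serves the sphere and the projective plane.\<close>

lemma cone_drawing:
  fixes \<Phi> :: "real^3 \<Rightarrow> 'x::metric_space" and P :: "'v \<Rightarrow> real^3"
    and D :: "'v set \<Rightarrow> real^3 \<Rightarrow> real^3 \<Rightarrow> bool"
  assumes cont: "continuous_on (sphere 0 1) \<Phi>"
    and inj: "\<And>x y. x \<in> sphere 0 1 \<Longrightarrow> y \<in> sphere 0 1 \<Longrightarrow> \<Phi> x = \<Phi> y \<Longrightarrow> x = y \<or> x = - y"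
    and nz: "\<And>v. v \<in> V \<Longrightarrow> P v \<noteq> 0"
    and dist: "\<And>u v c. u \<in> V \<Longrightarrow> v \<in> V \<Longrightarrow> u \<noteq> v \<Longrightarrow> P u \<noteq> c *\<^sub>R P v"
    and edge: "\<And>e. e \<in> E \<Longrightarrow> \<exists>A B. D e A B"
    and D: "\<And>e A B. e \<in> E \<Longrightarrow> D e A B \<Longrightarrow> \<exists>u\<in>V. \<exists>v\<in>V. u \<noteq> v \<and> e = {u, v} \<and> A = P u \<and>
        (B = P v \<or> B = - P v \<and> (\<forall>x\<in>sphere 0 1. \<Phi> (- x) = \<Phi> x))"
    and vertex: "\<And>e A B v \<alpha> \<beta> c. e \<in> E \<Longrightarrow> D e A B \<Longrightarrow> v \<in> V \<Longrightarrow> 0 < \<alpha> \<Longrightarrow> 0 < \<beta> \<Longrightarrow>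
        \<alpha> *\<^sub>R A + \<beta> *\<^sub>R B \<noteq> c *\<^sub>R P v"
    and cross: "\<And>e A B e' A' B' \<alpha> \<beta> \<alpha>' \<beta>'. e \<in> E \<Longrightarrow> D e A B \<Longrightarrow> e' \<in> E \<Longrightarrow> D e' A' B' \<Longrightarrow> e \<noteq> e' \<Longrightarrow>
        0 < \<alpha> \<Longrightarrow> 0 < \<beta> \<Longrightarrow> 0 < \<alpha>' \<Longrightarrow> 0 < \<beta>' \<Longrightarrow>
        \<alpha> *\<^sub>R A + \<beta> *\<^sub>R B \<noteq> \<alpha>' *\<^sub>R A' + \<beta>' *\<^sub>R B' \<and> \<alpha> *\<^sub>R A + \<beta> *\<^sub>R B \<noteq> - (\<alpha>' *\<^sub>R A' + \<beta>' *\<^sub>R B')"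
  shows "graph_embeds_in (V, E) (top_of_set (\<Phi> ` sphere 0 1))"
proof -
  define nm :: "real^3 \<Rightarrow> real^3" where "nm x = x /\<^sub>R norm x" for x
  have nm: "nm x \<in> sphere 0 1" if "x \<noteq> 0" for x using that by (simp add: nm_def)
  have nm_eq: "\<exists>c. c \<noteq> 0 \<and> x = c *\<^sub>R y" if "\<Phi> (nm x) = \<Phi> (nm y)" "x \<noteq> 0" "y \<noteq> 0" for x y
  proof -
    have "nm x = nm y \<or> nm x = - nm y" using inj nm that by blast
    moreover have "x = norm x *\<^sub>R nm x" using that(2) by (simp add: nm_def)
    ultimately have "x = norm x *\<^sub>R nm y \<or> x = (- norm x) *\<^sub>R nm y" by (metis scaleR_minus_left scaleR_minus_right)
    then have "x = (norm x / norm y) *\<^sub>R y \<or> x = (- norm x / norm y) *\<^sub>R y"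
      by (simp add: nm_def divide_inverse)
    moreover have "norm x / norm y \<noteq> 0" "- norm x / norm y \<noteq> 0" using that by simp_all
    ultimately show ?thesis by blast
  qed
  obtain A B where AB: "\<And>e. e \<in> E \<Longrightarrow> D e (A e) (B e)" using edge by metis
  define p where "p e t = (1 - t) *\<^sub>R A e + t *\<^sub>R B e" for e and t :: real
  define \<phi> where "\<phi> v = \<Phi> (nm (P v))" for v
  define \<gamma> where "\<gamma> e t = \<Phi> (nm (p e t))" for e t
  \<comment> \<open>The end vectors are linearly independent: the segment avoids the origin, and
    radial projection is injective on it.\<close>
  have ind: "a = 0 \<and> b = 0" if e: "e \<in> E" and ab: "a *\<^sub>R A e + b *\<^sub>R B e = 0" for e a b
  proof -
    obtain u v where uv: "u \<in> V" "v \<in> V" "u \<noteq> v" "A e = P u" "B e = P v \<or> B e = - P v"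
      using D[OF e AB[OF e]] by blast
    have "a = 0"
    proof (rule ccontr)
      assume "a \<noteq> 0"
      have "a *\<^sub>R A e = (- b) *\<^sub>R B e" using ab by (simp add: eq_neg_iff_add_eq_0)
      then have "A e = (- b / a) *\<^sub>R B e" using \<open>a \<noteq> 0\<close>
        by (metis (no_types, lifting) divide_inverse_commute inverse_eq_divide scaleR_left.minus scaleR_scaleR scaleR_one
            left_inverse)
      then have "P u = (- b / a) *\<^sub>R P v \<or> P u = (b / a) *\<^sub>R P v" using uv by auto
      then show False using dist uv by blast
    qed
    moreover have "B e \<noteq> 0" using uv nz by auto
    ultimately show ?thesis using ab by simp
  qed
  have p0: "p e t \<noteq> 0" if "e \<in> E" for e t using ind[OF that, of "1 - t" t] by (auto simp: p_def)
  have inter: "\<exists>\<alpha> \<beta>. 0 < \<alpha> \<and> 0 < \<beta> \<and> p e t = \<alpha> *\<^sub>R A e + \<beta> *\<^sub>R B e" if "t \<in> {0<..<1}" for e t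
    using that by (intro exI[of _ "1 - t"] exI[of _ t]) (simp add: p_def)
  have cnm: "continuous_on (- {0}) nm" unfolding nm_def by (intro continuous_intros) auto
  show ?thesis
    unfolding graph_embeds_in_def prod.case
  proof (intro exI[of _ \<phi>] exI[of _ \<gamma>] conjI ballI impI)
    show "inj_on \<phi> V"
    proof (rule inj_onI, rule ccontr)
      fix u v assume uv: "u \<in> V" "v \<in> V" "\<phi> u = \<phi> v" "u \<noteq> v"
      then have "\<exists>c. c \<noteq> 0 \<and> P u = c *\<^sub>R P v" unfolding \<phi>_def by (intro nm_eq nz)
      then show False using dist uv by blast
    qed
    show "\<phi> ` V \<subseteq> topspace (top_of_set (\<Phi> ` sphere 0 1))" using nm nz unfolding \<phi>_def by auto
    fix e assume e: "e \<in> E"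
    have "continuous_on {0..1} (p e)" unfolding p_def by (intro continuous_intros)
    then have "continuous_on {0..1} (\<lambda>t. nm (p e t))"
      by (rule continuous_on_compose2[OF cnm]) (use p0[OF e] in auto)
    then have c: "continuous_on {0..1} (\<gamma> e)"
      unfolding \<gamma>_def by (rule continuous_on_compose2[OF cont]) (use nm p0[OF e] in blast)
    have i: "inj_on (\<gamma> e) {0..1}"
    proof (rule inj_onI)
      fix s t assume st: "s \<in> {0..1}" "t \<in> {0..1}" "\<gamma> e s = \<gamma> e t"
      then obtain c where c: "p e s = c *\<^sub>R p e t" using nm_eq p0[OF e] unfolding \<gamma>_def by blast
      have "(1 - s - c * (1 - t)) *\<^sub>R A e + (s - c * t) *\<^sub>R B e = p e s - c *\<^sub>R p e t"
        by (simp add: p_def algebra_simps)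
      then have "(1 - s - c * (1 - t)) *\<^sub>R A e + (s - c * t) *\<^sub>R B e = 0" using c by simp
      then have "1 - s - c * (1 - t) = 0 \<and> s - c * t = 0" by (rule ind[OF e])
      then have "c = 1" "s = c * t" by (simp_all add: algebra_simps)
      then show "s = t" by simp
    qed
    show "embedding_map (top_of_set {0..1}) (top_of_set (\<Phi> ` sphere 0 1)) (\<gamma> e)"
    proof (rule continuous_imp_embedding_map)
      show "compact_space (top_of_set {0..1::real})" by (simp add: compact_space_subtopology compactin_euclidean_iff)
      show "Hausdorff_space (top_of_set (\<Phi> ` sphere 0 1))" by (simp add: Hausdorff_space_subtopology Hausdorff_space_euclidean)
      show "continuous_map (top_of_set {0..1}) (top_of_set (\<Phi> ` sphere 0 1)) (\<gamma> e)"
        using c nm[OF p0[OF e]] by (auto simp: \<gamma>_def simp del: mem_sphere_0 intro!: imageI)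
      show "inj_on (\<gamma> e) (topspace (top_of_set {0..1}))" using i by simp
    qed
    obtain u v where uv: "u \<in> V" "v \<in> V" "u \<noteq> v" "e = {u, v}" "A e = P u"
        "B e = P v \<or> B e = - P v \<and> (\<forall>x\<in>sphere 0 1. \<Phi> (- x) = \<Phi> x)"
      using D[OF e AB[OF e]] by blast
    have "\<Phi> (nm (B e)) = \<phi> v" using uv(6)
    proof
      assume *: "B e = - P v \<and> (\<forall>x\<in>sphere 0 1. \<Phi> (- x) = \<Phi> x)"
      then have "nm (B e) = - nm (P v)" by (simp add: nm_def)
      then show ?thesis using * nm[OF nz[OF uv(2)]] unfolding \<phi>_def by metis
    qed (simp add: \<phi>_def)
    then show "{\<gamma> e 0, \<gamma> e 1} = \<phi> ` e" using uv by (simp add: \<gamma>_def p_def \<phi>_def)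
    show "\<gamma> e ` {0<..<1} \<inter> \<phi> ` V = {}"
    proof (rule ccontr)
      assume "\<gamma> e ` {0<..<1} \<inter> \<phi> ` V \<noteq> {}"
      then obtain t w where t: "t \<in> {0<..<1}" and w: "w \<in> V" "\<gamma> e t = \<phi> w" by blast
      obtain c where c: "p e t = c *\<^sub>R P w" using nm_eq[OF w(2)[unfolded \<gamma>_def \<phi>_def] p0[OF e] nz[OF w(1)]] by blast
      then show False using inter[OF t, of e] vertex[OF e AB[OF e] w(1)] by metis
    qed
    fix e' assume e': "e' \<in> E" "e \<noteq> e'"
    show "\<gamma> e ` {0<..<1} \<inter> \<gamma> e' ` {0<..<1} = {}"
    proof (rule ccontr)
      assume "\<gamma> e ` {0<..<1} \<inter> \<gamma> e' ` {0<..<1} \<noteq> {}"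
      then obtain s t where s: "s \<in> {0<..<1}" and t: "t \<in> {0<..<1}" and st: "\<gamma> e s = \<gamma> e' t" by blast
      obtain c where c: "c \<noteq> 0" "p e s = c *\<^sub>R p e' t"
        using nm_eq[OF st[unfolded \<gamma>_def] p0[OF e] p0[OF e'(1)]] by blast
      obtain \<alpha> \<beta> where 1: "0 < \<alpha>" "0 < \<beta>" "p e s = \<alpha> *\<^sub>R A e + \<beta> *\<^sub>R B e" using inter[OF s] by blast
      obtain \<alpha>' \<beta>' where 2: "0 < \<alpha>'" "0 < \<beta>'" "p e' t = \<alpha>' *\<^sub>R A e' + \<beta>' *\<^sub>R B e'" using inter[OF t] by blast
      \<comment> \<open>The factor \<open>c\<close> may be negative, hence the two clauses of
        \<open>cross\<close>.\<close>
      have "0 < \<bar>c\<bar> * \<alpha>'" "0 < \<bar>c\<bar> * \<beta>'" using c 2 by simp_all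
      note cross[OF e AB[OF e] e'(1) AB[OF e'(1)] e'(2) 1(1,2) this]
      moreover have "p e s = \<bar>c\<bar> *\<^sub>R p e' t \<or> p e s = - (\<bar>c\<bar> *\<^sub>R p e' t)" using c by (cases "c > 0") auto
      ultimately show False unfolding 1(3) 2(3) by (simp add: scaleR_add_right)
    qed
  qed
qed

text \<open>The classical embedding of the projective plane in 4-space: the square of x1 + i x2,
  with its imaginary part halved, and the products of x3 with x1 and x2.\<close>

definition projective_map :: "real^3 \<Rightarrow> real^4" where
  "projective_map x = ((x$1)\<^sup>2 - (x$2)\<^sup>2) *\<^sub>R axis 1 1 + (x$1 * x$2) *\<^sub>R axis 2 1
     + (x$1 * x$3) *\<^sub>R axis 3 1 + (x$2 * x$3) *\<^sub>R axis 4 1"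

text \<open>Surfaces in the definition of the crosscap number have points in \<open>real^4\<close>,
  so the sphere is moved there too.\<close>

definition sphere_map :: "real^3 \<Rightarrow> real^4" where
  "sphere_map x = x$1 *\<^sub>R axis 1 1 + x$2 *\<^sub>R axis 2 1 + x$3 *\<^sub>R axis 3 1"

lemma continuous_on_projective_map: "continuous_on S projective_map"
  unfolding projective_map_def by (intro continuous_intros)

lemma continuous_on_sphere_map: "continuous_on S sphere_map"
  unfolding sphere_map_def by (intro continuous_intros)

lemma projective_map_minus: "projective_map (- x) = projective_map x"
  by (simp add: projective_map_def)

lemma sphere_map_inj: "sphere_map x = sphere_map y \<Longrightarrow> x = y"
  by (simp add: sphere_map_def vec_eq_iff forall_4 forall_3 axis_def)

text \<open>The square determines x1 + i x2 up to sign, and the products with x3 transfer that sign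
  to x3. At the poles, where the square vanishes, the unit norm determines x3 up to sign.\<close>

lemma projective_map_inj:
  assumes x: "x \<in> sphere 0 1" and y: "y \<in> sphere 0 1" and eq: "projective_map x = projective_map y"
  shows "x = y \<or> x = - y"
proof -
  have n: "(u$1)\<^sup>2 + (u$2)\<^sup>2 + (u$3)\<^sup>2 = 1" if "u \<in> sphere 0 1" for u :: "real^3"
    using that by (simp add: norm_eq_1 inner_vec_def sum_3 power2_eq_square)
  have e: "(x$1)\<^sup>2 - (x$2)\<^sup>2 = (y$1)\<^sup>2 - (y$2)\<^sup>2" "x$1 * x$2 = y$1 * y$2" "x$1 * x$3 = y$1 * y$3" "x$2 * x$3 = y$2 * y$3"
    using eq by (simp_all add: projective_map_def vec_eq_iff forall_4 axis_def)
  have "(Complex (x$1) (x$2))\<^sup>2 = (Complex (y$1) (y$2))\<^sup>2"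
    using e(1,2) by (simp add: complex_eq_iff power2_eq_square mult.commute)
  then have "Complex (x$1) (x$2) = Complex (y$1) (y$2) \<or> Complex (x$1) (x$2) = - Complex (y$1) (y$2)"
    by (simp add: power2_eq_iff)
  then obtain s :: real where s: "s = 1 \<or> s = - 1" "x$1 = s * y$1" "x$2 = s * y$2"
    by (elim disjE) (force simp: complex_eq_iff)+
  have "x$3 = s * y$3 \<or> (x$1 = 0 \<and> x$2 = 0 \<and> y$1 = 0 \<and> y$2 = 0)"
  proof -
    have "y$1 * (s * x$3 - y$3) = 0" "y$2 * (s * x$3 - y$3) = 0"
      using e(3,4) s(2,3) by (simp_all add: algebra_simps)
    then have "s * x$3 = y$3 \<or> (y$1 = 0 \<and> y$2 = 0)" by auto
    then show ?thesis using s by auto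
  qed
  then show ?thesis
  proof
    assume "x$3 = s * y$3"
    then show ?thesis using s by (auto simp: vec_eq_iff forall_3)
  next
    assume z: "x$1 = 0 \<and> x$2 = 0 \<and> y$1 = 0 \<and> y$2 = 0"
    then have "(x$3)\<^sup>2 = (y$3)\<^sup>2" using n[OF x] n[OF y] by simp
    then show ?thesis using z by (auto simp: vec_eq_iff forall_3 power2_eq_iff)
  qed
qed

lemma real_projective_plane_image: "real_projective_plane (top_of_set (projective_map ` sphere 0 1))"
  unfolding real_projective_plane_def
proof (intro exI[of _ projective_map] conjI ballI)
  show "quotient_map (top_of_set (sphere 0 1)) (top_of_set (projective_map ` sphere 0 1)) projective_map"
    by (rule continuous_imp_quotient_map)
       (auto simp: continuous_on_projective_map compact_space_subtopology compactin_euclidean_iff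
         Hausdorff_space_subtopology Hausdorff_space_euclidean)
  show "projective_map x = projective_map y \<longleftrightarrow> x = y \<or> x = - y"
    if "x \<in> sphere 0 1" "y \<in> sphere 0 1" for x y
    using projective_map_inj[OF that] projective_map_minus[of y] by metis
qed

lemma sphere_image: "top_of_set (sphere_map ` sphere 0 1) homeomorphic_space top_of_set (sphere (0 :: real^3) 1)"
proof -
  have "homeomorphic_map (top_of_set (sphere 0 1)) (top_of_set (sphere_map ` sphere 0 1)) sphere_map"
    by (rule continuous_imp_homeomorphic_map)
       (auto simp: continuous_on_sphere_map compact_space_subtopology compactin_euclidean_iff
         Hausdorff_space_subtopology Hausdorff_space_euclidean intro: inj_onI sphere_map_inj)
  then show ?thesis using homeomorphic_map_imp_homeomorphic_space homeomorphic_space_sym by blast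
qed

definition vec3 :: "real \<Rightarrow> real \<Rightarrow> real \<Rightarrow> real^3" where
  "vec3 x y z = x *\<^sub>R axis 1 1 + y *\<^sub>R axis 2 1 + z *\<^sub>R axis 3 1"

lemma vec3_nth [simp]: "vec3 x y z $ 1 = x" "vec3 x y z $ 2 = y" "vec3 x y z $ 3 = z"
  by (simp_all add: vec3_def axis_def)

lemma vec3_eq: "(u :: real^3) = w \<longleftrightarrow> u $ 1 = w $ 1 \<and> u $ 2 = w $ 2 \<and> u $ 3 = w $ 3"
  by (simp add: vec_eq_iff forall_3)

section \<open>K5 as a pentagon in the projective plane\<close>

text \<open>In the chart X = x / z, Y = y / z these are the corners (0, 0), (1, -2), (2, -1), (2,
  1), (1, 2) of a convex pentagon. Any two of its diagonals share a corner or meet inside, so their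
  complementary segments through infinity do not cross.\<close>

definition pent :: "nat \<Rightarrow> real^3" where
  "pent k = (if k = 0 then vec3 0 0 1 else if k = 1 then vec3 1 (- 2) 1
     else if k = 2 then vec3 1 (- 1 / 2) (1 / 2) else if k = 3 then vec3 1 (1 / 2) (1 / 2) else vec3 1 2 1)"

text \<open>The diagonals of the pentagon are drawn through infinity: one of their ends is negated.\<close>

definition pent_edge :: "real^3 \<Rightarrow> real^3 \<Rightarrow> nat \<Rightarrow> nat \<Rightarrow> bool" where
  "pent_edge A B i j \<longleftrightarrow> A = pent i \<and>
     ((i, j) \<in> {(0, 1), (1, 2), (2, 3), (3, 4), (0, 4)} \<and> B = pent j \<or>
      (i, j) \<in> {(0, 2), (0, 3), (1, 3), (1, 4), (2, 4)} \<and> B = - pent j)"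

lemma pent_simps: "pent 0 = vec3 0 0 1" "pent 1 = vec3 1 (- 2) 1" "pent (Suc 0) = vec3 1 (- 2) 1"
  "pent 2 = vec3 1 (- 1 / 2) (1 / 2)" "pent 3 = vec3 1 (1 / 2) (1 / 2)" "pent 4 = vec3 1 2 1"
  by (simp_all add: pent_def)

text \<open>The ten cones written out in coordinates, so that disjointness becomes linear arithmetic
  for each pair of rows.\<close>

definition pent_row :: "nat \<Rightarrow> nat \<Rightarrow> real \<Rightarrow> real \<Rightarrow> real \<Rightarrow> real \<Rightarrow> real \<Rightarrow> bool" where
  "pent_row i j \<alpha> \<beta> x y z \<longleftrightarrow>
      i = 0 \<and> j = 1 \<and> x = \<beta> \<and> y = - 2 * \<beta> \<and> z = \<alpha> + \<beta> \<or>
      i = 1 \<and> j = 2 \<and> x = \<alpha> + \<beta> \<and> y = - 2 * \<alpha> - \<beta> / 2 \<and> z = \<alpha> + \<beta> / 2 \<or>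
      i = 2 \<and> j = 3 \<and> x = \<alpha> + \<beta> \<and> y = - \<alpha> / 2 + \<beta> / 2 \<and> z = \<alpha> / 2 + \<beta> / 2 \<or>
      i = 3 \<and> j = 4 \<and> x = \<alpha> + \<beta> \<and> y = \<alpha> / 2 + 2 * \<beta> \<and> z = \<alpha> / 2 + \<beta> \<or>
      i = 0 \<and> j = 4 \<and> x = \<beta> \<and> y = 2 * \<beta> \<and> z = \<alpha> + \<beta> \<or>
      i = 0 \<and> j = 2 \<and> x = - \<beta> \<and> y = \<beta> / 2 \<and> z = \<alpha> - \<beta> / 2 \<or>
      i = 0 \<and> j = 3 \<and> x = - \<beta> \<and> y = - \<beta> / 2 \<and> z = \<alpha> - \<beta> / 2 \<or>
      i = 1 \<and> j = 3 \<and> x = \<alpha> - \<beta> \<and> y = - 2 * \<alpha> - \<beta> / 2 \<and> z = \<alpha> - \<beta> / 2 \<or>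
      i = 1 \<and> j = 4 \<and> x = \<alpha> - \<beta> \<and> y = - 2 * \<alpha> - 2 * \<beta> \<and> z = \<alpha> - \<beta> \<or>
      i = 2 \<and> j = 4 \<and> x = \<alpha> - \<beta> \<and> y = - \<alpha> / 2 - 2 * \<beta> \<and> z = \<alpha> / 2 - \<beta>"

lemma pent_edge_row:
  assumes "pent_edge A B i j"
  shows "\<exists>x y z. \<alpha> *\<^sub>R A + \<beta> *\<^sub>R B = vec3 x y z \<and> pent_row i j \<alpha> \<beta> x y z"
proof (intro exI conjI)
  let ?v = "\<alpha> *\<^sub>R A + \<beta> *\<^sub>R B"
  show "?v = vec3 (?v $ 1) (?v $ 2) (?v $ 3)" by (simp add: vec3_eq)
  show "pent_row i j \<alpha> \<beta> (?v $ 1) (?v $ 2) (?v $ 3)"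
    using assms unfolding pent_edge_def
    by (elim conjE disjE insertE emptyE) (simp_all add: pent_simps pent_row_def)
qed

lemma pent_rows_disjoint:
  assumes "pent_row i j \<alpha> \<beta> x y z" "pent_row i' j' \<alpha>' \<beta>' x y z"
    and pos: "0 < \<alpha>" "0 < \<beta>" "0 < \<alpha>'" "0 < \<beta>'"
  shows "i = i' \<and> j = j'"
  using assms unfolding pent_row_def by (elim disjE conjE) simp_all

lemma pent_rows_disjoint_minus:
  assumes "pent_row i j \<alpha> \<beta> x y z" "pent_row i' j' \<alpha>' \<beta>' (- x) (- y) (- z)"
    and pos: "0 < \<alpha>" "0 < \<beta>" "0 < \<alpha>'" "0 < \<beta>'"
  shows "i = i' \<and> j = j'"
  using assms unfolding pent_row_def by (elim disjE conjE) simp_all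

text \<open>In the chart the excluded region is 0 \<le> Y < X \<le> 1/2, a triangle inside the
  pentagon with its apex at the corner (0, 0). It is reserved for the fan; the second alternative is
  its negative.\<close>

lemma pent_row_fan:
  assumes "pent_row i j \<alpha> \<beta> x y z" "0 < \<alpha>" "0 < \<beta>"
    and "0 < x \<and> 0 \<le> y \<and> y < x \<and> 2 * x \<le> z \<or> x < 0 \<and> y \<le> 0 \<and> x < y \<and> z \<le> 2 * x"
  shows False
  using assms(4)
proof
  assume "0 < x \<and> 0 \<le> y \<and> y < x \<and> 2 * x \<le> z"
  then show False using assms(1-3) unfolding pent_row_def by (elim disjE conjE) linarith+
next
  assume "x < 0 \<and> y \<le> 0 \<and> x < y \<and> z \<le> 2 * x"
  then show False using assms(1-3) unfolding pent_row_def by (elim disjE conjE) linarith+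
qed

lemma pent_row_vertex:
  assumes "pent_row i j \<alpha> \<beta> x y z" "0 < \<alpha>" "0 < \<beta>" "k \<le> 4"
  shows "vec3 x y z \<noteq> a *\<^sub>R pent k"
proof
  assume "vec3 x y z = a *\<^sub>R pent k"
  moreover have "k = 0 \<or> k = 1 \<or> k = 2 \<or> k = 3 \<or> k = 4" using assms(4) by linarith
  ultimately have "x = 0 \<and> y = 0 \<and> z = a \<or> x = a \<and> y = - 2 * a \<and> z = a \<or> x = a \<and> y = - a / 2 \<and> z = a / 2
      \<or> x = a \<and> y = a / 2 \<and> z = a / 2 \<or> x = a \<and> y = 2 * a \<and> z = a"
    by (elim disjE) (simp_all add: pent_simps vec3_eq)
  then show False using assms(1-3) unfolding pent_row_def by (elim disjE conjE) simp_all
qed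

text \<open>The chords run inside the pentagon from a point (1/2, s/2) of the fan to the corners (1,
  -2) and (1, 2); \<open>m\<close> stands for \<open>\<gamma>\<close> times the slope s.\<close>

lemma pent_row_chord:
  assumes "pent_row i j \<alpha> \<beta> x y z" "0 < \<alpha>" "0 < \<beta>" "0 < \<gamma>" "0 < \<delta>" "0 \<le> m" "m < \<gamma>"
    and "\<sigma> = 2 \<or> \<sigma> = - 2"
    and eq: "x = \<gamma> + \<delta> \<and> y = m + \<sigma> * \<delta> \<and> z = 2 * \<gamma> + \<delta> \<or>
      - x = \<gamma> + \<delta> \<and> - y = m + \<sigma> * \<delta> \<and> - z = 2 * \<gamma> + \<delta>"
  shows False
  using eq
proof
  assume "x = \<gamma> + \<delta> \<and> y = m + \<sigma> * \<delta> \<and> z = 2 * \<gamma> + \<delta>"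
  then show False using assms(1-8) unfolding pent_row_def by (elim disjE conjE) simp_all
next
  assume "- x = \<gamma> + \<delta> \<and> - y = m + \<sigma> * \<delta> \<and> - z = 2 * \<gamma> + \<delta>"
  then have "x = - \<gamma> - \<delta> \<and> y = - m - \<sigma> * \<delta> \<and> z = - 2 * \<gamma> - \<delta>" by linarith
  then show False using assms(1-8) unfolding pent_row_def by (elim disjE conjE) simp_all
qed

lemma pent_nonzero: "pent k \<noteq> 0"
proof -
  have "pent k $ 3 \<noteq> 0" by (simp add: pent_def)
  then show ?thesis by (metis zero_index)
qed

lemma pent_independent:
  assumes "i \<le> 4" "j \<le> 4" "i \<noteq> j" shows "pent i \<noteq> c *\<^sub>R pent j"
proof -
  have "i = 0 \<or> i = 1 \<or> i = 2 \<or> i = 3 \<or> i = 4" "j = 0 \<or> j = 1 \<or> j = 2 \<or> j = 3 \<or> j = 4"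
    using assms by linarith+
  then show ?thesis using assms(3) by (elim disjE; simp add: pent_simps vec3_eq)
qed

lemma convex_between:
  fixes p q \<alpha> \<beta> :: real
  assumes "p < q" "0 < \<alpha>" "0 < \<beta>"
  shows "(\<alpha> + \<beta>) * p < \<alpha> * p + \<beta> * q" "\<alpha> * p + \<beta> * q < (\<alpha> + \<beta>) * q"
proof -
  have "\<beta> * p < \<beta> * q" "\<alpha> * p < \<alpha> * q" using assms by simp_all
  then show "(\<alpha> + \<beta>) * p < \<alpha> * p + \<beta> * q" "\<alpha> * p + \<beta> * q < (\<alpha> + \<beta>) * q"
    by (simp_all add: distrib_right)
qed

section \<open>The fan around the identity\<close>

text \<open>\<open>s\<close> is the slope of the ray from the identity, the corner
  \<open>c 0\<close>, on which a fan vertex lies. \<open>b\<close> selects whether the core is a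
  whole pentagon or the identity alone. \<open>z0\<close>, if it is a hub, may be joined to the
  corners 1 and 4.\<close>

locale fan_template =
  fixes F H :: "'v set" and s :: "'v \<Rightarrow> real" and c :: "nat \<Rightarrow> 'v" and b :: bool and z0 :: 'v
  assumes hubs: "H \<subseteq> F"
    and s_range: "\<And>v. v \<in> F \<Longrightarrow> 0 \<le> s v \<and> s v < 1"
    and s_inj: "inj_on s F"
    and c_inj: "inj_on c (if b then {..4} else {0})"
    and c_F: "c ` (if b then {..4} else {0}) \<inter> F = {}"
begin

text \<open>In the chart hubs lie at X = 1/2 and the other fan vertices nearer to the identity, at X
  = 1/4. A spoke therefore passes beyond the non-hubs whose rays it crosses.\<close>

definition t :: "'v \<Rightarrow> real" where "t v = (if v \<in> H then 2 else 4)"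

definition pos :: "'v \<Rightarrow> real^3" where
  "pos v = (if v \<in> F then vec3 1 (s v) (t v) else pent (inv_into (if b then {..4} else {0}) c v))"

text \<open>Each hub owns the block of slopes from its own up to the next hub, so a spoke never
  meets the longer ray of another hub.\<close>

definition spoke :: "'v \<Rightarrow> 'v \<Rightarrow> bool" where
  "spoke z w \<longleftrightarrow> z \<in> H \<and> w \<in> F - H \<and> s z < s w \<and> (\<forall>u\<in>H. s z < s u \<longrightarrow> s w < s u)"

text \<open>Slopes are consecutive in the whole fan, so the segment at X = 1/4 meets no ray on the
  way.\<close>

definition rim :: "'v \<Rightarrow> 'v \<Rightarrow> bool" where
  "rim w w' \<longleftrightarrow> w \<in> F - H \<and> w' \<in> F - H \<and> s w < s w' \<and> (\<forall>u\<in>F. \<not> (s w < s u \<and> s u < s w'))"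

definition drawn :: "'v set \<Rightarrow> real^3 \<Rightarrow> real^3 \<Rightarrow> bool" where
  "drawn e A B \<longleftrightarrow>
     (\<exists>v\<in>F. e = {c 0, v} \<and> A = pos (c 0) \<and> B = pos v) \<or>
     (\<exists>z w. spoke z w \<and> e = {z, w} \<and> A = pos z \<and> B = pos w) \<or>
     (\<exists>w w'. rim w w' \<and> e = {w, w'} \<and> A = pos w \<and> B = pos w') \<or>
     (b \<and> (\<exists>i j. e = {c i, c j} \<and> pent_edge A B i j)) \<or>
     (b \<and> z0 \<in> H \<and> (\<exists>k\<in>{1, 4}. e = {z0, c k} \<and> A = pos z0 \<and> B = pos (c k)))"

abbreviation "vertices \<equiv> F \<union> c ` (if b then {..4} else {0})"

lemma pos_F: "v \<in> F \<Longrightarrow> pos v = vec3 1 (s v) (t v)"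
  by (simp add: pos_def)

lemma pos_c: "k \<in> (if b then {..4} else {0}) \<Longrightarrow> pos (c k) = pent k"
proof -
  assume k: "k \<in> (if b then {..4} else {0})"
  then have "c k \<notin> F" using c_F by blast
  then show ?thesis unfolding pos_def using inv_into_f_f[OF c_inj k] by (simp only: if_False)
qed

lemma pos_c0: "pos (c 0) = vec3 0 0 1"
proof -
  have "(0::nat) \<in> (if b then {..4} else {0})" by (cases b) simp_all
  from pos_c[OF this] show ?thesis unfolding pent_simps(1) .
qed

text \<open>The coordinates of the points of an open edge cone, one disjunct for each kind of edge.\<close>

definition cone_row :: "'v set \<Rightarrow> real \<Rightarrow> real \<Rightarrow> real \<Rightarrow> real \<Rightarrow> real \<Rightarrow> bool" where
  "cone_row e \<alpha> \<beta> x y z \<longleftrightarrow>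
     (\<exists>v\<in>F. e = {c 0, v} \<and> x = \<beta> \<and> y = \<beta> * s v \<and> z = \<alpha> + \<beta> * t v) \<or>
     (\<exists>h w. spoke h w \<and> e = {h, w} \<and> x = \<alpha> + \<beta> \<and> y = \<alpha> * s h + \<beta> * s w \<and> z = 2 * \<alpha> + 4 * \<beta>) \<or>
     (\<exists>w w'. rim w w' \<and> e = {w, w'} \<and> x = \<alpha> + \<beta> \<and> y = \<alpha> * s w + \<beta> * s w' \<and> z = 4 * \<alpha> + 4 * \<beta>) \<or>
     (b \<and> (\<exists>i j. e = {c i, c j} \<and> pent_row i j \<alpha> \<beta> x y z)) \<or>
     (b \<and> z0 \<in> H \<and> (\<exists>k \<sigma>. (k = 1 \<and> \<sigma> = - 2 \<or> k = 4 \<and> \<sigma> = 2) \<and> e = {z0, c k} \<and>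
        x = \<alpha> + \<beta> \<and> y = \<alpha> * s z0 + \<sigma> * \<beta> \<and> z = 2 * \<alpha> + \<beta>))"

lemma drawn_cone_row:
  assumes "drawn e A B"
  shows "\<exists>x y z. \<alpha> *\<^sub>R A + \<beta> *\<^sub>R B = vec3 x y z \<and> cone_row e \<alpha> \<beta> x y z"
  using assms unfolding drawn_def
proof (elim disjE bexE exE conjE)
  fix v assume a: "v \<in> F" "e = {c 0, v}" "A = pos (c 0)" "B = pos v"
  show ?thesis
  proof (intro exI conjI)
    show "\<alpha> *\<^sub>R A + \<beta> *\<^sub>R B = vec3 \<beta> (\<beta> * s v) (\<alpha> + \<beta> * t v)"
      unfolding a pos_F[OF a(1)] pos_c0 by (simp add: vec3_eq)
    show "cone_row e \<alpha> \<beta> \<beta> (\<beta> * s v) (\<alpha> + \<beta> * t v)"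
      unfolding cone_row_def using a(1,2) by (intro disjI1 bexI[of _ v] conjI refl)
  qed
next
  fix h w assume a: "spoke h w" "e = {h, w}" "A = pos h" "B = pos w"
  then have p: "pos h = vec3 1 (s h) 2" "pos w = vec3 1 (s w) 4"
    using hubs by (auto simp: spoke_def pos_F t_def)
  show ?thesis
  proof (intro exI conjI)
    show "\<alpha> *\<^sub>R A + \<beta> *\<^sub>R B = vec3 (\<alpha> + \<beta>) (\<alpha> * s h + \<beta> * s w) (2 * \<alpha> + 4 * \<beta>)"
      unfolding a p by (simp add: vec3_eq)
    show "cone_row e \<alpha> \<beta> (\<alpha> + \<beta>) (\<alpha> * s h + \<beta> * s w) (2 * \<alpha> + 4 * \<beta>)"
      unfolding cone_row_def using a by blast
  qed
next
  fix w w' assume a: "rim w w'" "e = {w, w'}" "A = pos w" "B = pos w'"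
  then have p: "pos w = vec3 1 (s w) 4" "pos w' = vec3 1 (s w') 4"
    by (auto simp: rim_def pos_F t_def)
  show ?thesis
  proof (intro exI conjI)
    show "\<alpha> *\<^sub>R A + \<beta> *\<^sub>R B = vec3 (\<alpha> + \<beta>) (\<alpha> * s w + \<beta> * s w') (4 * \<alpha> + 4 * \<beta>)"
      unfolding a p by (simp add: vec3_eq)
    show "cone_row e \<alpha> \<beta> (\<alpha> + \<beta>) (\<alpha> * s w + \<beta> * s w') (4 * \<alpha> + 4 * \<beta>)"
      unfolding cone_row_def using a by blast
  qed
next
  fix i j assume "b" "e = {c i, c j}" "pent_edge A B i j"
  then show ?thesis using pent_edge_row[of A B i j \<alpha> \<beta>] unfolding cone_row_def by blast
next
  fix k assume a: "b" "z0 \<in> H" "k \<in> {1, 4}" "e = {z0, c k}" "A = pos z0" "B = pos (c k)"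
  define \<sigma> :: real where "\<sigma> = (if k = 1 then - 2 else 2)"
  have \<sigma>: "k = 1 \<and> \<sigma> = - 2 \<or> k = 4 \<and> \<sigma> = 2" using a(3) by (auto simp: \<sigma>_def)
  have "z0 \<in> F" using a(2) hubs by blast
  then have p: "pos z0 = vec3 1 (s z0) 2" using a(2) by (simp add: pos_F t_def)
  have q: "pos (c k) = vec3 1 \<sigma> 1"
  proof -
    have "k \<in> (if b then {..4} else {0})" using a(1,3) by auto
    then have "pos (c k) = pent k" by (rule pos_c)
    then show ?thesis using \<sigma> by (elim disjE conjE) (simp_all add: pent_simps)
  qed
  show ?thesis
  proof (intro exI conjI)
    show "\<alpha> *\<^sub>R A + \<beta> *\<^sub>R B = vec3 (\<alpha> + \<beta>) (\<alpha> * s z0 + \<sigma> * \<beta>) (2 * \<alpha> + \<beta>)"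
      unfolding a p q by (simp add: vec3_eq)
    show "cone_row e \<alpha> \<beta> (\<alpha> + \<beta>) (\<alpha> * s z0 + \<sigma> * \<beta>) (2 * \<alpha> + \<beta>)"
      unfolding cone_row_def using a(1,2,4) \<sigma> by blast
  qed
qed

lemma convex_F: 
  assumes "u \<in> F" "v \<in> F" "0 < \<alpha>" "0 < \<beta>"
  shows "0 \<le> \<alpha> * s u + \<beta> * s v" "\<alpha> * s u + \<beta> * s v < \<alpha> + \<beta>"
proof -
  have "\<alpha> * s u < \<alpha>" "\<beta> * s v < \<beta>" "0 \<le> \<alpha> * s u" "0 \<le> \<beta> * s v" using s_range assms by simp_all
  then show "0 \<le> \<alpha> * s u + \<beta> * s v" "\<alpha> * s u + \<beta> * s v < \<alpha> + \<beta>" by linarith+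
qed

end

context fan_template begin

lemma s_eq: "u \<in> F \<Longrightarrow> v \<in> F \<Longrightarrow> s u = s v \<longleftrightarrow> u = v"
  using s_inj by (auto dest: inj_onD)

lemma spoke_F: "spoke h w \<Longrightarrow> h \<in> H \<and> h \<in> F \<and> w \<in> F \<and> w \<notin> H \<and> s h < s w"
  using hubs unfolding spoke_def by blast

lemma rim_F: "rim w w' \<Longrightarrow> w \<in> F \<and> w' \<in> F \<and> w \<notin> H \<and> w' \<notin> H \<and> s w < s w'"
  unfolding rim_def by blast

text \<open>\<open>cone_row\<close> is split by region for the comparison: fan edges have X < 1/2 in
  the chart, chords have 1/2 < X < 1.\<close>

definition fan_row :: "'v set \<Rightarrow> real \<Rightarrow> real \<Rightarrow> real \<Rightarrow> real \<Rightarrow> real \<Rightarrow> bool" where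
  "fan_row e \<alpha> \<beta> x y z \<longleftrightarrow>
     (\<exists>v\<in>F. e = {c 0, v} \<and> x = \<beta> \<and> y = \<beta> * s v \<and> z = \<alpha> + \<beta> * t v) \<or>
     (\<exists>h w. spoke h w \<and> e = {h, w} \<and> x = \<alpha> + \<beta> \<and> y = \<alpha> * s h + \<beta> * s w \<and> z = 2 * \<alpha> + 4 * \<beta>) \<or>
     (\<exists>w w'. rim w w' \<and> e = {w, w'} \<and> x = \<alpha> + \<beta> \<and> y = \<alpha> * s w + \<beta> * s w' \<and> z = 4 * \<alpha> + 4 * \<beta>)"

definition chord_row :: "'v set \<Rightarrow> real \<Rightarrow> real \<Rightarrow> real \<Rightarrow> real \<Rightarrow> real \<Rightarrow> bool" where
  "chord_row e \<alpha> \<beta> x y z \<longleftrightarrow> b \<and> z0 \<in> H \<and> (\<exists>k \<sigma>. (k = 1 \<and> \<sigma> = - 2 \<or> k = 4 \<and> \<sigma> = 2) \<and> e = {z0, c k} \<and>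
        x = \<alpha> + \<beta> \<and> y = \<alpha> * s z0 + \<sigma> * \<beta> \<and> z = 2 * \<alpha> + \<beta>)"

lemma row_cases:
  assumes "cone_row e \<alpha> \<beta> x y z"
  obtains "fan_row e \<alpha> \<beta> x y z" | i j where "b" "e = {c i, c j}" "pent_row i j \<alpha> \<beta> x y z" | "chord_row e \<alpha> \<beta> x y z"
proof -
  have "fan_row e \<alpha> \<beta> x y z \<or> (b \<and> (\<exists>i j. e = {c i, c j} \<and> pent_row i j \<alpha> \<beta> x y z)) \<or> chord_row e \<alpha> \<beta> x y z"
    using assms unfolding cone_row_def fan_row_def chord_row_def by argo
  then show thesis using that by blast
qed

lemma fan_row_region:
  assumes "fan_row e \<alpha> \<beta> x y z" and ab: "0 < \<alpha>" "0 < \<beta>"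
  shows "0 < x" "0 \<le> y" "y < x" "2 * x < z"
proof -
  have "0 < x \<and> 0 \<le> y \<and> y < x \<and> 2 * x < z"
    using assms(1) unfolding fan_row_def
  proof (elim disjE bexE exE conjE)
    fix v assume "v \<in> F" "x = \<beta>" "y = \<beta> * s v" "z = \<alpha> + \<beta> * t v"
    then show ?thesis using s_range[of v] ab by (simp add: t_def)
  next
    fix h w assume "spoke h w" "x = \<alpha> + \<beta>" "y = \<alpha> * s h + \<beta> * s w" "z = 2 * \<alpha> + 4 * \<beta>"
    then show ?thesis using convex_F[of h w \<alpha> \<beta>] spoke_F ab by simp
  next
    fix w w' assume "rim w w'" "x = \<alpha> + \<beta>" "y = \<alpha> * s w + \<beta> * s w'" "z = 4 * \<alpha> + 4 * \<beta>"
    then show ?thesis using convex_F[of w w' \<alpha> \<beta>] rim_F ab by simp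
  qed
  then show "0 < x" "0 \<le> y" "y < x" "2 * x < z" by simp_all
qed

lemma spoke_between: "spoke h w \<Longrightarrow> u \<in> H \<Longrightarrow> \<not> (s h < s u \<and> s u < s w)"
  unfolding spoke_def by force

lemma rim_between: "rim w w' \<Longrightarrow> u \<in> F \<Longrightarrow> \<not> (s w < s u \<and> s u < s w')"
  unfolding rim_def by blast

lemma on_line:
  assumes "\<alpha> * s u + \<beta> * s v = (\<alpha> + \<beta>) * s w" "s u < s v" "0 < \<alpha>" "0 < \<beta>"
  shows "s u < s w \<and> s w < s v"
proof -
  have "(\<alpha> + \<beta>) * s u < (\<alpha> + \<beta>) * s w" "(\<alpha> + \<beta>) * s w < (\<alpha> + \<beta>) * s v"
    using convex_between[OF assms(2-4)] assms(1) by simp_all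
  then show ?thesis using assms(3,4) by simp
qed

text \<open>The blocks of different hubs do not overlap: both ends of the first spoke have smaller
  slope than the corresponding ends of the second.\<close>

lemma spokes_disjoint:
  assumes "spoke h w" "spoke h' w'" "s h < s h'" "0 < \<alpha>" "0 < \<beta>"
  shows "\<alpha> * s h + \<beta> * s w \<noteq> \<alpha> * s h' + \<beta> * s w'"
proof -
  have "s w < s h'" "s h' < s w'" using assms(1-3) spoke_F[OF assms(2)] unfolding spoke_def by blast+
  then have "\<alpha> * s h < \<alpha> * s h'" "\<beta> * s w < \<beta> * s w'" using assms by simp_all
  then show ?thesis by linarith
qed

lemma rims_disjoint:
  assumes r: "rim w w'" "rim u u'" and lt: "s w < s u'" "s u < s w'"
  shows "{w, w'} = {u, u'}"
proof -
  have m: "w \<in> F" "w' \<in> F" "u \<in> F" "u' \<in> F" "s w < s w'" "s u < s u'" using rim_F r by blast+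
  have "\<not> s u < s w" "\<not> s w < s u" using rim_between[OF r(1) m(3)] rim_between[OF r(2) m(1)] lt by blast+
  then have 1: "w = u" using s_eq[OF m(1,3)] by linarith
  have "\<not> s u' < s w'" "\<not> s w' < s u'" using rim_between[OF r(1) m(4)] rim_between[OF r(2) m(2)] lt 1 m by blast+
  then have "w' = u'" using s_eq[OF m(2,4)] by linarith
  then show ?thesis using 1 by simp
qed

text \<open>A star edge meeting a spoke would put its vertex, if a hub, strictly inside a block; for
  a non-hub the star edge has z > 4 x and the spoke z < 4 x. Rims have z = 4 x exactly. On two
  spokes equal x and z mean equal parameters, which leaves the slopes to be compared.\<close>

lemma fan_rows_disjoint:
  assumes r1: "fan_row e \<alpha> \<beta> x y z" and r2: "fan_row e' \<alpha>' \<beta>' x y z"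
    and ab: "0 < \<alpha>" "0 < \<beta>" "0 < \<alpha>'" "0 < \<beta>'"
  shows "e = e'"
proof -
  have spoke_spoke: False
    if st: "v \<in> F" "x = \<beta>1" "y = \<beta>1 * s v" "z = \<alpha>1 + \<beta>1 * t v"
      and sp: "spoke h w" "x = \<alpha>2 + \<beta>2" "y = \<alpha>2 * s h + \<beta>2 * s w" "z = 2 * \<alpha>2 + 4 * \<beta>2"
      and p: "0 < \<alpha>1" "0 < \<beta>1" "0 < \<alpha>2" "0 < \<beta>2" for v h w \<alpha>1 \<beta>1 \<alpha>2 \<beta>2
  proof (cases "v \<in> H")
    case True
    have "s h < s v \<and> s v < s w"
      using on_line[of \<alpha>2 h \<beta>2 w v] sp st spoke_F[OF sp(1)] p by simp
    then show False using spoke_between[OF sp(1) True] by simp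
  next
    case False
    then show False using st sp p by (simp add: t_def)
  qed
  have star_rim: False
    if st: "v \<in> F" "x = \<beta>1" "y = \<beta>1 * s v" "z = \<alpha>1 + \<beta>1 * t v"
      and sp: "rim w w'" "x = \<alpha>2 + \<beta>2" "y = \<alpha>2 * s w + \<beta>2 * s w'" "z = 4 * \<alpha>2 + 4 * \<beta>2"
      and p: "0 < \<alpha>1" "0 < \<beta>1" "0 < \<alpha>2" "0 < \<beta>2" for v w w' \<alpha>1 \<beta>1 \<alpha>2 \<beta>2
  proof -
    have "s w < s v \<and> s v < s w'"
      using on_line[of \<alpha>2 w \<beta>2 w' v] sp st rim_F[OF sp(1)] p by simp
    then show False using rim_between[OF sp(1) st(1)] by simp
  qed
  have spoke_rim: False
    if "x = \<alpha>1 + \<beta>1" "z = 2 * \<alpha>1 + 4 * \<beta>1" "x = \<alpha>2 + \<beta>2" "z = 4 * \<alpha>2 + 4 * \<beta>2" "0 < \<alpha>1" for \<alpha>1 \<beta>1 \<alpha>2 \<beta>2 :: real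
    using that by linarith
  from r1 show ?thesis unfolding fan_row_def
  proof (elim disjE bexE exE conjE)
    fix v assume 1: "v \<in> F" "e = {c 0, v}" "x = \<beta>" "y = \<beta> * s v" "z = \<alpha> + \<beta> * t v"
    from r2 show ?thesis unfolding fan_row_def
    proof (elim disjE bexE exE conjE)
      fix u assume 2: "u \<in> F" "e' = {c 0, u}" "x = \<beta>'" "y = \<beta>' * s u"
      then have "s v = s u" using 1 ab by simp
      then show ?thesis using s_eq 1 2 by simp
    next
      fix h w assume 2: "spoke h w" "x = \<alpha>' + \<beta>'" "y = \<alpha>' * s h + \<beta>' * s w" "z = 2 * \<alpha>' + 4 * \<beta>'"
      show ?thesis using spoke_spoke[OF 1(1,3-5) 2 ab] ..
    next
      fix w w' assume 2: "rim w w'" "x = \<alpha>' + \<beta>'" "y = \<alpha>' * s w + \<beta>' * s w'" "z = 4 * \<alpha>' + 4 * \<beta>'"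
      show ?thesis using star_rim[OF 1(1,3-5) 2 ab] ..
    qed
  next
    fix h w assume 1: "spoke h w" "e = {h, w}" "x = \<alpha> + \<beta>" "y = \<alpha> * s h + \<beta> * s w" "z = 2 * \<alpha> + 4 * \<beta>"
    from r2 show ?thesis unfolding fan_row_def
    proof (elim disjE bexE exE conjE)
      fix u assume 2: "u \<in> F" "x = \<beta>'" "y = \<beta>' * s u" "z = \<alpha>' + \<beta>' * t u"
      show ?thesis using spoke_spoke[OF 2 1(1,3-5) ab(3,4,1,2)] ..
    next
      fix h' w' assume 2: "spoke h' w'" "e' = {h', w'}" "x = \<alpha>' + \<beta>'" "y = \<alpha>' * s h' + \<beta>' * s w'" "z = 2 * \<alpha>' + 4 * \<beta>'"
      have eq: "\<alpha>' = \<alpha>" "\<beta>' = \<beta>" using 1 2 by linarith+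
      have "\<not> s h < s h'" "\<not> s h' < s h"
        using spokes_disjoint[OF 1(1) 2(1) _ ab(1,2)] spokes_disjoint[OF 2(1) 1(1) _ ab(1,2)] 1(4) 2(4) eq by auto
      then have h: "h = h'" using s_eq spoke_F[OF 1(1)] spoke_F[OF 2(1)] by (metis linorder_neqE)
      then have "s w = s w'" using 1(4) 2(4) eq ab by simp
      then show ?thesis using s_eq spoke_F[OF 1(1)] spoke_F[OF 2(1)] 1(2) 2(2) h by simp
    next
      fix u u' assume 2: "x = \<alpha>' + \<beta>'" "z = 4 * \<alpha>' + 4 * \<beta>'"
      show ?thesis using spoke_rim[OF 1(3,5) 2 ab(1)] ..
    qed
  next
    fix w w' assume 1: "rim w w'" "e = {w, w'}" "x = \<alpha> + \<beta>" "y = \<alpha> * s w + \<beta> * s w'" "z = 4 * \<alpha> + 4 * \<beta>"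
    from r2 show ?thesis unfolding fan_row_def
    proof (elim disjE bexE exE conjE)
      fix u assume 2: "u \<in> F" "x = \<beta>'" "y = \<beta>' * s u" "z = \<alpha>' + \<beta>' * t u"
      show ?thesis using star_rim[OF 2 1(1,3-5) ab(3,4,1,2)] ..
    next
      fix h u assume 2: "x = \<alpha>' + \<beta>'" "z = 2 * \<alpha>' + 4 * \<beta>'"
      show ?thesis using spoke_rim[OF 2 1(3,5) ab(3)] ..
    next
      fix u u' assume 2: "rim u u'" "e' = {u, u'}" "x = \<alpha>' + \<beta>'" "y = \<alpha>' * s u + \<beta>' * s u'"
      have m: "s w < s w'" "s u < s u'" using rim_F 1(1) 2(1) by blast+
      have "x * s w < y" "y < x * s u'" "x * s u < y" "y < x * s w'"
        using convex_between[OF m(1) ab(1,2)] convex_between[OF m(2) ab(3,4)] 1 2 by simp_all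
      then have "x * s w < x * s u'" "x * s u < x * s w'" by linarith+
      moreover have "0 < x" using 1 ab by simp
      ultimately have "s w < s u'" "s u < s w'" by simp_all
      then show ?thesis using rims_disjoint[OF 1(1) 2(1)] 1(2) 2(2) by simp
    qed
  qed
qed

lemma chord_row_region:
  assumes "chord_row e \<alpha> \<beta> x y z" and ab: "0 < \<alpha>" "0 < \<beta>"
  shows "0 < x" "z < 2 * x" "x < z"
  using assms unfolding chord_row_def by auto

lemma chord_rows_disjoint:
  assumes "chord_row e \<alpha> \<beta> x y z" "chord_row e' \<alpha>' \<beta>' x y z"
    and ab: "0 < \<alpha>" "0 < \<beta>" "0 < \<alpha>'" "0 < \<beta>'"
  shows "e = e'"
proof -
  obtain k \<sigma> where 1: "k = 1 \<and> \<sigma> = - 2 \<or> k = 4 \<and> \<sigma> = (2::real)" "e = {z0, c k}"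
    "x = \<alpha> + \<beta>" "y = \<alpha> * s z0 + \<sigma> * \<beta>" "z = 2 * \<alpha> + \<beta>"
    using assms(1) unfolding chord_row_def by blast
  obtain k' \<sigma>' where 2: "k' = 1 \<and> \<sigma>' = - 2 \<or> k' = 4 \<and> \<sigma>' = (2::real)" "e' = {z0, c k'}"
    "x = \<alpha>' + \<beta>'" "y = \<alpha>' * s z0 + \<sigma>' * \<beta>'" "z = 2 * \<alpha>' + \<beta>'"
    using assms(2) unfolding chord_row_def by blast
  have "\<alpha>' = \<alpha>" "\<beta>' = \<beta>" using 1 2 by linarith+
  then have "\<sigma> = \<sigma>'" using 1(4) 2(4) ab by simp
  then have "k = k'" using 1(1) 2(1) by auto
  then show ?thesis using 1 2 by simp
qed

lemma pent_chord_disjoint: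
  assumes p: "pent_row i j \<alpha> \<beta> x y z" "0 < \<alpha>" "0 < \<beta>" and ab: "0 < \<gamma>" "0 < \<delta>"
    and ch: "chord_row e \<gamma> \<delta> x' y' z'"
    and eq: "x' = x \<and> y' = y \<and> z' = z \<or> x' = - x \<and> y' = - y \<and> z' = - z"
  shows False
proof -
  obtain k \<sigma> where 1: "k = 1 \<and> \<sigma> = - 2 \<or> k = 4 \<and> \<sigma> = (2::real)" "z0 \<in> H"
    "x' = \<gamma> + \<delta>" "y' = \<gamma> * s z0 + \<sigma> * \<delta>" "z' = 2 * \<gamma> + \<delta>"
    using ch unfolding chord_row_def by blast
  have "z0 \<in> F" using hubs 1(2) by blast
  then have m: "0 \<le> \<gamma> * s z0" "\<gamma> * s z0 < \<gamma>" using s_range[of z0] ab by simp_all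
  have "\<sigma> = 2 \<or> \<sigma> = - 2" using 1(1) by blast
  moreover have "x = \<gamma> + \<delta> \<and> y = \<gamma> * s z0 + \<sigma> * \<delta> \<and> z = 2 * \<gamma> + \<delta> \<or>
      - x = \<gamma> + \<delta> \<and> - y = \<gamma> * s z0 + \<sigma> * \<delta> \<and> - z = 2 * \<gamma> + \<delta>" using eq 1(3-5) by presburger
  ultimately show False by (rule pent_row_chord[OF p ab m])
qed

lemma pent_fan_disjoint:
  assumes p: "pent_row i j \<alpha> \<beta> x y z" "0 < \<alpha>" "0 < \<beta>" and f: "fan_row e \<gamma> \<delta> x' y' z'" "0 < \<gamma>" "0 < \<delta>"
    and eq: "x' = x \<and> y' = y \<and> z' = z \<or> x' = - x \<and> y' = - y \<and> z' = - z"
  shows False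
  by (rule pent_row_fan[OF p]) (use fan_row_region[OF f] eq in linarith)

text \<open>The two alternatives of \<open>eq\<close> are equality and antipodality. Fan rows and
  chord rows have positive x, so between them only equality can occur.\<close>

lemma rows_disjoint:
  assumes r1: "cone_row e \<alpha> \<beta> x y z" and r2: "cone_row e' \<alpha>' \<beta>' x' y' z'"
    and ab: "0 < \<alpha>" "0 < \<beta>" "0 < \<alpha>'" "0 < \<beta>'"
    and eq: "x' = x \<and> y' = y \<and> z' = z \<or> x' = - x \<and> y' = - y \<and> z' = - z"
  shows "e = e'"
proof -
  have eq': "x = x' \<and> y = y' \<and> z = z' \<or> x = - x' \<and> y = - y' \<and> z = - z'" using eq by auto
  from r1 show ?thesis
  proof (cases rule: row_cases)
    case 1
    note R = fan_row_region[OF 1 ab(1,2)]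
    from r2 show ?thesis
    proof (cases rule: row_cases)
      case f: 1
      then have "x' = x \<and> y' = y \<and> z' = z" using R fan_row_region[OF f ab(3,4)] eq by linarith
      then show ?thesis using fan_rows_disjoint[OF 1 _ ab] f by simp
    next
      case (2 i j)
      show ?thesis using pent_fan_disjoint[OF 2(3) ab(3,4) 1 ab(1,2) eq'] ..
    next
      case 3
      show ?thesis using chord_row_region[OF 3 ab(3,4)] R eq by linarith
    qed
  next
    case (2 i j)
    from r2 show ?thesis
    proof (cases rule: row_cases)
      case f: 1
      show ?thesis using pent_fan_disjoint[OF 2(3) ab(1,2) f ab(3,4) eq] ..
    next
      case p: (2 i' j')
      have "i = i' \<and> j = j'" using eq
      proof
        assume "x' = x \<and> y' = y \<and> z' = z"
        then show ?thesis using pent_rows_disjoint[OF 2(3) _ ab] p(3) by blast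
      next
        assume "x' = - x \<and> y' = - y \<and> z' = - z"
        then show ?thesis using pent_rows_disjoint_minus[OF 2(3) _ ab] p(3) by blast
      qed
      then show ?thesis using 2(2) p(2) by simp
    next
      case 3
      show ?thesis using pent_chord_disjoint[OF 2(3) ab 3 eq] ..
    qed
  next
    case 3
    from r2 show ?thesis
    proof (cases rule: row_cases)
      case f: 1
      show ?thesis using fan_row_region[OF f ab(3,4)] chord_row_region[OF 3 ab(1,2)] eq by linarith
    next
      case p: (2 i' j')
      show ?thesis using pent_chord_disjoint[OF p(3) ab(3,4,1,2) 3 eq'] ..
    next
      case f: 3
      have "x' = x \<and> y' = y \<and> z' = z"
        using chord_row_region[OF f ab(3,4)] chord_row_region[OF 3 ab(1,2)] eq by linarith
      then show ?thesis using chord_rows_disjoint[OF 3 _ ab] f by simp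
    qed
  qed
qed

lemma row_vertex:
  assumes r: "cone_row e \<alpha> \<beta> x y z" and ab: "0 < \<alpha>" "0 < \<beta>" and v: "v \<in> vertices"
  shows "vec3 x y z \<noteq> a *\<^sub>R pos v"
proof (cases "v \<in> F")
  case True
  show ?thesis
  proof
    assume "vec3 x y z = a *\<^sub>R pos v"
    then have e: "x = a" "y = a * s v" "z = a * t v" using True by (simp_all add: pos_F vec3_eq)
    have sv: "0 \<le> s v" "s v < 1" using s_range[OF True] by simp_all
    have tv: "t v = 2 \<or> t v = 4" by (simp add: t_def)
    from r show False
    proof (cases rule: row_cases)
      case 1
      then show False unfolding fan_row_def
      proof (elim disjE bexE exE conjE)
        fix u assume 2: "u \<in> F" "x = \<beta>" "y = \<beta> * s u" "z = \<alpha> + \<beta> * t u"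
        then have "s u = s v" using e ab by simp
        then have "u = v" using s_eq 2 True by blast
        then show False using 2 e ab by simp
      next
        fix h w assume 2: "spoke h w" "x = \<alpha> + \<beta>" "z = 2 * \<alpha> + 4 * \<beta>"
        then show False using e tv ab by (elim disjE) simp_all
      next
        fix w w' assume 2: "rim w w'" "x = \<alpha> + \<beta>" "y = \<alpha> * s w + \<beta> * s w'" "z = 4 * \<alpha> + 4 * \<beta>"
        then have "s w < s v \<and> s v < s w'"
          using on_line[of \<alpha> w \<beta> w' v] e rim_F ab by simp
        then show False using rim_between[OF 2(1) True] by simp
      qed
    next
      case (2 i j)
      have "a \<noteq> 0"
      proof
        assume "a = 0"
        then have "vec3 x y z = 0 *\<^sub>R pent 0" using e by (simp add: vec3_eq)
        then show False using pent_row_vertex[OF 2(3) ab, of 0 0] by simp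
      qed
      then have "0 < a \<or> a < 0" by linarith
      then show False
      proof
        assume "0 < a"
        then have "0 \<le> a * s v" "a * s v < a" "2 * a \<le> a * t v" using sv tv by auto
        then show False using pent_row_fan[OF 2(3) ab] \<open>0 < a\<close> e by simp
      next
        assume "a < 0"
        then have "a * s v \<le> 0" "a < a * s v" "a * t v \<le> 2 * a"
          using sv tv by (auto simp: mult_nonpos_nonneg)
        then show False using pent_row_fan[OF 2(3) ab] \<open>a < 0\<close> e by simp
      qed
    next
      case 3
      have "0 < a" "a * t v < 2 * a" using chord_row_region[OF 3 ab] e by simp_all
      then show False using tv by auto
    qed
  qed
next
  case False
  then obtain k where k: "k \<in> (if b then {..4} else {0})" "v = c k" using v by blast
  have k4: "k \<le> 4" "pos v = pent k" using k(1) pos_c[OF k(1)] k(2) by (cases b; simp)+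
  show ?thesis
  proof
    assume eq: "vec3 x y z = a *\<^sub>R pos v"
    have "k = 0 \<or> k = 1 \<or> k = 2 \<or> k = 3 \<or> k = 4" using k4(1) by linarith
    then have e: "x = 0 \<or> x = a \<and> (k = 1 \<and> z = a \<or> k = 4 \<and> z = a \<or> z = a / 2)"
      using eq unfolding k4(2) by (elim disjE) (simp_all add: pent_simps vec3_eq)
    from r show False
    proof (cases rule: row_cases)
      case 1
      show False using fan_row_region[OF 1 ab] e by linarith
    next
      case (2 i j)
      show False using pent_row_vertex[OF 2(3) ab k4(1), of a] eq[unfolded k4(2)] by (rule notE)
    next
      case 3
      show False using chord_row_region[OF 3 ab] e by linarith
    qed
  qed
qed

lemma pos_nonzero: "v \<in> vertices \<Longrightarrow> pos v \<noteq> 0"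
proof -
  assume v: "v \<in> vertices"
  show ?thesis
  proof (cases "v \<in> F")
    case True
    then show ?thesis by (simp add: pos_F vec3_eq)
  next
    case False
    then obtain k where k: "k \<in> (if b then {..4} else {0})" "v = c k" using v by blast
    then show ?thesis using pos_c[OF k(1)] pent_nonzero by simp
  qed
qed

lemma pos_independent:
  assumes "u \<in> vertices" "v \<in> vertices" "u \<noteq> v"
  shows "pos u \<noteq> a *\<^sub>R pos v"
proof
  assume eq: "pos u = a *\<^sub>R pos v"
  have K: "\<exists>k\<le>4. w = c k \<and> pos w = pent k" if w: "w \<in> vertices" "w \<notin> F" for w
  proof -
    obtain k where k: "k \<in> (if b then {..4} else {0})" "w = c k" using w by blast
    have "k \<le> 4" using k(1) by (cases b) simp_all
    then show ?thesis using pos_c[OF k(1)] k(2) by blast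
  qed
  \<comment> \<open>The ratio of third to first coordinate is at least 2 for fan vertices and at
    most 1 for core vertices, except at \<open>c 0\<close>, whose first coordinate is 0.\<close>
  have FK: False if "w \<in> F" "pos w = a *\<^sub>R pent k \<or> pent k = a *\<^sub>R pos w" "k \<le> 4" for w k a
  proof -
    have p: "pent k $ 1 = 0 \<and> pent k $ 3 = 1 \<or> pent k $ 1 = 1 \<and> pent k $ 3 \<le> 1"
      by (simp add: pent_def)
    have w: "pos w $ 1 = 1" "2 \<le> pos w $ 3" using pos_F[OF that(1)] by (simp_all add: t_def)
    have "pos w $ 1 = a * pent k $ 1 \<and> pos w $ 3 = a * pent k $ 3 \<or>
        pent k $ 1 = a * pos w $ 1 \<and> pent k $ 3 = a * pos w $ 3"
      using that(2) by (elim disjE) simp_all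
    then show False using p w by (elim disjE conjE) simp_all
  qed
  show False
  proof (cases "u \<in> F"; cases "v \<in> F")
    assume "u \<in> F" "v \<in> F"
    then have "a = 1" "s u = a * s v" using eq by (simp_all add: pos_F vec3_eq)
    then show False using s_eq \<open>u \<in> F\<close> \<open>v \<in> F\<close> assms(3) by simp
  next
    assume "u \<in> F" "v \<notin> F"
    then obtain k where "k \<le> 4" "pos v = pent k" using K[OF assms(2)] by blast
    then show False using FK[OF \<open>u \<in> F\<close>, of a k] eq by simp
  next
    assume "u \<notin> F" "v \<in> F"
    then obtain k where "k \<le> 4" "pos u = pent k" using K[OF assms(1)] by blast
    then show False using FK[OF \<open>v \<in> F\<close>, of a k] eq by simp
  next
    assume "u \<notin> F" "v \<notin> F"
    then obtain i j where "i \<le> 4" "u = c i" "pos u = pent i" "j \<le> 4" "v = c j" "pos v = pent j"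
      using K[OF assms(1)] K[OF assms(2)] by blast
    then show False using pent_independent[of i j a] eq assms(3) by auto
  qed
qed

theorem embeds:
  fixes \<Phi> :: "real^3 \<Rightarrow> 'x::metric_space"
  assumes cont: "continuous_on (sphere 0 1) \<Phi>"
    and inj: "\<And>x y. x \<in> sphere 0 1 \<Longrightarrow> y \<in> sphere 0 1 \<Longrightarrow> \<Phi> x = \<Phi> y \<Longrightarrow> x = y \<or> x = - y"
    and even: "b \<Longrightarrow> \<forall>x\<in>sphere 0 1. \<Phi> (- x) = \<Phi> x"
    and E: "\<And>e. e \<in> E \<Longrightarrow> \<exists>A B. drawn e A B"
  shows "graph_embeds_in (vertices, E) (top_of_set (\<Phi> ` sphere 0 1))"
proof (rule cone_drawing[where P = pos and D = drawn])
  have c0: "c 0 \<in> vertices" by (cases b) auto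
  have cF: "c k \<notin> F" if "k \<in> (if b then {..4} else {0})" for k using c_F that by blast
  have W: "\<exists>u\<in>vertices. \<exists>v\<in>vertices. u \<noteq> v \<and> e = {u, v} \<and> A = pos u \<and>
      (B = pos v \<or> B = - pos v \<and> (\<forall>x\<in>sphere 0 1. \<Phi> (- x) = \<Phi> x))"
    if m: "u \<in> vertices" "v \<in> vertices" and r: "u \<noteq> v" "e = {u, v}" "A = pos u"
      and s: "B = pos v \<or> B = - pos v \<and> b" for e A B u v
  proof (rule bexI[OF _ m(1)], rule bexI[OF _ m(2)])
    have "B = pos v \<or> B = - pos v \<and> (\<forall>x\<in>sphere 0 1. \<Phi> (- x) = \<Phi> x)"
      using s even by (elim disjE conjE) simp_all
    then show "u \<noteq> v \<and> e = {u, v} \<and> A = pos u \<and>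
      (B = pos v \<or> B = - pos v \<and> (\<forall>x\<in>sphere 0 1. \<Phi> (- x) = \<Phi> x))" using r by (intro conjI)
  qed
  have FV: "v \<in> vertices" if "v \<in> F" for v using that by (rule UnI1)
  have cV: "c k \<in> vertices" if "k \<in> (if b then {..4} else {0})" for k using that by (intro UnI2 imageI)
  show "\<exists>u\<in>vertices. \<exists>v\<in>vertices. u \<noteq> v \<and> e = {u, v} \<and> A = pos u \<and>
      (B = pos v \<or> B = - pos v \<and> (\<forall>x\<in>sphere 0 1. \<Phi> (- x) = \<Phi> x))" if "drawn e A B" for e A B
    using that unfolding drawn_def
  proof (elim disjE bexE exE conjE)
    fix v assume v: "v \<in> F" "e = {c 0, v}" "A = pos (c 0)" "B = pos v"
    moreover have "c 0 \<noteq> v" using cF[of 0] \<open>v \<in> F\<close> by (cases b) auto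
    ultimately show ?thesis using W[OF c0 FV[OF v(1)]] by simp
  next
    fix h w assume a: "spoke h w" "e = {h, w}" "A = pos h" "B = pos w"
    have "h \<in> F" "w \<in> F" "h \<noteq> w" using spoke_F[OF a(1)] by auto
    then show ?thesis using W[OF FV FV] a(2-4) by simp
  next
    fix w w' assume a: "rim w w'" "e = {w, w'}" "A = pos w" "B = pos w'"
    have "w \<in> F" "w' \<in> F" "w \<noteq> w'" using rim_F[OF a(1)] by auto
    then show ?thesis using W[OF FV FV] a(2-4) by simp
  next
    fix i j assume a: "b" "e = {c i, c j}" "pent_edge A B i j"
    have ij: "i \<le> 4" "j \<le> 4" "i \<noteq> j" "A = pent i" "B = pent j \<or> B = - pent j"
      using a(3) unfolding pent_edge_def by (elim conjE disjE insertE emptyE; simp)+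
    have I: "i \<in> (if b then {..4} else {0})" "j \<in> (if b then {..4} else {0})" using a(1) ij by simp_all
    have "c i \<noteq> c j" using inj_onD[OF c_inj _ I] ij(3) by blast
    then show ?thesis
      by (rule W[OF cV[OF I(1)] cV[OF I(2)]]) (use a ij(4,5) pos_c[OF I(1)] pos_c[OF I(2)] in simp_all)
  next
    fix k assume a: "b" "z0 \<in> H" "k \<in> {1, 4}" "e = {z0, c k}" "A = pos z0" "B = pos (c k)"
    have k: "k \<in> (if b then {..4} else {0})" using a(1,3) by auto
    have z: "z0 \<in> F" using a(2) hubs by blast
    then have "z0 \<noteq> c k" using cF[OF k] by blast
    then show ?thesis using W[OF FV[OF z] cV[OF k]] a(4-6) by simp
  qed
  fix e A B assume D: "drawn e A B"
  show "\<alpha> *\<^sub>R A + \<beta> *\<^sub>R B \<noteq> a *\<^sub>R pos v" if "v \<in> vertices" "0 < \<alpha>" "0 < \<beta>" for v \<alpha> \<beta> a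
  proof -
    obtain x y z where 1: "\<alpha> *\<^sub>R A + \<beta> *\<^sub>R B = vec3 x y z" "cone_row e \<alpha> \<beta> x y z"
      using drawn_cone_row[OF D] by blast
    show ?thesis unfolding 1(1) by (rule row_vertex[OF 1(2) that(2,3,1)])
  qed
  fix e' A' B' and \<alpha> \<beta> \<alpha>' \<beta>' :: real
  assume D': "drawn e' A' B'" and ne: "e \<noteq> e'" and ab: "0 < \<alpha>" "0 < \<beta>" "0 < \<alpha>'" "0 < \<beta>'"
  obtain x y z where 1: "\<alpha> *\<^sub>R A + \<beta> *\<^sub>R B = vec3 x y z" "cone_row e \<alpha> \<beta> x y z"
    using drawn_cone_row[OF D] by blast
  obtain x' y' z' where 2: "\<alpha>' *\<^sub>R A' + \<beta>' *\<^sub>R B' = vec3 x' y' z'" "cone_row e' \<alpha>' \<beta>' x' y' z'"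
    using drawn_cone_row[OF D'] by blast
  show "\<alpha> *\<^sub>R A + \<beta> *\<^sub>R B \<noteq> \<alpha>' *\<^sub>R A' + \<beta>' *\<^sub>R B' \<and> \<alpha> *\<^sub>R A + \<beta> *\<^sub>R B \<noteq> - (\<alpha>' *\<^sub>R A' + \<beta>' *\<^sub>R B')"
    unfolding 1(1) 2(1)   proof
    show "vec3 x y z \<noteq> vec3 x' y' z'"
    proof
      assume "vec3 x y z = vec3 x' y' z'"
      then have "x' = x \<and> y' = y \<and> z' = z" by (simp add: vec3_eq)
      then show False using rows_disjoint[OF 1(2) 2(2) ab] ne by blast
    qed
    show "vec3 x y z \<noteq> - vec3 x' y' z'"
    proof
      assume "vec3 x y z = - vec3 x' y' z'"
      then have "x' = - x \<and> y' = - y \<and> z' = - z" by (simp add: vec3_eq)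
      then show False using rows_disjoint[OF 1(2) 2(2) ab] ne by blast
    qed
  qed
qed (use cont inj E in \<open>simp_all add: pos_nonzero pos_independent\<close>)

end

section \<open>The six groups have a big cyclic subgroup\<close>

definition has_big_cyclic :: "('a, 'b) monoid_scheme \<Rightarrow> bool" where
  "has_big_cyclic G \<longleftrightarrow> (\<exists>g\<in>carrier G. (group.ord G g = 5 \<or> group.ord G g = 6) \<and>
     (\<forall>x\<in>carrier G. x \<notin> generate G {g} \<longrightarrow> group.ord G x \<le> 4))"

text \<open>The map goes from the concrete structure \<open>A\<close> into the group, so that
  explicit parametrisations of a group can be used and no group axioms for \<open>A\<close>
  enter.\<close>

lemma is_isoI:
  assumes f: "bij_betw f (carrier A) (carrier G)"
    and cl: "\<And>a b. a \<in> carrier A \<Longrightarrow> b \<in> carrier A \<Longrightarrow> a \<otimes>\<^bsub>A\<^esub> b \<in> carrier A"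
    and m: "\<And>a b. a \<in> carrier A \<Longrightarrow> b \<in> carrier A \<Longrightarrow> f (a \<otimes>\<^bsub>A\<^esub> b) = f a \<otimes>\<^bsub>G\<^esub> f b"
  shows "G \<cong> A"
proof -
  let ?h = "inv_into (carrier A) f"
  have im: "f ` carrier A = carrier G" and inj: "inj_on f (carrier A)" using f by (auto simp: bij_betw_def)
  have h: "?h x \<in> carrier A" "f (?h x) = x" if "x \<in> carrier G" for x
    using that im by (metis inv_into_into, metis f_inv_into_f)
  have "?h \<in> hom G A"
  proof (rule homI)
    show "?h x \<in> carrier A" if "x \<in> carrier G" for x using h that by blast
    show "?h (x \<otimes>\<^bsub>G\<^esub> y) = ?h x \<otimes>\<^bsub>A\<^esub> ?h y" if "x \<in> carrier G" "y \<in> carrier G" for x y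
    proof -
      have "f (?h x \<otimes>\<^bsub>A\<^esub> ?h y) = x \<otimes>\<^bsub>G\<^esub> y" using m h that by simp
      then show ?thesis using inv_into_f_f[OF inj cl[OF h(1)[OF that(1)] h(1)[OF that(2)]]] by simp
    qed
  qed
  then have "?h \<in> iso G A" using bij_betw_inv_into[OF f] by (simp add: iso_def)
  then show ?thesis unfolding is_iso_def by blast
qed

lemma is_isoD:
  assumes "G \<cong> A" "group G"
  obtains f where "bij_betw f (carrier A) (carrier G)"
    "\<And>a b. a \<in> carrier A \<Longrightarrow> b \<in> carrier A \<Longrightarrow> f (a \<otimes>\<^bsub>A\<^esub> b) = f a \<otimes>\<^bsub>G\<^esub> f b"
proof -
  interpret group G by fact
  obtain h where h: "h \<in> hom G A" "bij_betw h (carrier G) (carrier A)"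
    using assms(1) unfolding is_iso_def iso_def by blast
  let ?f = "inv_into (carrier G) h"
  have inj: "inj_on h (carrier G)" and im: "h ` carrier G = carrier A" using h(2) by (auto simp: bij_betw_def)
  show ?thesis
  proof (rule that[of ?f])
    show "bij_betw ?f (carrier A) (carrier G)" by (rule bij_betw_inv_into[OF h(2)])
    fix a b assume "a \<in> carrier A" "b \<in> carrier A"
    then obtain x y where x: "x \<in> carrier G" "a = h x" and y: "y \<in> carrier G" "b = h y" using im by blast
    have "a \<otimes>\<^bsub>A\<^esub> b = h (x \<otimes>\<^bsub>G\<^esub> y)" using hom_mult[OF h(1) x(1) y(1)] x y by simp
    then show "?f (a \<otimes>\<^bsub>A\<^esub> b) = ?f a \<otimes>\<^bsub>G\<^esub> ?f b" using x y inv_into_f_f[OF inj] by simp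
  qed
qed

lemma carrier_sd: "0 < n \<Longrightarrow> 0 < m \<Longrightarrow>
    carrier (semidirect_product (integer_mod_group n) (integer_mod_group m) \<theta>) = {0..<int n} \<times> {0..<int m}"
  by (simp add: semidirect_product_def carrier_integer_mod_group)

lemma mult_sd:
  assumes "0 < n" "0 \<le> k'" "k' < int n"
  shows "(k, h) \<otimes>\<^bsub>semidirect_product (integer_mod_group n) (integer_mod_group m) (inversion_action n)\<^esub> (k', h') =
    ((k + (if even h then k' else - k')) mod int n, (h + h') mod int m)"
proof -
  have "k' \<in> carrier (integer_mod_group n)" using assms by (simp add: carrier_integer_mod_group)
  then show ?thesis by (simp add: semidirect_product_def inversion_action_def mod_diff_right_eq mod_add_right_eq)
qed

context group
begin

lemma ord_le_4: "x \<in> carrier G \<Longrightarrow> (x \<otimes> x) \<otimes> (x \<otimes> x) = \<one> \<Longrightarrow> ord x \<le> 4"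
proof -
  assume x: "x \<in> carrier G" and e: "(x \<otimes> x) \<otimes> (x \<otimes> x) = \<one>"
  have "x [^] (4::nat) = \<one>" using x e by (simp add: numeral_eq_Suc m_assoc)
  then have "ord x dvd 4" using pow_eq_id[OF x] by blast
  then show ?thesis by (rule dvd_imp_le) simp
qed

lemma cyclic_part:
  assumes n: "2 \<le> n" and \<phi>: "\<phi> ` {0..<int n} \<subseteq> carrier G" and inj: "inj_on \<phi> {0..<int n}"
    and mult: "\<And>a b. a \<in> {0..<int n} \<Longrightarrow> b \<in> {0..<int n} \<Longrightarrow> \<phi> ((a + b) mod int n) = \<phi> a \<otimes> \<phi> b"
  shows "\<phi> 1 \<in> carrier G" "ord (\<phi> 1) = n" "\<And>k. k \<in> {0..<int n} \<Longrightarrow> \<phi> k \<in> generate G {\<phi> 1}"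
proof -
  have c: "carrier (integer_mod_group n) = {0..<int n}" using n by (simp add: carrier_integer_mod_group)
  have "group_hom (integer_mod_group n) G \<phi>"
    by (intro group_hom.intro group_hom_axioms.intro homI group_integer_mod_group is_group)
       (use \<phi> mult in \<open>auto simp: c\<close>)
  then interpret h: group_hom "integer_mod_group n" G \<phi> .
  have one: "1 \<in> carrier (integer_mod_group n)" using n by (simp add: c)
  show g: "\<phi> 1 \<in> carrier G" using \<phi> n by auto
  have pw: "\<phi> 1 [^] k = \<phi> (k mod int n)" for k :: int
    using h.hom_int_pow[OF one, of k] by (simp add: int_pow_integer_mod_group)
  show "\<phi> k \<in> generate G {\<phi> 1}" if "k \<in> {0..<int n}" for k
  proof -
    have "\<phi> k = \<phi> 1 [^] k" using pw[of k] that by simp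
    then show ?thesis unfolding generate_pow[OF g] by blast
  qed
  have "\<phi> 1 [^] m = \<one> \<longleftrightarrow> n dvd m" for m :: nat
  proof -
    have "\<phi> 0 = \<one>" using h.hom_one by simp
    then have "\<phi> 1 [^] m = \<one> \<longleftrightarrow> \<phi> (int m mod int n) = \<phi> 0" using pw[of "int m"] by (simp add: int_pow_int)
    also have "\<dots> \<longleftrightarrow> int m mod int n = 0" using inj_on_eq_iff[OF inj, of "int m mod int n" 0] n by simp
    also have "\<dots> \<longleftrightarrow> n dvd m" by (simp add: dvd_eq_mod_eq_0[symmetric] int_dvd_int_iff)
    finally show ?thesis .
  qed
  then show "ord (\<phi> 1) = n" using ord_unique[OF g] by blast
qed

text \<open>A fourth power condition covers all cases: outside the cyclic subgroup of the dihedral,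
  dicyclic and Frobenius groups all orders divide 4.\<close>

lemma has_big_cyclicI:
  assumes n: "n = 5 \<or> n = 6" and \<phi>: "\<phi> ` {0..<int n} \<subseteq> carrier G" and inj: "inj_on \<phi> {0..<int n}"
    and mult: "\<And>a b. a \<in> {0..<int n} \<Longrightarrow> b \<in> {0..<int n} \<Longrightarrow> \<phi> ((a + b) mod int n) = \<phi> a \<otimes> \<phi> b"
    and out: "\<And>x. x \<in> carrier G \<Longrightarrow> x \<notin> \<phi> ` {0..<int n} \<Longrightarrow> (x \<otimes> x) \<otimes> (x \<otimes> x) = \<one>"
  shows "has_big_cyclic G"
proof -
  have "2 \<le> n" using n by auto
  note c = cyclic_part[OF this \<phi> inj mult]
  show ?thesis unfolding has_big_cyclic_def
  proof (intro bexI[OF _ c(1)] conjI ballI impI)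
    show "ord (\<phi> 1) = 5 \<or> ord (\<phi> 1) = 6" using c(2) n by simp
    fix x assume "x \<in> carrier G" "x \<notin> generate G {\<phi> 1}"
    then show "ord x \<le> 4" using c(3) by (intro ord_le_4 out) auto
  qed
qed

lemma has_big_cyclic_Zn:
  assumes "G \<cong> integer_mod_group n" "n = 5 \<or> n = 6" shows "has_big_cyclic G"
proof -
  have c: "carrier (integer_mod_group n) = {0..<int n}" using assms(2) by (auto simp: carrier_integer_mod_group)
  obtain f where f: "bij_betw f (carrier (integer_mod_group n)) (carrier G)"
    "\<And>a b. a \<in> carrier (integer_mod_group n) \<Longrightarrow> b \<in> carrier (integer_mod_group n) \<Longrightarrow>
       f (a \<otimes>\<^bsub>integer_mod_group n\<^esub> b) = f a \<otimes> f b"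
    using is_isoD[OF assms(1) is_group] by blast
  have im: "f ` {0..<int n} = carrier G" and inj: "inj_on f {0..<int n}" using f(1) by (auto simp: bij_betw_def c)
  show ?thesis
    by (rule has_big_cyclicI[of n f, OF assms(2)]) (use f(2) im inj in \<open>simp_all add: c\<close>)
qed

lemma idem_one: "x \<in> carrier G \<Longrightarrow> x = x \<otimes> x \<Longrightarrow> x = \<one>"
  using l_cancel_one'[of x x] by simp

lemma has_big_cyclic_dihedral:
  assumes "G \<cong> dihedral_group n" "n = 5 \<or> n = 6" shows "has_big_cyclic G"
proof -
  have n: "0 < n" using assms(2) by auto
  let ?A = "dihedral_group n"
  have c: "carrier ?A = {0..<int n} \<times> {0..<2}" unfolding dihedral_group_def using n by (simp add: carrier_sd)
  obtain f where f: "bij_betw f (carrier ?A) (carrier G)"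
    "\<And>a b. a \<in> carrier ?A \<Longrightarrow> b \<in> carrier ?A \<Longrightarrow> f (a \<otimes>\<^bsub>?A\<^esub> b) = f a \<otimes> f b"
    using is_isoD[OF assms(1) is_group] by blast
  have im: "f ` carrier ?A = carrier G" and inj: "inj_on f (carrier ?A)" using f(1) by (auto simp: bij_betw_def)
  have m: "f (k, h) \<otimes> f (k', h') = f ((k + (if even h then k' else - k')) mod int n, (h + h') mod 2)"
    if "k \<in> {0..<int n}" "k' \<in> {0..<int n}" "h \<in> {0..<2}" "h' \<in> {0..<2}" for k k' h h'
  proof -
    have "(k, h) \<otimes>\<^bsub>?A\<^esub> (k', h') = ((k + (if even h then k' else - k')) mod int n, (h + h') mod int 2)"
      unfolding dihedral_group_def by (rule mult_sd) (use that n in simp_all)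
    moreover have "(k, h) \<in> carrier ?A" "(k', h') \<in> carrier ?A" unfolding c using that by (simp_all only: mem_Times_iff fst_conv snd_conv)
    ultimately show ?thesis using f(2)[of "(k, h)" "(k', h')"] by simp
  qed
  have 1: "f (0, 0) = \<one>" by (rule idem_one) (use m[of 0 0 0 0] n im c in auto)
  show ?thesis
  proof (rule has_big_cyclicI[of n "\<lambda>k. f (k, 0)", OF assms(2)])
    show "(\<lambda>k. f (k, 0)) ` {0..<int n} \<subseteq> carrier G" using im c by auto
    show "inj_on (\<lambda>k. f (k, 0)) {0..<int n}"
    proof (rule inj_onI)
      fix a b assume "a \<in> {0..<int n}" "b \<in> {0..<int n}" and e: "f (a, 0) = f (b, 0)"
      then have "(a, 0) \<in> carrier ?A" "(b, 0) \<in> carrier ?A" by (simp_all add: c)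
      then show "a = b" using inj_onD[OF inj e] by simp
    qed
    show "f ((a + b) mod int n, 0) = f (a, 0) \<otimes> f (b, 0)" if "a \<in> {0..<int n}" "b \<in> {0..<int n}" for a b
      using m[of a b 0 0] that by simp
    fix x assume x: "x \<in> carrier G" "x \<notin> (\<lambda>k. f (k, 0)) ` {0..<int n}"
    have "x \<in> f ` ({0..<int n} \<times> {0..<2})" using x(1) im c by simp
    then obtain k h where kh: "k \<in> {0..<int n}" "h \<in> {0..<2}" "x = f (k, h)" by blast
    have "h \<noteq> 0" using x(2) kh by auto
    then have "h = 1" using kh(2) by auto
    then have "x \<otimes> x = \<one>" unfolding kh(3) using m[OF kh(1) kh(1) kh(2) kh(2)] 1 by simp
    then show "(x \<otimes> x) \<otimes> (x \<otimes> x) = \<one>" by simp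
  qed
qed

text \<open>The pairs with even second entry are the product of Z3 with the centre, cyclic of order
  6; every other element squares to the central pair (0, 2).\<close>

lemma has_big_cyclic_dicyclic:
  assumes "G \<cong> Z3_semidirect_Z4" shows "has_big_cyclic G"
proof -
  let ?A = "Z3_semidirect_Z4"
  have c: "carrier ?A = {0..<3} \<times> {0..<4}" unfolding Z3_semidirect_Z4_def by (simp add: carrier_sd)
  obtain f where f: "bij_betw f (carrier ?A) (carrier G)"
    "\<And>a b. a \<in> carrier ?A \<Longrightarrow> b \<in> carrier ?A \<Longrightarrow> f (a \<otimes>\<^bsub>?A\<^esub> b) = f a \<otimes> f b"
    using is_isoD[OF assms(1) is_group] by blast
  have im: "f ` carrier ?A = carrier G" and inj: "inj_on f (carrier ?A)" using f(1) by (auto simp: bij_betw_def)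
  have m: "f (k, h) \<otimes> f (k', h') = f ((k + (if even h then k' else - k')) mod 3, (h + h') mod 4)"
    if "k \<in> {0..<3}" "k' \<in> {0..<3}" "h \<in> {0..<4}" "h' \<in> {0..<4}" for k k' h h'
  proof -
    have "(k, h) \<otimes>\<^bsub>?A\<^esub> (k', h') = ((k + (if even h then k' else - k')) mod int 3, (h + h') mod int 4)"
      unfolding Z3_semidirect_Z4_def by (rule mult_sd) (use that in simp_all)
    moreover have "(k, h) \<in> carrier ?A" "(k', h') \<in> carrier ?A" unfolding c using that by (simp_all only: mem_Times_iff fst_conv snd_conv)
    ultimately show ?thesis using f(2)[of "(k, h)" "(k', h')"] by simp
  qed
  have 1: "f (0, 0) = \<one>" by (rule idem_one) (use m[of 0 0 0 0] im c in auto)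
  show ?thesis
  proof (rule has_big_cyclicI[of 6 "\<lambda>k. f (k mod 3, 2 * k mod 4)"])
    show "(\<lambda>k. f (k mod 3, 2 * k mod 4)) ` {0..<int 6} \<subseteq> carrier G" using im c by auto
    show "inj_on (\<lambda>k. f (k mod 3, 2 * k mod 4)) {0..<int 6}"
    proof (rule inj_onI)
      fix a b assume ab: "a \<in> {0..<int 6}" "b \<in> {0..<int 6}" "f (a mod 3, 2 * a mod 4) = f (b mod 3, 2 * b mod 4)"
      have "(a mod 3, 2 * a mod 4) \<in> carrier ?A" "(b mod 3, 2 * b mod 4) \<in> carrier ?A" by (simp_all add: c)
      then have "a mod 3 = b mod 3" "2 * a mod 4 = 2 * b mod 4" using inj_onD[OF inj ab(3)] by simp_all
      moreover have "a = 0 \<or> a = 1 \<or> a = 2 \<or> a = 3 \<or> a = 4 \<or> a = 5" "b = 0 \<or> b = 1 \<or> b = 2 \<or> b = 3 \<or> b = 4 \<or> b = 5"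
        using ab(1,2) by auto
      ultimately show "a = b" by (elim disjE) simp_all
    qed
    show "f ((a + b) mod int 6 mod 3, 2 * ((a + b) mod int 6) mod 4) = f (a mod 3, 2 * a mod 4) \<otimes> f (b mod 3, 2 * b mod 4)" for a b
    proof -
      have "even (2 * a mod 4)" "(a mod 3 + b mod 3) mod 3 = (a + b) mod int 6 mod 3"
        "(2 * a mod 4 + 2 * b mod 4) mod 4 = 2 * ((a + b) mod int 6) mod 4"
        by (presburger, simp add: mod_add_eq mod_mod_cancel,
            simp add: mod_add_eq mult_mod_right mod_mod_cancel distrib_left)
      then show ?thesis using m[of "a mod 3" "b mod 3" "2 * a mod 4" "2 * b mod 4"] by simp
    qed
    fix x assume x: "x \<in> carrier G" "x \<notin> (\<lambda>k. f (k mod 3, 2 * k mod 4)) ` {0..<int 6}"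
    have "x \<in> f ` ({0..<3} \<times> {0..<4})" using x(1) im c by simp
    then obtain k h where kh: "k \<in> {0..<3}" "h \<in> {0..<4}" "x = f (k, h)" by blast
    have k: "k = 0 \<or> k = 1 \<or> k = 2" and h: "h = 0 \<or> h = 1 \<or> h = 2 \<or> h = 3" using kh(1,2) by auto
    have "odd h"
    proof
      assume "even h"
      then have h: "h = 0 \<or> h = 2" using h by auto
      \<comment> \<open>The inverse of the Chinese remainder map that sends j to the pair of j mod 3
        and 2 j mod 4.\<close>
      define j :: int where "j = (if h = 0 then (if k = 0 then 0 else if k = 1 then 4 else 2)
        else (if k = 0 then 3 else if k = 1 then 1 else 5))"
      have "j mod 3 = k \<and> 2 * j mod 4 = h \<and> j \<in> {0..<int 6}"
        using k h by (elim disjE) (simp_all add: j_def)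
      then show False using x(2) kh(3) by blast
    qed
    then have "h = 1 \<or> h = 3" using h by auto
    then have "x \<otimes> x = f (0, 2)" unfolding kh(3) using m[OF kh(1) kh(1) kh(2) kh(2)] by (elim disjE) simp_all
    then show "(x \<otimes> x) \<otimes> (x \<otimes> x) = \<one>" using m[of 0 0 2 2] 1 by simp
  qed simp
qed

lemma subgroup_cyclic:
  assumes K: "subgroup K G" and iso: "G\<lparr>carrier := K\<rparr> \<cong> integer_mod_group n" and n: "2 \<le> n"
  obtains f where "f ` {0..<int n} = K" "inj_on f {0..<int n}"
    "\<And>a b. a \<in> {0..<int n} \<Longrightarrow> b \<in> {0..<int n} \<Longrightarrow> f ((a + b) mod int n) = f a \<otimes> f b"
proof -
  have c: "carrier (integer_mod_group n) = {0..<int n}" using n by (simp add: carrier_integer_mod_group)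
  have "group (G\<lparr>carrier := K\<rparr>)" using K by (rule subgroup_imp_group)
  then obtain f where f: "bij_betw f (carrier (integer_mod_group n)) (carrier (G\<lparr>carrier := K\<rparr>))"
    "\<And>a b. a \<in> carrier (integer_mod_group n) \<Longrightarrow> b \<in> carrier (integer_mod_group n) \<Longrightarrow>
       f (a \<otimes>\<^bsub>integer_mod_group n\<^esub> b) = f a \<otimes>\<^bsub>G\<lparr>carrier := K\<rparr>\<^esub> f b"
    by (rule is_isoD[OF iso]) (rule that)
  show ?thesis
  proof (rule that)
    show "f ` {0..<int n} = K" "inj_on f {0..<int n}" using f(1) unfolding c bij_betw_def by simp_all
    show "f ((a + b) mod int n) = f a \<otimes> f b" if "a \<in> {0..<int n}" "b \<in> {0..<int n}" for a b
      using f(2)[of a b] that unfolding c by simp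
  qed
qed

text \<open>By the definition of the kernel, an element outside it is conjugate to an element of the
  complement, so its fourth power is 1.\<close>

lemma has_big_cyclic_frobenius:
  assumes "is_frobenius_product G (integer_mod_group 5) (integer_mod_group 4)" shows "has_big_cyclic G"
proof -
  obtain K H where F: "frobenius_group G K H" and K: "subgroup K G" "G\<lparr>carrier := K\<rparr> \<cong> integer_mod_group 5"
    and H: "G\<lparr>carrier := H\<rparr> \<cong> integer_mod_group 4" using assms unfolding is_frobenius_product_def by blast
  have Hs: "subgroup H G" and Keq: "K = insert \<one> (carrier G - (\<Union>g\<in>carrier G. (\<lambda>h. g \<otimes> h \<otimes> inv g) ` H))"
    using F unfolding frobenius_group_def by blast+
  obtain f where f: "f ` {0..<int 5} = K" "inj_on f {0..<int 5}"
    "\<And>a b. a \<in> {0..<int 5} \<Longrightarrow> b \<in> {0..<int 5} \<Longrightarrow> f ((a + b) mod int 5) = f a \<otimes> f b"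
    by (rule subgroup_cyclic[OF K], simp, rule that)
  obtain e where e: "e ` {0..<int 4} = H" "inj_on e {0..<int 4}"
    "\<And>a b. a \<in> {0..<int 4} \<Longrightarrow> b \<in> {0..<int 4} \<Longrightarrow> e ((a + b) mod int 4) = e a \<otimes> e b"
    by (rule subgroup_cyclic[OF Hs H], simp, rule that)
  have HG: "H \<subseteq> carrier G" and KG: "K \<subseteq> carrier G" using Hs K(1) subgroup.subset by blast+
  have "e 0 \<in> e ` {0..<int 4}" by (rule imageI) simp
  then have "e 0 \<in> carrier G" using e(1) HG by blast
  moreover have "e 0 = e 0 \<otimes> e 0" using e(3)[of 0 0] by simp
  ultimately have e0: "e 0 = \<one>" by (rule idem_one)
  have h4: "(h \<otimes> h) \<otimes> (h \<otimes> h) = \<one>" if h: "h \<in> H" for h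
  proof -
    obtain a where a: "a \<in> {0..<int 4}" "h = e a" using h e(1) by blast
    then have "h \<otimes> h = e ((a + a) mod 4)" using e(3)[of a a] by simp
    moreover have "(a + a) mod 4 \<in> {0..<int 4}" "((a + a) mod 4 + (a + a) mod 4) mod 4 = (0::int)"
      by simp presburger
    ultimately show ?thesis using e(3)[of "(a + a) mod 4" "(a + a) mod 4"] e0 by simp
  qed
  show ?thesis
  proof (rule has_big_cyclicI[of 5 f])
    show "f ` {0..<int 5} \<subseteq> carrier G" using f(1) KG by simp
    fix x assume "x \<in> carrier G" "x \<notin> f ` {0..<int 5}"
    then have "x \<in> (\<Union>g\<in>carrier G. (\<lambda>h. g \<otimes> h \<otimes> inv g) ` H)" unfolding f(1) Keq by blast
    then obtain g h where g: "g \<in> carrier G" "h \<in> H" "x = g \<otimes> h \<otimes> inv g" by blast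
    then have h: "h \<in> carrier G" using HG by blast
    have conj: "(g \<otimes> a \<otimes> inv g) \<otimes> (g \<otimes> b \<otimes> inv g) = g \<otimes> (a \<otimes> b) \<otimes> inv g"
      if "a \<in> carrier G" "b \<in> carrier G" for a b
    proof -
      have "inv g \<otimes> (g \<otimes> y) = y" if "y \<in> carrier G" for y
        using g(1) that by (simp add: m_assoc[symmetric])
      then show ?thesis using g(1) that by (simp add: m_assoc)
    qed
    show "(x \<otimes> x) \<otimes> (x \<otimes> x) = \<one>"
      unfolding g(3) using conj h h4[OF g(2)] g(1) by simp
  qed (use f in auto)
qed

end

section \<open>Arithmetic and recognition of semidirect products\<close>

text \<open>Chinese remainders: 2 (2 i) + 3 i = 7 i is i modulo 6. This writes a power of g as a
  power of g^2 times a power of g^3.\<close>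

lemma six_dvd_crt: "6 dvd 2 * (2 * i mod 3) + 3 * (i mod 2) - (i :: int)"
proof -
  have 1: "2 * (2 * i - 3 * q) + 3 * (i - 2 * p) - i = 6 * (i - q - p)" for p q :: int by (simp add: algebra_simps)
  have "2 * (2 * i mod 3) + 3 * (i mod 2) - i = 6 * (i - 2 * i div 3 - i div 2)"
    unfolding 1[symmetric] by (simp only: minus_mult_div_eq_mod)
  then show ?thesis by (rule dvdI)
qed

context group
begin

lemma conj_int_pow:
  assumes "t \<in> carrier G" "u \<in> carrier G"
  shows "t \<otimes> u [^] (k::int) \<otimes> inv t = (t \<otimes> u \<otimes> inv t) [^] k"
proof -
  have c: "inv t \<otimes> (t \<otimes> y) = y" if "y \<in> carrier G" for y
    using assms(1) that by (simp add: m_assoc[symmetric])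
  have "group_hom G G (\<lambda>x. t \<otimes> x \<otimes> inv t)"
    by (intro group_hom.intro group_hom_axioms.intro homI is_group)
       (use assms c in \<open>simp_all add: m_assoc\<close>)
  then interpret h: group_hom G G "\<lambda>x. t \<otimes> x \<otimes> inv t" .
  show ?thesis using h.hom_int_pow[OF assms(2), of k] by simp
qed

lemma cyclic_iso:
  assumes u: "u \<in> carrier G" and n: "ord u = n" "2 \<le> n"
  shows "G\<lparr>carrier := generate G {u}\<rparr> \<cong> integer_mod_group n"
proof (rule is_isoI[where f = "\<lambda>k. u [^] k"])
  have c: "carrier (integer_mod_group n) = {0..<int n}" using n by (simp add: carrier_integer_mod_group)
  have eq: "u [^] a = u [^] b \<longleftrightarrow> int n dvd b - a" for a b :: int using int_pow_eq[OF u] n by simp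
  show "bij_betw (\<lambda>k. u [^] k) (carrier (integer_mod_group n)) (carrier (G\<lparr>carrier := generate G {u}\<rparr>))"
    unfolding bij_betw_def c
  proof
    show "inj_on (\<lambda>k. u [^] k) {0..<int n}"
    proof (rule inj_onI)
      fix a b assume ab: "a \<in> {0..<int n}" "b \<in> {0..<int n}" "u [^] a = u [^] b"
      then have "int n dvd b - a" using eq by blast
      then have "b mod int n = a mod int n" by (simp only: mod_eq_dvd_iff)
      then show "a = b" using ab by simp
    qed
    have "u [^] k \<in> (\<lambda>k. u [^] k) ` {0..<int n}" for k :: int
    proof (rule image_eqI)
      show "k mod int n \<in> {0..<int n}" using n by simp
      show "u [^] k = u [^] (k mod int n)" unfolding eq by (simp add: mod_eq_dvd_iff[symmetric])
    qed
    then show "(\<lambda>k. u [^] k) ` {0..<int n} = carrier (G\<lparr>carrier := generate G {u}\<rparr>)"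
      unfolding generate_pow[OF u] by auto
  qed
  show "a \<otimes>\<^bsub>integer_mod_group n\<^esub> b \<in> carrier (integer_mod_group n)" for a b
    unfolding c using n by simp
  show "u [^] (a \<otimes>\<^bsub>integer_mod_group n\<^esub> b) = u [^] a \<otimes>\<^bsub>G\<lparr>carrier := generate G {u}\<rparr>\<^esub> u [^] b" for a b
  proof -
    have "u [^] ((a + b) mod int n) = u [^] (a + b)" unfolding eq by (simp add: mod_eq_dvd_iff[symmetric])
    then show ?thesis using int_pow_mult[OF u] by simp
  qed
qed

text \<open>Internal recognition: every element is uniquely a power of \<open>a\<close> times a
  power of \<open>t\<close>, and \<open>t\<close> inverts \<open>a\<close>. The divisibilities
  \<open>an\<close> and \<open>tm\<close> let exponents be reduced modulo \<open>n\<close> and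
  \<open>m\<close>.\<close>

lemma sd_iso:
  assumes a: "a \<in> carrier G" and t: "t \<in> carrier G" and nm: "0 < n" "0 < m"
    and an: "int (ord a) dvd int n" and tm: "int (ord t) dvd int m"
    and comm: "\<And>k::int. t \<otimes> a [^] k = a [^] (- k) \<otimes> t"
    and bij: "bij_betw (\<lambda>(k::int, h::int). a [^] k \<otimes> t [^] h) ({0..<int n} \<times> {0..<int m}) (carrier G)"
  shows "G \<cong> semidirect_product (integer_mod_group n) (integer_mod_group m) (inversion_action n)" (is "G \<cong> ?A")
proof (rule is_isoI[OF bij[folded carrier_sd[OF nm, of "inversion_action n"]]])
  have pm: "a [^] (x mod int n) = a [^] x" "t [^] (x mod int m) = t [^] x" for x :: int
    unfolding int_pow_eq[OF a] int_pow_eq[OF t]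
    by (rule dvd_trans[OF an dvd_minus_mod], rule dvd_trans[OF tm dvd_minus_mod])
  have ch: "t [^] h \<otimes> a [^] k = a [^] (if even h then k else - k) \<otimes> t [^] h" for h :: nat and k :: int
  proof (induction h arbitrary: k)
    case (Suc h)
    have "t [^] Suc h \<otimes> a [^] k = t [^] h \<otimes> (a [^] (- k) \<otimes> t)" using a t comm by (simp add: m_assoc)
    also have "\<dots> = (t [^] h \<otimes> a [^] (- k)) \<otimes> t" using a t by (simp add: m_assoc)
    also have "\<dots> = a [^] (if even (Suc h) then k else - k) \<otimes> t [^] Suc h"
      unfolding Suc.IH using a t by (simp add: m_assoc)
    finally show ?case .
  qed (use a in simp)
  fix x y assume "x \<in> carrier ?A" "y \<in> carrier ?A"
  then obtain k h k' h' where x: "x = (k, h)" "k \<in> {0..<int n}" "h \<in> {0..<int m}"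
    and y: "y = (k', h')" "k' \<in> {0..<int n}" "h' \<in> {0..<int m}" unfolding carrier_sd[OF nm] by blast
  have xy: "x \<otimes>\<^bsub>?A\<^esub> y = ((k + (if even h then k' else - k')) mod int n, (h + h') mod int m)"
    unfolding x(1) y(1) by (rule mult_sd) (use nm y in simp_all)
  show "x \<otimes>\<^bsub>?A\<^esub> y \<in> carrier ?A" unfolding xy carrier_sd[OF nm] using nm by simp
  have hh: "t [^] h \<otimes> a [^] k' = a [^] (if even h then k' else - k') \<otimes> t [^] h"
  proof -
    obtain h0 where h0: "h = int h0" using x(3) by (meson atLeastLessThan_iff zero_le_imp_eq_int)
    show ?thesis using ch[of h0 k'] unfolding h0 int_pow_int even_of_nat .
  qed
  have "(a [^] k \<otimes> t [^] h) \<otimes> (a [^] k' \<otimes> t [^] h') = a [^] k \<otimes> (t [^] h \<otimes> a [^] k') \<otimes> t [^] h'"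
    using a t by (simp add: m_assoc)
  also have "\<dots> = (a [^] k \<otimes> a [^] (if even h then k' else - k')) \<otimes> (t [^] h \<otimes> t [^] h')"
    unfolding hh
  proof -
    have assoc4: "x \<otimes> (y \<otimes> z) \<otimes> w = (x \<otimes> y) \<otimes> (z \<otimes> w)"
      if "x \<in> carrier G" "y \<in> carrier G" "z \<in> carrier G" "w \<in> carrier G" for x y z w
      using that by (simp add: m_assoc)
    show "a [^] k \<otimes> (a [^] (if even h then k' else - k') \<otimes> t [^] h) \<otimes> t [^] h' =
      (a [^] k \<otimes> a [^] (if even h then k' else - k')) \<otimes> (t [^] h \<otimes> t [^] h')"
      by (rule assoc4) (use a t in \<open>simp_all only: int_pow_closed\<close>)
  qed
  also have "\<dots> = a [^] (k + (if even h then k' else - k')) \<otimes> t [^] (h + h')"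
    unfolding int_pow_mult[OF a] int_pow_mult[OF t] ..
  finally show "(case x \<otimes>\<^bsub>?A\<^esub> y of (k, h) \<Rightarrow> a [^] k \<otimes> t [^] h) =
      (case x of (k, h) \<Rightarrow> a [^] k \<otimes> t [^] h) \<otimes> (case y of (k, h) \<Rightarrow> a [^] k \<otimes> t [^] h)"
    unfolding xy unfolding x(1) y(1) prod.case pm by (rule sym)
qed

end

section \<open>The action of the group on its big cyclic subgroup\<close>

locale big_cyclic = group +
  fixes g and n :: nat
  assumes fin: "finite (carrier G)" and g: "g \<in> carrier G" and ordg: "ord g = n" and n: "n = 5 \<or> n = 6"
    and out: "\<And>x. x \<in> carrier G \<Longrightarrow> x \<notin> generate G {g} \<Longrightarrow> ord x \<le> 4"
begin

abbreviation "C \<equiv> generate G {g}"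

lemma C_iff: "x \<in> C \<longleftrightarrow> (\<exists>k::int. x = g [^] k)"
  unfolding generate_pow[OF g] by simp

lemma geq: "g [^] (a::int) = g [^] (b::int) \<longleftrightarrow> int n dvd b - a"
  using int_pow_eq[OF g] ordg by simp

lemma gadd: "g [^] (a::int) \<otimes> g [^] (b::int) = g [^] (a + b)"
  using int_pow_mult[OF g] by simp

lemma out34: "x \<in> carrier G \<Longrightarrow> x \<notin> C \<Longrightarrow> x [^] (3::nat) = \<one> \<or> x [^] (4::nat) = \<one>"
proof -
  assume x: "x \<in> carrier G" "x \<notin> C"
  have "ord x = 1 \<or> ord x = 2 \<or> ord x = 3 \<or> ord x = 4" using out[OF x] ord_ge_1[OF fin x(1)] by linarith
  then show ?thesis unfolding pow_eq_id[OF x(1)] by (elim disjE) simp_all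
qed

text \<open>Conjugation by \<open>t\<close> raises \<open>g\<close> to the power \<open>j\<close>,
  written without inverses; \<open>j\<close> is an integer that matters only modulo
  \<open>n\<close>.\<close>

definition act :: "'a \<Rightarrow> int \<Rightarrow> bool" where
  "act t j \<longleftrightarrow> (\<forall>k::int. t \<otimes> g [^] k = g [^] (j * k) \<otimes> t)"

lemma actD: "act t j \<Longrightarrow> t \<otimes> g [^] (k::int) = g [^] (j * k) \<otimes> t"
  unfolding act_def by blast

text \<open>The conjugate of \<open>g\<close> has order \<open>n\<close> > 4, so it cannot lie
  outside \<open>C\<close>: the subgroup is normal.\<close>

lemma act_exists: "t \<in> carrier G \<Longrightarrow> \<exists>j. act t j"
proof -
  assume t: "t \<in> carrier G"
  define y where "y = t \<otimes> g \<otimes> inv t"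
  have yc: "y \<in> carrier G" using t g by (simp add: y_def)
  have pw: "t \<otimes> g [^] k \<otimes> inv t = y [^] k" for k :: int unfolding y_def by (rule conj_int_pow[OF t g])
  have "y \<in> C"
  proof (rule ccontr)
    assume "y \<notin> C"
    then have "y [^] (3::nat) = \<one> \<or> y [^] (4::nat) = \<one>" by (rule out34[OF yc])
    then obtain m :: nat where m: "m = 3 \<or> m = 4" "y [^] int m = \<one>" by (metis int_pow_int)
    then have "t \<otimes> g [^] int m \<otimes> inv t = \<one>" using pw[of "int m"] by simp
    then have "g [^] int m = \<one>" using t g
      by (metis (no_types, opaque_lifting) int_pow_closed inv_closed inv_equality inv_inv l_inv m_assoc m_closed r_cancel_one')
    then have "int n dvd int m" using int_pow_eq_id[OF g] ordg by simp
    then show False using n m(1) by auto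
  qed
  then obtain j :: int where j: "y = g [^] j" using C_iff by blast
  have "t \<otimes> g [^] k = g [^] (j * k) \<otimes> t" for k :: int
  proof -
    have "t \<otimes> g [^] k = (t \<otimes> g [^] k \<otimes> inv t) \<otimes> t" using t g by (simp add: m_assoc)
    then show ?thesis unfolding pw j int_pow_pow[OF g] .
  qed
  then show ?thesis unfolding act_def by blast
qed

lemma act_mult: "act t j \<Longrightarrow> act u k \<Longrightarrow> t \<in> carrier G \<Longrightarrow> u \<in> carrier G \<Longrightarrow> act (t \<otimes> u) (j * k)"
proof -
  assume a: "act t j" "act u k" and c: "t \<in> carrier G" "u \<in> carrier G"
  have "(t \<otimes> u) \<otimes> g [^] m = g [^] (j * k * m) \<otimes> (t \<otimes> u)" for m :: int
  proof -
    have "(t \<otimes> u) \<otimes> g [^] m = t \<otimes> (g [^] (k * m) \<otimes> u)" using c g actD[OF a(2)] by (simp add: m_assoc)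
    also have "\<dots> = (t \<otimes> g [^] (k * m)) \<otimes> u" using c g by (simp add: m_assoc)
    also have "\<dots> = g [^] (j * (k * m)) \<otimes> (t \<otimes> u)" unfolding actD[OF a(1)] using c g by (simp add: m_assoc)
    finally show ?thesis by (simp add: mult.assoc)
  qed
  then show ?thesis unfolding act_def by blast
qed

text \<open>In other words, \<open>j\<close> is a unit modulo \<open>n\<close>.\<close>

lemma act_coprime: "act t j \<Longrightarrow> t \<in> carrier G \<Longrightarrow> int n dvd j * k \<Longrightarrow> int n dvd k"
proof -
  assume a: "act t j" and t: "t \<in> carrier G" and d: "int n dvd j * k"
  have "g [^] (j * k) = \<one>" using int_pow_eq_id[OF g] ordg d by simp
  then have "t \<otimes> g [^] k = t" using actD[OF a, of k] t by simp
  then have "g [^] k = \<one>" using t g by simp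
  then show ?thesis using int_pow_eq_id[OF g] ordg by simp
qed

lemma gC: "x \<in> carrier G \<Longrightarrow> x \<otimes> g [^] (k::int) \<in> C \<Longrightarrow> x \<in> C"
proof -
  assume x: "x \<in> carrier G" and c: "x \<otimes> g [^] k \<in> C"
  obtain a :: int where a: "x \<otimes> g [^] k = g [^] a" using c C_iff by blast
  have "x = (x \<otimes> g [^] k) \<otimes> g [^] (- k)" using x g by (simp add: m_assoc gadd)
  then have "x = g [^] (a - k)" unfolding a gadd by simp
  then show ?thesis using C_iff by blast
qed

text \<open>If x outside \<open>C\<close> commuted with \<open>g\<close>, then all x g^k would be
  outside too, so their third or fourth powers would be trivial, while powers of such products
  split.\<close>

lemma centralizer:
  assumes x: "x \<in> carrier G" and a: "act x j" "int n dvd j - 1"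
  shows "x \<in> C"
proof (rule ccontr)
  assume nC: "x \<notin> C"
  have comm: "x \<otimes> g [^] k = g [^] k \<otimes> x" for k :: int
  proof -
    have "int n dvd k - j * k" using dvd_mult[OF a(2), of "- k"] by (simp add: algebra_simps)
    then have "g [^] (j * k) = g [^] k" using geq by blast
    then show ?thesis using actD[OF a(1), of k] by simp
  qed
  have pw: "(x \<otimes> g [^] k) [^] m = x [^] m \<otimes> g [^] (k * int m)" for k :: int and m :: nat
    using pow_mult_distrib[OF comm x, of k m] g by (simp add: int_pow_pow[OF g] flip: int_pow_int)
  have y34: "(x \<otimes> g [^] k) [^] (3::nat) = \<one> \<or> (x \<otimes> g [^] k) [^] (4::nat) = \<one>" for k :: int
    using out34[of "x \<otimes> g [^] k"] gC[OF x] nC x g by blast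
  have id: "g [^] k = \<one> \<longleftrightarrow> int n dvd k" for k :: int using int_pow_eq_id[OF g] ordg by simp
  have x1: "x \<noteq> \<one>" using nC C_iff[of x] by (metis int_pow_0)
  have x34: "x [^] (3::nat) = \<one> \<or> x [^] (4::nat) = \<one>" using out34[OF x nC] .
  have p: "x [^] (3::nat) = x \<otimes> x \<otimes> x" "x [^] (4::nat) = x [^] (3::nat) \<otimes> x" using x by (simp_all add: numeral_eq_Suc)
  have not_both: "\<not> (x [^] (3::nat) = \<one> \<and> x [^] (4::nat) = \<one>)" using p(2) x x1 by auto
  show False using n
  proof
    \<comment> \<open>The twelfth powers of x and of x g would both be 1, but 5 does not divide
      12.\<close>
    assume n5: "n = 5"
    have tw: "u [^] (12::nat) = \<one>" if "u \<in> carrier G" "u [^] (3::nat) = \<one> \<or> u [^] (4::nat) = \<one>" for u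
      using that nat_pow_pow[of u 3 4] nat_pow_pow[of u 4 3] by auto
    have "x [^] (12::nat) = \<one>" by (rule tw[OF x x34])
    moreover have "(x \<otimes> g [^] (1::int)) [^] (12::nat) = \<one>" by (rule tw[OF _ y34]) (use x g in simp)
    ultimately have "g [^] (12::int) = \<one>" using pw[of 1 12] g by simp
    then show False unfolding id n5 by simp
  next
    assume n6: "n = 6"
    show False using x34
    proof
      \<comment> \<open>Since g^8 is not 1, the cube of x g^2 must be 1; as g^6 = 1, this gives x^3
        = 1 as well.\<close>
      assume x4: "x [^] (4::nat) = \<one>"
      have "(x \<otimes> g [^] (2::int)) [^] (4::nat) \<noteq> \<one>" unfolding pw x4 using g id[of 8] n6 by simp
      then have "(x \<otimes> g [^] (2::int)) [^] (3::nat) = \<one>" using y34 by blast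
      moreover have "g [^] (6::int) = \<one>" unfolding id n6 by simp
      ultimately show False unfolding pw using x x4 not_both by simp
    next
      \<comment> \<open>Likewise g^9 is not 1, so the fourth power of x g^3 is 1, and g^12 = 1 gives
        x^4 = 1.\<close>
      assume x3: "x [^] (3::nat) = \<one>"
      have "(x \<otimes> g [^] (3::int)) [^] (3::nat) \<noteq> \<one>" unfolding pw x3 using g id[of 9] n6 by simp
      then have "(x \<otimes> g [^] (3::int)) [^] (4::nat) = \<one>" using y34 by blast
      moreover have "g [^] (12::int) = \<one>" unfolding id n6 by simp
      ultimately show False unfolding pw using x x3 not_both by simp
    qed
  qed
qed

lemma cyclic_case: "carrier G = C \<Longrightarrow> G \<cong> integer_mod_group n"
proof -
  assume c: "carrier G = C"
  have "G\<lparr>carrier := C\<rparr> = G" using c by (metis partial_object.surjective partial_object.update_convs(1))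
  then show ?thesis using cyclic_iso[OF g ordg] n by auto
qed

text \<open>The square of \<open>t\<close> centralizes \<open>g\<close>, so it lies in
  \<open>C\<close>; there \<open>t\<close> inverts it, yet \<open>t\<close> commutes with
  it.\<close>

lemma sq_C: 
  assumes t: "t \<in> carrier G" and a: "act t (- 1)"
  obtains b :: int where "t \<otimes> t = g [^] b" "int n dvd 2 * b"
proof -
  have "t \<otimes> t \<in> C" by (rule centralizer[OF _ act_mult[OF a a t t]]) (use t in simp_all)
  then obtain b :: int where b: "t \<otimes> t = g [^] b" using C_iff by blast
  have "g [^] b \<otimes> t = t \<otimes> g [^] b" unfolding b[symmetric] using t by (simp add: m_assoc)
  also have "\<dots> = g [^] (- b) \<otimes> t" using actD[OF a, of b] by simp
  finally have "g [^] b = g [^] (- b)" using t g by simp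
  then have "int n dvd - b - b" using geq by blast
  then have "int n dvd 2 * b" using dvd_minus_iff[of "int n" "2 * b"] by simp
  then show ?thesis using b that by blast
qed

text \<open>A product of two inverting elements centralizes \<open>g\<close>, so all inverting
  elements lie in one coset of \<open>C\<close>.\<close>

lemma split_coset:
  assumes t: "t \<in> carrier G" "act t (- 1)" and x: "x \<in> carrier G" "act x (- 1)"
  obtains k :: int where "x = g [^] k \<otimes> t"
proof -
  obtain b :: int where b: "t \<otimes> t = g [^] b" using sq_C[OF t] by blast
  have "x \<otimes> t \<in> C" by (rule centralizer[OF _ act_mult[OF x(2) t(2) x(1) t(1)]]) (use t x in simp_all)
  then obtain a :: int where a: "x \<otimes> t = g [^] a" using C_iff by blast
  have "x \<otimes> g [^] b = g [^] a \<otimes> t" unfolding b[symmetric] a[symmetric] using t x by (simp add: m_assoc)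
  then have "x \<otimes> g [^] b \<otimes> g [^] (- b) = g [^] a \<otimes> (t \<otimes> g [^] (- b))" using t g by (simp add: m_assoc)
  also have "\<dots> = g [^] (a + b) \<otimes> t" unfolding actD[OF t(2)] using t g by (simp add: m_assoc[symmetric] gadd)
  finally have "x = g [^] (a + b) \<otimes> t" using x g by (simp add: m_assoc gadd)
  then show ?thesis using that by blast
qed

lemma coset_disjoint: "t \<in> carrier G \<Longrightarrow> t \<notin> C \<Longrightarrow> g [^] (k::int) \<otimes> t \<notin> C"
proof
  assume t: "t \<in> carrier G" "t \<notin> C" and "g [^] k \<otimes> t \<in> C"
  then obtain a :: int where a: "g [^] k \<otimes> t = g [^] a" using C_iff by blast
  have "t = g [^] (- k) \<otimes> (g [^] k \<otimes> t)" using t g by (simp add: m_assoc[symmetric] gadd)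
  then have "t = g [^] (a - k)" unfolding a gadd by simp
  then show False using t C_iff by blast
qed

lemma int_pow_two: "t \<in> carrier G \<Longrightarrow> t [^] (2::int) = t \<otimes> t"
  using int_pow_mult[of t 1 1] by simp

lemma dihedral_case:
  assumes t: "t \<in> carrier G" "t \<notin> C" "act t (- 1)" and tt: "t \<otimes> t = \<one>"
    and cov: "\<And>x. x \<in> carrier G \<Longrightarrow> x \<notin> C \<Longrightarrow> act x (- 1)"
  shows "G \<cong> dihedral_group n"
  unfolding dihedral_group_def
proof (rule sd_iso[OF g t(1)])
  have n0: "0 < int n" using n by auto
  show "0 < n" "0 < (2::nat)" using n by auto
  show "int (ord g) dvd int n" by (simp add: ordg)
  have "t [^] (2::int) = \<one>" using int_pow_two[OF t(1)] tt by simp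
  then show "int (ord t) dvd int 2" using int_pow_eq_id[OF t(1), of 2] by simp
  show "t \<otimes> g [^] k = g [^] (- k) \<otimes> t" for k :: int using actD[OF t(3), of k] by simp
  let ?f = "\<lambda>(k::int, h::int). g [^] k \<otimes> t [^] h"
  have h01: "h = 0 \<or> h = 1" if "h \<in> {0..<int 2}" for h using that by auto
  show "bij_betw ?f ({0..<int n} \<times> {0..<int 2}) (carrier G)" unfolding bij_betw_def
  proof
    show "inj_on ?f ({0..<int n} \<times> {0..<int 2})"
    proof (rule inj_onI)
      fix x y assume "x \<in> {0..<int n} \<times> {0..<int 2}" "y \<in> {0..<int n} \<times> {0..<int 2}" and e: "?f x = ?f y"
      then obtain k h k' h' where x: "x = (k, h)" "k \<in> {0..<int n}" "h \<in> {0..<int 2}"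
        and y: "y = (k', h')" "k' \<in> {0..<int n}" "h' \<in> {0..<int 2}" by blast
      have e: "g [^] k \<otimes> t [^] h = g [^] k' \<otimes> t [^] h'" using e x(1) y(1) by simp
      have inC: "g [^] a \<in> C" for a :: int using C_iff by blast
      have "h = h'"
      proof (rule ccontr)
        assume "h \<noteq> h'"
        then have "h = 0 \<and> h' = 1 \<or> h = 1 \<and> h' = 0" using h01[OF x(3)] h01[OF y(3)] by auto
        then have "g [^] k \<otimes> t \<in> C \<or> g [^] k' \<otimes> t \<in> C"
          using e inC[of k] inC[of k'] t(1) g by (elim disjE conjE) simp_all
        then show False using coset_disjoint[OF t(1,2)] by blast
      qed
      then have "g [^] k = g [^] k'" using e t(1) g by simp
      then have "int n dvd k' - k" using geq by blast
      then have "k' mod int n = k mod int n" by (simp only: mod_eq_dvd_iff)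
      then show "x = y" using x y \<open>h = h'\<close> by simp
    qed
    show "?f ` ({0..<int n} \<times> {0..<int 2}) = carrier G"
    proof
      show "?f ` ({0..<int n} \<times> {0..<int 2}) \<subseteq> carrier G" using t(1) g by auto
      show "carrier G \<subseteq> ?f ` ({0..<int n} \<times> {0..<int 2})"
      proof
        fix x assume x: "x \<in> carrier G"
        obtain k h :: int where kh: "h \<in> {0..<int 2}" "x = g [^] k \<otimes> t [^] h"
        proof (cases "x \<in> C")
          case True
          then obtain k :: int where "x = g [^] k" using C_iff by blast
          then show ?thesis using that[of 0 k] g by simp
        next
          case False
          then obtain k :: int where "x = g [^] k \<otimes> t" using split_coset[OF t(1,3) x cov[OF x]] by blast
          then show ?thesis using that[of 1 k] t(1) by simp
        qed
        have "g [^] k = g [^] (k mod int n)" unfolding geq by (simp add: mod_eq_dvd_iff[symmetric])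
        then have "x = ?f (k mod int n, h)" using kh(2) by simp
        moreover have "(k mod int n, h) \<in> {0..<int n} \<times> {0..<int 2}" using kh(1) n0 by simp
        ultimately show "x \<in> ?f ` ({0..<int n} \<times> {0..<int 2})" by (rule image_eqI)
      qed
    qed
  qed
qed

text \<open>The normal factor is generated by g^2, of order 3, the other one by \<open>t\<close>,
  whose square is g^3. Even exponents of \<open>t\<close> account for \<open>C\<close>, odd ones for
  its other coset; these are \<open>fe\<close> and \<open>fo\<close>.\<close>

lemma dicyclic_case:
  assumes t: "t \<in> carrier G" "t \<notin> C" "act t (- 1)" and tt: "t \<otimes> t = g [^] (3::int)" and n6: "n = 6"
    and cov: "\<And>x. x \<in> carrier G \<Longrightarrow> x \<notin> C \<Longrightarrow> act x (- 1)"
  shows "G \<cong> Z3_semidirect_Z4"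
  unfolding Z3_semidirect_Z4_def
proof (rule sd_iso[where a = "g [^] (2::int)" and t = t])
  show a: "g [^] (2::int) \<in> carrier G" "t \<in> carrier G" using g t by simp_all
  show "0 < (3::nat)" "0 < (4::nat)" by simp_all
  have id: "g [^] k = \<one> \<longleftrightarrow> 6 dvd k" for k :: int using int_pow_eq_id[OF g] ordg n6 by simp
  have p2: "(g [^] (2::int)) [^] k = g [^] (2 * k)" for k :: int by (rule int_pow_pow[OF g])
  have "(g [^] (2::int)) [^] (3::int) = \<one>" unfolding p2 id by simp
  then show "int (ord (g [^] (2::int))) dvd int 3" using int_pow_eq_id[OF a(1), of 3] by simp
  have t2: "t [^] (2::int) = g [^] (3::int)" using int_pow_two[OF t(1)] tt by simp
  have t2k: "t [^] (2 * k) = g [^] (3 * k)" for k :: int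
    using int_pow_pow[OF t(1), of 2 k] int_pow_pow[OF g, of 3 k] t2 by simp
  have "t [^] (4::int) = \<one>" using t2k[of 2] id[of 6] by simp
  then show "int (ord t) dvd int 4" using int_pow_eq_id[OF t(1), of 4] by simp
  show "t \<otimes> (g [^] (2::int)) [^] k = (g [^] (2::int)) [^] (- k) \<otimes> t" for k :: int
    unfolding p2 using actD[OF t(3), of "2 * k"] by simp
  let ?f = "\<lambda>(k::int, h::int). (g [^] (2::int)) [^] k \<otimes> t [^] h"
  have todd: "t [^] (2 * k + 1) = g [^] (3 * k) \<otimes> t" for k :: int
    using int_pow_mult[OF t(1), of "2 * k" 1] t2k[of k] t(1) by simp
  have fe: "?f (k, 2 * h) = g [^] (2 * k + 3 * h)" for k h :: int unfolding prod.case p2 t2k gadd ..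
  have fo: "?f (k, 2 * h + 1) = g [^] (2 * k + 3 * h) \<otimes> t" for k h :: int
    unfolding prod.case p2 todd using g t(1) by (simp add: m_assoc[symmetric] gadd)
  show "bij_betw ?f ({0..<int 3} \<times> {0..<int 4}) (carrier G)" unfolding bij_betw_def
  proof
    have h4: "\<exists>m. (m = 0 \<or> m = 1) \<and> (h = 2 * m \<or> h = 2 * m + 1)" if "h \<in> {0..<int 4}" for h
    proof -
      have "h = 0 \<or> h = 1 \<or> h = 2 \<or> h = 3" using that by auto
      then show ?thesis by (elim disjE) (auto intro: exI[of _ 0] exI[of _ 1])
    qed
    have inC: "g [^] a \<in> C" for a :: int using C_iff by blast
    show "inj_on ?f ({0..<int 3} \<times> {0..<int 4})"
    proof (rule inj_onI)
      fix x y assume "x \<in> {0..<int 3} \<times> {0..<int 4}" "y \<in> {0..<int 3} \<times> {0..<int 4}" and e: "?f x = ?f y"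
      then obtain k h k' h' where x: "x = (k, h)" "k \<in> {0..<int 3}" "h \<in> {0..<int 4}"
        and y: "y = (k', h')" "k' \<in> {0..<int 3}" "h' \<in> {0..<int 4}" by blast
      obtain m where m: "m = 0 \<or> m = 1" "h = 2 * m \<or> h = 2 * m + 1" using h4[OF x(3)] by blast
      obtain m' where m': "m' = 0 \<or> m' = 1" "h' = 2 * m' \<or> h' = 2 * m' + 1" using h4[OF y(3)] by blast
      have main: "k = k' \<and> m = m'" if "g [^] (2 * k + 3 * m) = g [^] (2 * k' + 3 * m')"
      proof -
        have d: "6 dvd 2 * k' + 3 * m' - (2 * k + 3 * m)" using that geq n6 by simp
        have kk: "k = 0 \<or> k = 1 \<or> k = 2" "k' = 0 \<or> k' = 1 \<or> k' = 2" using x(2) y(2) by auto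
        show ?thesis using d m(1) m'(1) kk by (elim disjE) simp_all
      qed
      have nC: "g [^] a \<otimes> t \<notin> C" for a :: int by (rule coset_disjoint[OF t(1,2)])
      from m(2) show "x = y"
      proof
        assume h: "h = 2 * m"
        from m'(2) show ?thesis
        proof
          assume h': "h' = 2 * m'"
          then show ?thesis using e main x(1) y(1) h unfolding x(1) y(1) h h' fe by simp
        next
          assume h': "h' = 2 * m' + 1"
          show ?thesis using e nC[of "2 * k' + 3 * m'"] inC[of "2 * k + 3 * m"] unfolding x(1) y(1) h h' fe fo by simp
        qed
      next
        assume h: "h = 2 * m + 1"
        from m'(2) show ?thesis
        proof
          assume h': "h' = 2 * m'"
          show ?thesis using e nC[of "2 * k + 3 * m"] inC[of "2 * k' + 3 * m'"] unfolding x(1) y(1) h h' fe fo by simp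
        next
          assume h': "h' = 2 * m' + 1"
          have "g [^] (2 * k + 3 * m) \<otimes> t = g [^] (2 * k' + 3 * m') \<otimes> t"
            using e unfolding x(1) y(1) h h' fo .
          then have "g [^] (2 * k + 3 * m) = g [^] (2 * k' + 3 * m')" using g t(1) by simp
          then show ?thesis using main x(1) y(1) h h' by simp
        qed
      qed
    qed
    show "?f ` ({0..<int 3} \<times> {0..<int 4}) = carrier G"
    proof
      show "?f ` ({0..<int 3} \<times> {0..<int 4}) \<subseteq> carrier G" using t(1) g by auto
      have rep: "\<exists>k\<in>{0..<int 3}. \<exists>m\<in>{0, 1}. g [^] i = g [^] (2 * k + 3 * m)" for i :: int
      proof -
        have "6 dvd 2 * (2 * i mod 3) + 3 * (i mod 2) - i" by (rule six_dvd_crt)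
        then have 1: "g [^] i = g [^] (2 * (2 * i mod 3) + 3 * (i mod 2))" by (simp only: geq n6 of_nat_numeral)
        have 2: "2 * i mod 3 \<in> {0..<int 3}" by simp
        have 3: "i mod 2 \<in> {0, 1}" by auto
        show ?thesis by (rule bexI[of _ "2 * i mod 3"], rule bexI[of _ "i mod 2"], fact 1, fact 3, fact 2)
      qed
      show "carrier G \<subseteq> ?f ` ({0..<int 3} \<times> {0..<int 4})"
      proof
        fix x assume x: "x \<in> carrier G"
        show "x \<in> ?f ` ({0..<int 3} \<times> {0..<int 4})"
        proof (cases "x \<in> C")
          case True
          then obtain i :: int where "x = g [^] i" using C_iff by blast
          moreover obtain k m where km: "k \<in> {0..<int 3}" "m \<in> {0, 1}" "g [^] i = g [^] (2 * k + 3 * m)"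
            using rep[of i] by blast
          ultimately have xt: "x = g [^] (2 * k + 3 * m)" by simp
          have "x = ?f (k, 2 * m)" unfolding fe by (rule xt)
          moreover have "(k, 2 * m) \<in> {0..<int 3} \<times> {0..<int 4}" using km by auto
          ultimately show ?thesis by (rule image_eqI)
        next
          case False
          then obtain i :: int where "x = g [^] i \<otimes> t" using split_coset[OF t(1,3) x cov[OF x]] by blast
          moreover obtain k m where km: "k \<in> {0..<int 3}" "m \<in> {0, 1}" "g [^] i = g [^] (2 * k + 3 * m)"
            using rep[of i] by blast
          ultimately have xt: "x = g [^] (2 * k + 3 * m) \<otimes> t" by simp
          have "x = ?f (k, 2 * m + 1)" unfolding fo by (rule xt)
          moreover have "(k, 2 * m + 1) \<in> {0..<int 3} \<times> {0..<int 4}" using km by auto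
          ultimately show ?thesis by (rule image_eqI)
        qed
      qed
    qed
  qed
qed

lemma act_cong: "act t j \<Longrightarrow> int n dvd j - j' \<Longrightarrow> act t j'"
proof -
  assume a: "act t j" and d: "int n dvd j - j'"
  have "g [^] (j' * k) = g [^] (j * k)" for k :: int
    unfolding geq using dvd_mult2[OF d, of k] by (simp add: left_diff_distrib)
  then show ?thesis using a unfolding act_def by simp
qed

text \<open>The units modulo 6 are 1 and -1, and \<open>centralizer\<close> excludes 1 outside
  \<open>C\<close>. So every outer element inverts \<open>g\<close>, and the square of one of them
  is 1 or g^3, which separates the dihedral from the dicyclic group.\<close>

lemma order6_case:
  assumes n6: "n = 6"
  shows "G \<cong> integer_mod_group 6 \<or> G \<cong> dihedral_group 6 \<or> G \<cong> Z3_semidirect_Z4"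
proof (cases "carrier G = C")
  case True
  then show ?thesis using cyclic_case n6 by simp
next
  case False
  have cov: "act x (- 1)" if x: "x \<in> carrier G" "x \<notin> C" for x
  proof -
    obtain j where j: "act x j" using act_exists[OF x(1)] by blast
    have "\<not> 6 dvd j * 2" "\<not> 6 dvd j * 3" "\<not> 6 dvd j - 1"
      using act_coprime[OF j x(1), of 2] act_coprime[OF j x(1), of 3] centralizer[OF x(1) j] x(2) n6 by auto
    then have "int n dvd j - (- 1)" unfolding n6 by simp presburger
    then show ?thesis by (rule act_cong[OF j])
  qed
  have "C \<subseteq> carrier G" using g by (simp add: generate_incl)
  then obtain t where t: "t \<in> carrier G" "t \<notin> C" using False by blast
  obtain b :: int where b: "t \<otimes> t = g [^] b" "int n dvd 2 * b" using sq_C[OF t(1) cov[OF t]] by blast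
  have "6 dvd b \<or> 6 dvd 3 - b" using b(2) unfolding n6 by simp presburger
  then have "t \<otimes> t = \<one> \<or> t \<otimes> t = g [^] (3::int)"
    unfolding b(1) using geq[of b 3] int_pow_eq_id[OF g, of b] ordg n6 by auto
  then show ?thesis
    using dihedral_case[OF t cov[OF t] _ cov] dicyclic_case[OF t cov[OF t] _ n6 cov] n6 by blast
qed

end

context big_cyclic
begin

lemma int_pow_mod4: "t \<in> carrier G \<Longrightarrow> t [^] (4::int) = \<one> \<Longrightarrow> t [^] (m mod 4) = t [^] (m::int)"
proof -
  assume t: "t \<in> carrier G" "t [^] (4::int) = \<one>"
  have "int (ord t) dvd 4" using int_pow_eq_id[OF t(1), of 4] t(2) by simp
  then show ?thesis unfolding int_pow_eq[OF t(1)] by (rule dvd_trans) (rule dvd_minus_mod)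
qed

text \<open>2 generates the units modulo 5. The fourth power of \<open>t\<close> lies in
  \<open>C\<close> and is fixed by an automorphism that doubles exponents, so it is 1, and
  \<open>t\<close> generates the complement. Since 1 - j is a unit whenever t^m is nontrivial and
  acts as j, conjugating t^m by powers of \<open>g\<close> reaches the whole coset of t^m; this
  yields both the Frobenius condition and the kernel.\<close>

lemma frobenius_case:
  assumes n5: "n = 5" and t: "t \<in> carrier G" "act t 2"
    and cov: "\<And>x. x \<in> carrier G \<Longrightarrow> \<exists>j. act x j \<and> \<not> 5 dvd j"
  shows "is_frobenius_product G (integer_mod_group 5) (integer_mod_group 4)"
proof -
  have id: "g [^] k = \<one> \<longleftrightarrow> 5 dvd k" for k :: int using int_pow_eq_id[OF g] ordg n5 by simp
  have geq5: "g [^] a = g [^] b \<longleftrightarrow> 5 dvd b - a" for a b :: int using geq n5 by simp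
  have CG: "C \<subseteq> carrier G" using g by (simp add: generate_incl)
  have act1: "act \<one> 1" unfolding act_def using g by simp
  have actC: "5 dvd j - 1" if xC: "x \<in> C" and xj: "act x j" for x j
  proof -
    obtain a :: int where a: "x = g [^] a" using xC C_iff by blast
    have "g [^] j \<otimes> x = x \<otimes> g [^] (1::int)" using actD[OF xj, of 1, symmetric] unfolding mult_1_right .
    then have "g [^] (j + a) = g [^] (a + 1)" unfolding a gadd .
    then have "5 dvd a + 1 - (j + a)" unfolding geq5 .
    moreover have "a + 1 - (j + a) = - (j - 1)" by simp
    ultimately have "5 dvd - (j - 1)" by (simp only:)
    then show ?thesis by (simp only: dvd_minus_iff)
  qed
  have tn: "act (t [^] m) (2 ^ m)" for m :: nat
  proof (induction m)
    case (Suc m)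
    have "act (t [^] m \<otimes> t) (2 ^ m * 2)" by (rule act_mult[OF Suc t(2)]) (use t in simp_all)
    then show ?case by (simp add: mult.commute)
  qed (use act1 in simp)
  have t4C: "t [^] (4::nat) \<in> C" by (rule centralizer[OF _ tn[of 4]]) (use t n5 in simp_all)
  then obtain b :: int where b: "t [^] (4::nat) = g [^] b" using C_iff by blast
  have "t \<otimes> t [^] (4::nat) = t [^] (4::nat) \<otimes> t"
    using nat_pow_Suc2[OF t(1), of 4, symmetric] unfolding nat_pow_Suc .
  then have "g [^] (2 * b) \<otimes> t = g [^] b \<otimes> t" unfolding b actD[OF t(2)] .
  then have "g [^] (2 * b) = g [^] b" using g t(1) by simp
  then have "5 dvd b - 2 * b" unfolding geq5 .
  moreover have "b - 2 * b = - b" by simp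
  ultimately have "5 dvd - b" by (simp only:)
  then have t4n: "t [^] (4::nat) = \<one>" unfolding b id by (simp only: dvd_minus_iff)
  then have t4: "t [^] (4::int) = \<one>" using int_pow_int[of G t 4] by simp
  have tmod: "t [^] (m mod 4) = t [^] m" for m :: int by (rule int_pow_mod4[OF t(1) t4])
  have cases4: "m mod 4 = 0 \<or> m mod 4 = 1 \<or> m mod 4 = 2 \<or> m mod 4 = 3" for m :: int by presburger
  \<comment> \<open>\<open>j\<close> is 2 to the power m mod 4, not reduced modulo 5, hence the
    value 8.\<close>
  have actm: "\<exists>j. act (t [^] m) j \<and> (m mod 4 = 0 \<and> j = 1 \<or> m mod 4 = 1 \<and> j = 2 \<or> m mod 4 = 2 \<and> j = 4 \<or> m mod 4 = 3 \<and> j = 8)"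
    for m :: int
  proof -
    have e: "t [^] m = t [^] nat (m mod 4)" using tmod[of m] int_pow_int[of G t "nat (m mod 4)"] by simp
    have "act (t [^] m) (2 ^ nat (m mod 4))" unfolding e by (rule tn)
    then show ?thesis using cases4[of m] by (elim disjE) (intro exI conjI, assumption, simp)+
  qed
  have tC: "t [^] m \<in> C \<longleftrightarrow> m mod 4 = 0" for m :: int
  proof
    assume c: "t [^] m \<in> C"
    obtain j where j: "act (t [^] m) j" "m mod 4 = 0 \<and> j = 1 \<or> m mod 4 = 1 \<and> j = 2 \<or> m mod 4 = 2 \<and> j = 4 \<or> m mod 4 = 3 \<and> j = 8"
      using actm by blast
    have "5 dvd j - 1" by (rule actC[OF c j(1)])
    then show "m mod 4 = 0" using j(2) by (elim disjE conjE) simp_all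
  next
    assume "m mod 4 = 0"
    then have "t [^] m = \<one>" using tmod[of m] by simp
    then show "t [^] m \<in> C" using C_iff by (metis int_pow_0)
  qed
  have tone: "t [^] m = \<one> \<longleftrightarrow> m mod 4 = 0" for m :: int
    using tC[of m] tmod[of m] C_iff[of \<one>] by (metis int_pow_0)
  have ordt: "ord t = 4"
  proof -
    have "int (ord t) dvd m \<longleftrightarrow> 4 dvd m" for m :: int
      using tone[of m] int_pow_eq_id[OF t(1), of m] by (simp add: dvd_eq_mod_eq_0)
    from this[of 4] this[of "int (ord t)"] have "int (ord t) dvd int 4" "int 4 dvd int (ord t)" by simp_all
    then show ?thesis unfolding int_dvd_int_iff by (rule dvd_antisym)
  qed
  let ?H = "generate G {t}"
  have H_iff: "x \<in> ?H \<longleftrightarrow> (\<exists>k::int. x = t [^] k)" for x unfolding generate_pow[OF t(1)] by simp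
  have HG: "?H \<subseteq> carrier G" using t by (simp add: generate_incl)
  have Hs: "subgroup ?H G" and Cs: "subgroup C G" using t g by (simp_all add: generate_is_subgroup)
  \<comment> \<open>The values -1, 3 and 2 invert 1 - j = -1, -3 and -7 modulo 5.\<close>
  have inverse: "\<exists>u. 5 dvd (1 - j) * u - 1" if "m mod 4 = 1 \<and> j = 2 \<or> m mod 4 = 2 \<and> j = 4 \<or> m mod 4 = 3 \<and> j = 8" for m j :: int
    using that by (elim disjE conjE) (rule exI[of _ "-1"], simp, rule exI[of _ 3], simp, rule exI[of _ 2], simp)
  \<comment> \<open>Some power of \<open>t\<close> undoes the action of \<open>x\<close>; the
    product then centralizes \<open>g\<close> and lies in \<open>C\<close>.\<close>
  have decomp: "\<exists>k::int. \<exists>m::int. x = g [^] k \<otimes> t [^] m" if x: "x \<in> carrier G" for x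
  proof -
    obtain j where j: "act x j" "\<not> 5 dvd j" using cov[OF x] by blast
    have "j mod 5 = 1 \<or> j mod 5 = 2 \<or> j mod 5 = 3 \<or> j mod 5 = 4" using j(2) by presburger
    then obtain m :: nat where m: "5 dvd j * 2 ^ m - 1"
    proof (elim disjE)
      assume "j mod 5 = 1" then have "5 dvd j * 2 ^ 0 - 1" by simp presburger
      then show ?thesis by (rule that)
    next
      assume "j mod 5 = 2" then have "5 dvd j * 2 ^ 3 - 1" by simp presburger
      then show ?thesis by (rule that)
    next
      assume "j mod 5 = 3" then have "5 dvd j * 2 ^ 1 - 1" by simp presburger
      then show ?thesis by (rule that)
    next
      assume "j mod 5 = 4" then have "5 dvd j * 2 ^ 2 - 1" by simp presburger
      then show ?thesis by (rule that)
    qed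
    have "x \<otimes> t [^] m \<in> C" by (rule centralizer[OF _ act_mult[OF j(1) tn[of m]]]) (use x t m n5 in simp_all)
    then obtain a :: int where a: "x \<otimes> t [^] m = g [^] a" using C_iff by blast
    have "x = (x \<otimes> t [^] int m) \<otimes> t [^] (- int m)"
      using x t(1) by (simp add: m_assoc int_pow_mult[OF t(1), symmetric])
    then have "x = g [^] a \<otimes> t [^] (- int m)" using a by (simp add: int_pow_int)
    then show ?thesis by blast
  qed
  have conj: "g [^] k \<otimes> t [^] m \<otimes> g [^] (- k) = g [^] ((1 - j) * k) \<otimes> t [^] m" if "act (t [^] m) j" for k m j :: int
  proof -
    have "g [^] k \<otimes> t [^] m \<otimes> g [^] (- k) = g [^] k \<otimes> (t [^] m \<otimes> g [^] (- k))" using g t(1) by (simp add: m_assoc)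
    also have "\<dots> = g [^] k \<otimes> (g [^] (j * (- k)) \<otimes> t [^] m)" unfolding actD[OF that] ..
    also have "\<dots> = g [^] (k + j * (- k)) \<otimes> t [^] m" using g t(1) by (simp add: m_assoc[symmetric] gadd)
    finally show ?thesis by (simp add: algebra_simps)
  qed
  have inv_decomp: "inv (g [^] k \<otimes> t [^] i) = t [^] (- i) \<otimes> g [^] (- k)" for k i :: int
    using g t(1) by (simp add: inv_mult_group int_pow_neg)
  have conj2: "(g [^] k \<otimes> t [^] i) \<otimes> t [^] m \<otimes> inv (g [^] k \<otimes> t [^] i) = g [^] k \<otimes> t [^] m \<otimes> g [^] (- k)" for k i m :: int
  proof -
    have "(g [^] k \<otimes> t [^] i) \<otimes> t [^] m \<otimes> (t [^] (- i) \<otimes> g [^] (- k)) = g [^] k \<otimes> (t [^] i \<otimes> t [^] m \<otimes> t [^] (- i)) \<otimes> g [^] (- k)"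
      using g t(1) by (simp add: m_assoc)
    also have "t [^] i \<otimes> t [^] m \<otimes> t [^] (- i) = t [^] m" using int_pow_mult[OF t(1), of "i + m" "- i"] int_pow_mult[OF t(1), of i m] by simp
    finally show ?thesis unfolding inv_decomp .
  qed
  have g1H: "g \<notin> ?H"
  proof
    assume "g \<in> ?H"
    then obtain k :: int where k: "g = t [^] k" using H_iff by blast
    have "g \<in> C" using C_iff by (metis g int_pow_1)
    then have "k mod 4 = 0" using tC k by blast
    then have "g = \<one>" unfolding k tone .
    then show False using ordg n5 by simp
  qed
  have "frobenius_group G C ?H" unfolding frobenius_group_def
  proof (intro conjI ballI)
    show "group G" by (rule is_group)
    show "subgroup ?H G" by (rule Hs)
    have "t \<in> ?H" "t \<noteq> \<one>" using generate.incl[of t "{t}" G] tone[of 1] t(1) by auto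
    then show "?H \<noteq> {\<one>}" by blast
    show "?H \<noteq> carrier G" using g1H g by blast
    fix y assume y: "y \<in> carrier G - ?H"
    then obtain k i :: int where ki: "y = g [^] k \<otimes> t [^] i" using decomp by blast
    \<comment> \<open>A common element t^l = y t^m y^-1 forces 5 to divide (1 - j) k. If t^m is
      nontrivial, 5 divides k, and \<open>y\<close> would lie in the complement.\<close>
    have "x = \<one>" if x: "x \<in> ?H" "x = y \<otimes> h \<otimes> inv y" "h \<in> ?H" for x h
    proof -
      obtain m :: int where m: "h = t [^] m" using x(3) H_iff by blast
      obtain l :: int where l: "x = t [^] l" using x(1) H_iff by blast
      obtain j where j: "act (t [^] m) j" "m mod 4 = 0 \<and> j = 1 \<or> m mod 4 = 1 \<and> j = 2 \<or> m mod 4 = 2 \<and> j = 4 \<or> m mod 4 = 3 \<and> j = 8"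
        using actm by blast
      have e: "t [^] l = g [^] ((1 - j) * k) \<otimes> t [^] m" using x(2) unfolding l m ki conj2 conj[OF j(1)] .
      then have "t [^] l \<otimes> t [^] (- m) = g [^] ((1 - j) * k)"
        using g t(1) by (simp add: m_assoc int_pow_mult[OF t(1), symmetric])
      then have e2: "t [^] (l - m) = g [^] ((1 - j) * k)" using int_pow_mult[OF t(1), of l "- m"] by simp
      then have "t [^] (l - m) \<in> C" using C_iff by blast
      then have "t [^] (l - m) = \<one>" using tC tone by blast
      then have d: "5 dvd (1 - j) * k" using e2 id by simp
      show "x = \<one>"
      proof (cases "m mod 4 = 0")
        case True
        then have "h = \<one>" unfolding m tone .
        then show ?thesis using x(2) y by simp
      next
        case False
        then obtain u where u: "5 dvd (1 - j) * u - 1" using inverse[of m j] j(2) by blast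
        have "5 dvd ((1 - j) * u - 1) * k" "5 dvd u * ((1 - j) * k)" using u d by (simp_all only: dvd_mult2 dvd_mult)
        then have "5 dvd u * ((1 - j) * k) - ((1 - j) * u - 1) * k" by (rule dvd_diff[rotated])
        then have "5 dvd k" by (simp add: algebra_simps)
        then have "g [^] k = \<one>" using id by blast
        then have "y = t [^] i" using ki t(1) by simp
        then show ?thesis using y H_iff by blast
      qed
    qed
    moreover have "\<one> \<in> ?H" by (rule subgroup.one_closed[OF Hs])
    moreover have "\<one> = y \<otimes> \<one> \<otimes> inv y" using y by simp
    ultimately show "?H \<inter> (\<lambda>h. y \<otimes> h \<otimes> inv y) ` ?H = {\<one>}" by blast
  next
    show "C = insert \<one> (carrier G - (\<Union>y\<in>carrier G. (\<lambda>h. y \<otimes> h \<otimes> inv y) ` ?H))"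
    proof (intro equalityI subsetI)
      fix x assume x: "x \<in> C"
      show "x \<in> insert \<one> (carrier G - (\<Union>y\<in>carrier G. (\<lambda>h. y \<otimes> h \<otimes> inv y) ` ?H))"
      proof (rule ccontr)
        assume "\<not> ?thesis"
        then have x1: "x \<noteq> \<one>" and "x \<in> (\<Union>y\<in>carrier G. (\<lambda>h. y \<otimes> h \<otimes> inv y) ` ?H)" using x CG by blast+
        then obtain y h where y: "y \<in> carrier G" "h \<in> ?H" "x = y \<otimes> h \<otimes> inv y" by blast
        obtain k i :: int where ki: "y = g [^] k \<otimes> t [^] i" using decomp[OF y(1)] by blast
        obtain m :: int where m: "h = t [^] m" using y(2) H_iff by blast
        obtain j where j: "act (t [^] m) j" using actm by blast
        have e: "x = g [^] ((1 - j) * k) \<otimes> t [^] m" using y(3) unfolding m ki conj2 conj[OF j] .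
        obtain a :: int where a: "x = g [^] a" using x C_iff by blast
        have "t [^] m = g [^] (- ((1 - j) * k)) \<otimes> (g [^] ((1 - j) * k) \<otimes> t [^] m)"
          using g t(1) by (simp add: m_assoc[symmetric] gadd)
        also have "\<dots> = g [^] (- ((1 - j) * k) + a)" unfolding e[symmetric] a gadd ..
        finally have "t [^] m \<in> C" using C_iff by blast
        then have "h = \<one>" using tC tone m by blast
        then show False using y x1 by simp
      qed
    next
      fix x assume x: "x \<in> insert \<one> (carrier G - (\<Union>y\<in>carrier G. (\<lambda>h. y \<otimes> h \<otimes> inv y) ` ?H))"
      show "x \<in> C"
      proof (rule ccontr)
        assume nC: "x \<notin> C"
        have "\<one> \<in> C" by (rule subgroup.one_closed[OF Cs])
        then have xc: "x \<in> carrier G" "x \<notin> (\<Union>y\<in>carrier G. (\<lambda>h. y \<otimes> h \<otimes> inv y) ` ?H)" using x nC by auto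
        obtain k m :: int where km: "x = g [^] k \<otimes> t [^] m" using decomp[OF xc(1)] by blast
        obtain j where j: "act (t [^] m) j" "m mod 4 = 0 \<and> j = 1 \<or> m mod 4 = 1 \<and> j = 2 \<or> m mod 4 = 2 \<and> j = 4 \<or> m mod 4 = 3 \<and> j = 8"
          using actm by blast
        have "m mod 4 \<noteq> 0"
        proof
          assume "m mod 4 = 0"
          then have "t [^] m = \<one>" unfolding tone .
          then have "x = g [^] k" using km g by simp
          then show False using nC C_iff by blast
        qed
        then obtain u where u: "5 dvd (1 - j) * u - 1" using inverse[of m j] j(2) by blast
        have "5 dvd k * ((1 - j) * u - 1)" using u by (simp only: dvd_mult)
        then have "5 dvd (1 - j) * (u * k) - k" by (simp add: algebra_simps)
        \<comment> \<open>Modulo 5, k is (1 - j) u k, which exhibits \<open>x\<close> as the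
          conjugate of t^m by g^(u k).\<close>
        then have e5: "g [^] k = g [^] ((1 - j) * (u * k))" unfolding geq5 .
        have "x = g [^] (u * k) \<otimes> t [^] m \<otimes> g [^] (- (u * k))"
          unfolding conj[OF j(1)] by (rule km[unfolded e5])
        then have "x = g [^] (u * k) \<otimes> t [^] m \<otimes> inv (g [^] (u * k))" unfolding int_pow_neg[OF g] .
        moreover have "t [^] m \<in> ?H" using H_iff by blast
        moreover have "g [^] (u * k) \<in> carrier G" using g by simp
        ultimately show False using xc(2) by blast
      qed
    qed
  qed
  moreover have "G\<lparr>carrier := C\<rparr> \<cong> integer_mod_group 5" using cyclic_iso[OF g ordg] n5 by simp
  moreover have "G\<lparr>carrier := ?H\<rparr> \<cong> integer_mod_group 4" using cyclic_iso[OF t(1) ordt] by simp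
  ultimately show ?thesis unfolding is_frobenius_product_def using Cs by blast
qed

text \<open>The units 2 and 3 modulo 5 are generators. Either some element acts by one of them, the
  Frobenius case, or all elements outside \<open>C\<close> invert \<open>g\<close>.\<close>

lemma order5_case:
  assumes n5: "n = 5"
  shows "G \<cong> integer_mod_group 5 \<or> G \<cong> dihedral_group 5 \<or>
    is_frobenius_product G (integer_mod_group 5) (integer_mod_group 4)"
proof (cases "\<exists>t\<in>carrier G. \<exists>j. act t j \<and> (j mod 5 = 2 \<or> j mod 5 = 3)")
  case True
  then obtain t j where t: "t \<in> carrier G" "act t j" "j mod 5 = 2 \<or> j mod 5 = 3" by blast
  have cov: "\<exists>j. act x j \<and> \<not> 5 dvd j" if x: "x \<in> carrier G" for x
  proof -
    obtain j where j: "act x j" using act_exists[OF x] by blast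
    have "\<not> 5 dvd j" using act_coprime[OF j x, of 1] n5 by auto
    then show ?thesis using j by blast
  qed
  obtain u where u: "u \<in> carrier G" "act u 2"
  proof (cases "j mod 5 = 2")
    case True
    then have "int n dvd j - 2" unfolding n5 by simp presburger
    then show ?thesis by (rule that[OF t(1) act_cong[OF t(2)]])
  next
    case False
    \<comment> \<open>3^3 is 2 modulo 5, so the cube of \<open>t\<close> acts as 2.\<close>
    then have "j mod 5 = 3" using t(3) by blast
    then have "j * j mod 5 = 4" using mod_mult_eq[of j 5 j] by simp
    then have "int n dvd j * j - 4" unfolding n5 using mod_eq_dvd_iff[of "j * j" 5 4] by simp
    moreover have "int n dvd 4 * j - 2" unfolding n5 using \<open>j mod 5 = 3\<close> by simp presburger
    ultimately have "int n dvd j * j - 4" "int n dvd 4 * j - 2" by blast+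
    then have "act (t \<otimes> t) 4" by (intro act_cong[OF act_mult[OF t(2) t(2) t(1) t(1)]])
    then have "act (t \<otimes> t \<otimes> t) (4 * j)" by (rule act_mult[OF _ t(2)]) (use t(1) in simp_all)
    then have "act (t \<otimes> t \<otimes> t) 2" by (rule act_cong[OF _ \<open>int n dvd 4 * j - 2\<close>])
    then show ?thesis by (rule that[rotated]) (use t(1) in simp)
  qed
  show ?thesis using frobenius_case[OF n5 u cov] by blast
next
  case none: False
  show ?thesis
  proof (cases "carrier G = C")
    case True
    then show ?thesis using cyclic_case n5 by simp
  next
    case False
    have cov: "act x (- 1)" if x: "x \<in> carrier G" "x \<notin> C" for x
    proof -
      obtain j where j: "act x j" using act_exists[OF x(1)] by blast
      have "\<not> 5 dvd j" "\<not> 5 dvd j - 1" "\<not> (j mod 5 = 2 \<or> j mod 5 = 3)"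
        using act_coprime[OF j x(1), of 1] centralizer[OF x(1) j] x n5 none j by auto
      then have "int n dvd j - (- 1)" unfolding n5 by simp presburger
      then show ?thesis by (rule act_cong[OF j])
    qed
    have "C \<subseteq> carrier G" using g by (simp add: generate_incl)
    then obtain t where t: "t \<in> carrier G" "t \<notin> C" using False by blast
    obtain b :: int where b: "t \<otimes> t = g [^] b" "int n dvd 2 * b" using sq_C[OF t(1) cov[OF t]] by blast
    have "5 dvd b" using b(2) unfolding n5 by simp presburger
    then have "t \<otimes> t = \<one>" unfolding b(1) using int_pow_eq_id[OF g, of b] ordg n5 by simp
    then show ?thesis using dihedral_case[OF t cov[OF t] _ cov] n5 by blast
  qed
qed

end

theorem has_big_cyclic_iff:
  fixes G :: "('a, 'b) monoid_scheme"
  assumes "group G" "finite (carrier G)"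
  shows "has_big_cyclic G \<longleftrightarrow>
           G \<cong> integer_mod_group 5 \<or> G \<cong> integer_mod_group 6 \<or> G \<cong> dihedral_group 5 \<or> G \<cong> dihedral_group 6 \<or>
           G \<cong> Z3_semidirect_Z4 \<or> is_frobenius_product G (integer_mod_group 5) (integer_mod_group 4)"
proof
  interpret group G by fact
  assume "has_big_cyclic G"
  then obtain g where hg: "g \<in> carrier G" "ord g = 5 \<or> ord g = 6" "\<forall>x\<in>carrier G. x \<notin> generate G {g} \<longrightarrow> ord x \<le> 4"
    unfolding has_big_cyclic_def by blast
  interpret big_cyclic G g "ord g"
    by (rule big_cyclic.intro[OF is_group big_cyclic_axioms.intro]) (use assms(2) hg in simp_all)
  show "G \<cong> integer_mod_group 5 \<or> G \<cong> integer_mod_group 6 \<or> G \<cong> dihedral_group 5 \<or> G \<cong> dihedral_group 6 \<or>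
           G \<cong> Z3_semidirect_Z4 \<or> is_frobenius_product G (integer_mod_group 5) (integer_mod_group 4)"
    using order5_case order6_case hg(2) by blast
next
  interpret group G by fact
  assume "G \<cong> integer_mod_group 5 \<or> G \<cong> integer_mod_group 6 \<or> G \<cong> dihedral_group 5 \<or> G \<cong> dihedral_group 6 \<or>
           G \<cong> Z3_semidirect_Z4 \<or> is_frobenius_product G (integer_mod_group 5) (integer_mod_group 4)"
  then show "has_big_cyclic G"
    using has_big_cyclic_Zn has_big_cyclic_dihedral has_big_cyclic_dicyclic has_big_cyclic_frobenius by blast
qed

section \<open>Crosscap number one, and obstructions in power graphs\<close>

text \<open>The infimum of a nonempty set of naturals is attained, so it is 1 exactly if 1 occurs
  and 0 does not; surfaces beyond the projective plane never enter.\<close>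

lemma projective_graph_iff:
  "projective_graph \<Gamma> \<longleftrightarrow>
     (\<exists>S. real_projective_plane S \<and> graph_embeds_in \<Gamma> (S :: (real^4) topology)) \<and>
     \<not> (\<exists>S :: (real^4) topology. S homeomorphic_space top_of_set (sphere (0 :: real^3) 1) \<and> graph_embeds_in \<Gamma> S)"
proof -
  define A where "A = {enat k | k. \<exists>S. nonorientable_surface k S \<and> graph_embeds_in \<Gamma> S}"
  have "Inf A = 1 \<longleftrightarrow> 1 \<in> A \<and> 0 \<notin> A"
  proof
    assume 1: "Inf A = 1"
    then have ne: "A \<noteq> {}" by (auto simp: Inf_enat_def)
    then have "Inf A = (LEAST x. x \<in> A)" by (simp add: Inf_enat_def)
    then have "Inf A \<in> A" using ne by (metis LeastI_ex ex_in_conv)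
    moreover have "0 \<notin> A" using Inf_lower[of 0 A] 1 by auto
    ultimately show "1 \<in> A \<and> 0 \<notin> A" using 1 by simp
  next
    assume a: "1 \<in> A \<and> 0 \<notin> A"
    have "1 \<le> x" if "x \<in> A" for x using a that by (metis i0_lb ile_eSuc one_eSuc ileI1 order_le_less)
    then have "1 \<le> Inf A" by (rule Inf_greatest)
    moreover have "Inf A \<le> 1" using a by (intro Inf_lower) simp
    ultimately show "Inf A = 1" by (rule antisym[rotated])
  qed
  moreover have "0 \<in> A \<longleftrightarrow> (\<exists>S. nonorientable_surface 0 S \<and> graph_embeds_in \<Gamma> S)"
    unfolding A_def by (auto simp: zero_enat_def)
  moreover have "1 \<in> A \<longleftrightarrow> (\<exists>S. nonorientable_surface (Suc 0) S \<and> graph_embeds_in \<Gamma> S)"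
    unfolding A_def by (auto simp: one_enat_def)
  ultimately show ?thesis
    unfolding projective_graph_def crosscap_number_def A_def[symmetric] by simp
qed

definition linked :: "('a, 'b) monoid_scheme \<Rightarrow> 'a \<Rightarrow> 'a \<Rightarrow> bool" where
  "linked G x y \<longleftrightarrow> x \<in> generate G {y} \<or> y \<in> generate G {x}"

abbreviation "power_edges G \<equiv> snd (power_graph G)"

lemma power_edge_iff:
  "e \<in> power_edges G \<longleftrightarrow> (\<exists>x y. e = {x, y} \<and> x \<in> carrier G \<and> y \<in> carrier G \<and> x \<noteq> y \<and> linked G x y)"
  unfolding power_graph_def linked_def by auto

lemma power_graph_eq: "power_graph G = (carrier G, power_edges G)"
  by (simp add: power_graph_def)

context group
begin

lemma linked_one: "x \<in> carrier G \<Longrightarrow> linked G \<one> x"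
  unfolding linked_def by (simp add: generate.one)

text \<open>Adjacency is read off from integer exponents alone, whatever the order of
  \<open>g\<close>; the order only decides which powers are distinct.\<close>

lemma linked_pow:
  assumes "g \<in> carrier G" "a dvd b \<or> b dvd a" shows "linked G (g [^] (a::int)) (g [^] (b::int))"
proof -
  have *: "g [^] (a * k) \<in> generate G {g [^] a}" for a k :: int
  proof -
    have "g [^] (a * k) = (g [^] a) [^] k" using int_pow_pow[OF assms(1), of a k] by (rule sym)
    then show ?thesis unfolding generate_pow[OF int_pow_closed[OF assms(1)]] by blast
  qed
  from assms(2) show ?thesis
  proof
    assume "a dvd b" then obtain k where "b = a * k" by blast
    then show ?thesis unfolding linked_def using * by blast
  next
    assume "b dvd a" then obtain k where "a = b * k" by blast
    then show ?thesis unfolding linked_def using * by blast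
  qed
qed

lemma power_graph_vertices:
  assumes d: "distinct xs" "length xs = n" "set xs \<subseteq> carrier G"
  shows "inj_on (\<lambda>i. xs ! i) {..<n}" "(\<lambda>i. xs ! i) ` {..<n} \<subseteq> carrier G"
    "\<And>i j. i < j \<Longrightarrow> j < n \<Longrightarrow> linked G (xs ! i) (xs ! j) \<Longrightarrow> {xs ! i, xs ! j} \<in> power_edges G"
proof -
  show "inj_on (\<lambda>i. xs ! i) {..<n}" using d by (intro inj_on_nth) auto
  show "(\<lambda>i. xs ! i) ` {..<n} \<subseteq> carrier G" using d by auto
  fix i j assume ij: "i < j" "j < n" "linked G (xs ! i) (xs ! j)"
  have "xs ! i \<noteq> xs ! j" using nth_eq_iff_index_eq[OF d(1), of i j] ij d(2) by simp
  moreover have "xs ! i \<in> carrier G" "xs ! j \<in> carrier G" using ij d(2,3) by (metis less_trans nth_mem subsetD)+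
  ultimately show "{xs ! i, xs ! j} \<in> power_edges G" unfolding power_edge_iff using ij(3) by blast
qed

lemma projective_no_K7_minus_C4:
  fixes S :: "(real^4) topology"
  assumes S: "real_projective_plane S" "graph_embeds_in (power_graph G) S"
    and d: "distinct [\<one>, x1, x2, x3, x4, x5, x6]" "set [x1, x2, x3, x4, x5, x6] \<subseteq> carrier G"
    and l: "linked G x1 x2" "linked G x1 x3" "linked G x1 x4" "linked G x1 x5" "linked G x1 x6"
      "linked G x2 x3" "linked G x2 x4" "linked G x2 x5" "linked G x2 x6" "linked G x3 x4" "linked G x5 x6"
  shows False
proof -
  define xs where "xs = [\<one>, x1, x2, x3, x4, x5, x6]"
  have xs: "distinct xs" "length xs = 7" "set xs \<subseteq> carrier G" using d by (simp_all add: xs_def)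
  note V = power_graph_vertices[OF xs]
  have L: "linked G (xs ! i) (xs ! j)" if "i < j" "j < 7" "\<not> (i \<in> {3, 4} \<and> j \<in> {5, 6})" for i j
  proof -
    have "i = 0 \<or> i = 1 \<or> i = 2 \<or> i = 3 \<or> i = 4 \<or> i = 5" using that by linarith
    moreover have "j = 1 \<or> j = 2 \<or> j = 3 \<or> j = 4 \<or> j = 5 \<or> j = 6" using that by linarith
    ultimately show ?thesis using that l linked_one d(2)
      by (elim disjE) (simp_all add: xs_def)
  qed
  have E: "{xs ! i, xs ! j} \<in> power_edges G" if "i < j" "j < 7" "\<not> (i \<in> {3, 4} \<and> j \<in> {5, 6})" for i j
    using V(3)[OF that(1,2) L[OF that]] .
  have star: "{xs ! 0, xs ! j} \<in> power_edges G" if "0 < j" "j < 7" for j by (rule E) (use that in simp_all)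
  have S2: "graph_embeds_in (carrier G, power_edges G) S" by (subst power_graph_eq[symmetric]) (rule S(2))
  have "2 \<le> (7::nat)" by simp
  note draw = projective_plane_drawing[OF S(1) S2 V(1,2) this star]
  show False
  proof (rule draw)
    fix p y e
    assume D: "projective_drawing 7 (\<lambda>i j. {xs ! i, xs ! j} \<in> power_edges G) p y e"
      "\<And>j. 0 < j \<Longrightarrow> j < 7 \<Longrightarrow> \<not> y 0 j"
    show False by (rule no_projective_drawing_K7_minus_C4[OF D E])
  qed
qed

lemma projective_no_two_K5:
  fixes S :: "(real^4) topology"
  assumes S: "real_projective_plane S" "graph_embeds_in (power_graph G) S"
    and d: "distinct [\<one>, x1, x2, x3, x4, x5, x6, x7, x8]" "set [x1, x2, x3, x4, x5, x6, x7, x8] \<subseteq> carrier G"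
    and l: "linked G x1 x2" "linked G x1 x3" "linked G x1 x4" "linked G x2 x3" "linked G x2 x4" "linked G x3 x4"
      "linked G x5 x6" "linked G x5 x7" "linked G x5 x8" "linked G x6 x7" "linked G x6 x8" "linked G x7 x8"
  shows False
proof -
  define xs where "xs = [\<one>, x1, x2, x3, x4, x5, x6, x7, x8]"
  have xs: "distinct xs" "length xs = 9" "set xs \<subseteq> carrier G" using d by (simp_all add: xs_def)
  note V = power_graph_vertices[OF xs]
  have L: "linked G (xs ! i) (xs ! j)" if "i < j" "j < 9" "i = 0 \<or> j \<le> 4 \<or> 5 \<le> i" for i j
  proof -
    have "i = 0 \<or> i = 1 \<or> i = 2 \<or> i = 3 \<or> i = 4 \<or> i = 5 \<or> i = 6 \<or> i = 7" using that by linarith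
    moreover have "j = 1 \<or> j = 2 \<or> j = 3 \<or> j = 4 \<or> j = 5 \<or> j = 6 \<or> j = 7 \<or> j = 8" using that by linarith
    ultimately show ?thesis using that l linked_one d(2)
      by (elim disjE) (simp_all add: xs_def)
  qed
  have E: "{xs ! i, xs ! j} \<in> power_edges G" if "i < j" "j < 9" "i = 0 \<or> j \<le> 4 \<or> 5 \<le> i" for i j
    using V(3)[OF that(1,2) L[OF that]] .
  have star: "{xs ! 0, xs ! j} \<in> power_edges G" if "0 < j" "j < 9" for j by (rule E) (use that in simp_all)
  have S2: "graph_embeds_in (carrier G, power_edges G) S" by (subst power_graph_eq[symmetric]) (rule S(2))
  have "2 \<le> (9::nat)" by simp
  note draw = projective_plane_drawing[OF S(1) S2 V(1,2) this star]
  show False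
  proof (rule draw)
    fix p y e
    assume D: "projective_drawing 9 (\<lambda>i j. {xs ! i, xs ! j} \<in> power_edges G) p y e"
      "\<And>j. 0 < j \<Longrightarrow> j < 9 \<Longrightarrow> \<not> y 0 j"
    show False by (rule no_projective_drawing_two_K5[OF D E])
  qed
qed

lemma int_dvd_small: "k \<noteq> 0 \<Longrightarrow> \<bar>k\<bar> < int n \<Longrightarrow> \<not> int n dvd k"
  using dvd_imp_le_int[of k "int n"] by auto

text \<open>The five exponents differ by at most 4, so their powers are distinct and form a
  K5.\<close>

lemma sphere_ord:
  fixes S :: "(real^4) topology"
  assumes S: "S homeomorphic_space top_of_set (sphere (0 :: real^3) 1)" "graph_embeds_in (power_graph G) S"
    and g: "g \<in> carrier G" "5 \<le> ord g"
  shows False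
proof -
  define xs where "xs = [g [^] (0::int), g [^] (1::int), g [^] (-1::int), g [^] (2::int), g [^] (-2::int)]"
  have D: "\<not> int (ord g) dvd k" if "k \<noteq> 0" "\<bar>k\<bar> < 5" for k using int_dvd_small[of k "ord g"] that g(2) by simp
  have xs: "distinct xs" "length xs = 5" "set xs \<subseteq> carrier G"
    unfolding xs_def using g by (simp_all add: int_pow_eq[OF g(1)] D del: int_pow_0 int_pow_1)
  note V = power_graph_vertices[OF xs]
  have L: "linked G (xs ! i) (xs ! j)" if "i < j" "j < 5" for i j
  proof -
    have "i = 0 \<or> i = 1 \<or> i = 2 \<or> i = 3" using that by linarith
    moreover have "j = 1 \<or> j = 2 \<or> j = 3 \<or> j = 4" using that by linarith
    ultimately show ?thesis using that
      by (elim disjE) (simp_all add: xs_def linked_pow[OF g(1)] del: int_pow_0 int_pow_1)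
  qed
  have E: "{xs ! i, xs ! j} \<in> power_edges G" if "i < j" "j < 5" for i j
    using V(3)[OF that L[OF that]] .
  have S2: "graph_embeds_in (carrier G, power_edges G) S" by (subst power_graph_eq[symmetric]) (rule S(2))
  have star: "{xs ! 0, xs ! j} \<in> power_edges G" if "0 < j" "j < 5" for j by (rule E) (use that in simp_all)
  have "2 \<le> (5::nat)" by simp
  note draw = sphere_drawing[OF S(1) S2 V(1,2) this star]
  show False
  proof (rule draw)
    fix p e
    assume D: "projective_drawing 5 (\<lambda>i j. {xs ! i, xs ! j} \<in> power_edges G) p (\<lambda>_ _. False) e"
    show False by (rule no_untwisted_drawing_K5[OF D _ E]) simp_all
  qed
qed

text \<open>The seven exponents differ by at most 6. Their order in the list puts 2, -2 and 3, -3 at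
  the positions 3, 4 and 5, 6 between which edges may be absent.\<close>

lemma projective_ord:
  fixes S :: "(real^4) topology"
  assumes S: "real_projective_plane S" "graph_embeds_in (power_graph G) S"
    and g: "g \<in> carrier G"
  shows "ord g \<le> 6"
proof (rule ccontr)
  assume "\<not> ord g \<le> 6"
  then have og: "ord g \<noteq> Suc 0" by simp
  have D: "\<not> int (ord g) dvd k" if "k \<noteq> 0" "\<bar>k\<bar> < 7" for k using \<open>\<not> ord g \<le> 6\<close> int_dvd_small[of k "ord g"] that by simp
  let ?p = "\<lambda>k::int. g [^] k"
  have "distinct [?p 0, ?p 1, ?p (-1), ?p 2, ?p (-2), ?p 3, ?p (-3)]"
    by (simp add: int_pow_eq[OF g] D og del: int_pow_0 int_pow_1)
  then have d: "distinct [\<one>, ?p 1, ?p (-1), ?p 2, ?p (-2), ?p 3, ?p (-3)]" by (simp only: int_pow_0)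
  show False
    by (rule projective_no_K7_minus_C4[OF S d])
       (use g in \<open>simp_all add: linked_pow[OF g] del: int_pow_0 int_pow_1\<close>)
qed

text \<open>If powers of \<open>g\<close> and \<open>h\<close> with exponents 1, -1, 2, -2 coincide,
  both orders are 6 and the two groups share their elements of order 3. These and the identity are
  adjacent to g, h and their inverses, which gives K7 minus a 4-cycle. Otherwise there are two K5's
  meeting only in the identity.\<close>

lemma projective_unique:
  fixes S :: "(real^4) topology"
  assumes S: "real_projective_plane S" "graph_embeds_in (power_graph G) S"
    and g: "g \<in> carrier G" "5 \<le> ord g" and h: "h \<in> carrier G" "5 \<le> ord h"
  shows "h \<in> generate G {g}"
proof (rule ccontr)
  assume nin: "h \<notin> generate G {g}"
  have hk: "h \<noteq> g [^] k" for k :: int using nin unfolding generate_pow[OF g(1)] by blast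
  have og: "ord g = 5 \<or> ord g = 6" and oh: "ord h = 5 \<or> ord h = 6"
    using projective_ord[OF S g(1)] projective_ord[OF S h(1)] g(2) h(2) by auto
  have Dg: "\<not> int (ord g) dvd k" if "k \<noteq> 0" "\<bar>k\<bar> < 5" for k using int_dvd_small[of k "ord g"] that g(2) by simp
  have Dh: "\<not> int (ord h) dvd k" if "k \<noteq> 0" "\<bar>k\<bar> < 5" for k using int_dvd_small[of k "ord h"] that h(2) by simp
  have o1: "ord g \<noteq> Suc 0" "ord h \<noteq> Suc 0" using g(2) h(2) by simp_all
  have pp: "(h [^] b) [^] k = h [^] (b * k)" "(g [^] b) [^] k = g [^] (b * k)" for b k :: int
    using int_pow_pow[OF h(1)] int_pow_pow[OF g(1)] by simp_all
  let ?A = "{1, -1, 2, -2} :: int set"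
  show False
  proof (cases "\<exists>a\<in>?A. \<exists>b\<in>?A. g [^] a = h [^] b")
    case True
    then obtain a b where ab: "a \<in> ?A" "b \<in> ?A" "g [^] a = h [^] b" by blast
    \<comment> \<open>h^b is a power of \<open>g\<close> and \<open>h\<close> is not, so
      \<open>h\<close> cannot be a power of h^b.\<close>
    have hb: "\<not> int (ord h) dvd 1 - b * k" for k
    proof
      assume "int (ord h) dvd 1 - b * k"
      then have "h [^] (b * k) = h [^] (1::int)" using int_pow_eq[OF h(1), of "b * k" 1] by simp
      then have "h = g [^] (a * k)" using pp(1)[of b k] pp(2)[of a k] ab(3) h(1) by simp
      then show False using hk by blast
    qed
    have b2: "b = 2 \<or> b = - 2" using ab(2) hb[of b] by auto
    \<comment> \<open>In order 5 the exponents 2 and -2 would be invertible, with inverses 3 and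
      -3.\<close>
    have h6: "ord h = 6" using oh b2 hb[of 3] hb[of "-3"] by auto
    have "(h [^] b) [^] (3::int) = \<one>" unfolding pp using b2 int_pow_eq_id[OF h(1), of "b * 3"] h6 by auto
    then have "g [^] (a * 3) = \<one>" unfolding ab(3)[symmetric] pp .
    then have "int (ord g) dvd a * 3" using int_pow_eq_id[OF g(1)] by simp
    then have a2: "a = 2 \<or> a = - 2" and g6: "ord g = 6" using ab(1) og by auto
    have gh: "g [^] (2::int) = h [^] (2::int) \<or> g [^] (2::int) = h [^] (-2::int)"
    proof -
      have "(g [^] a) [^] (-1::int) = (h [^] b) [^] (-1::int)" using ab(3) by simp
      then have "g [^] (- a) = h [^] (- b)" unfolding pp by simp
      then show ?thesis using ab(3) a2 b2 by (elim disjE) simp_all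
    qed
    have gh': "g [^] (-2::int) = h [^] (2::int) \<or> g [^] (-2::int) = h [^] (-2::int)"
    proof -
      have "g [^] (-2::int) = (g [^] (2::int)) [^] (-1::int)" unfolding pp by simp
      moreover have "(h [^] (2::int)) [^] (-1::int) = h [^] (-2::int)" "(h [^] (-2::int)) [^] (-1::int) = h [^] (2::int)"
        unfolding pp by simp_all
      ultimately show ?thesis using gh by (elim disjE) simp_all
    qed
    let ?p = "\<lambda>k::int. g [^] k"
    have hm: "h [^] (-1::int) \<noteq> g [^] k" for k :: int
    proof
      assume "h [^] (-1::int) = g [^] k"
      then have "(h [^] (-1::int)) [^] (-1::int) = (g [^] k) [^] (-1::int)" by (rule arg_cong)
      then have "h [^] (1::int) = g [^] (k * - 1)" unfolding pp by simp
      then have "h = g [^] (k * - 1)" unfolding int_pow_1[OF h(1)] .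
      then show False using hk by blast
    qed
    have d1: "distinct [?p 0, ?p 2, ?p (-2), ?p 1, ?p (-1)]"
      by (simp add: int_pow_eq[OF g(1)] Dg o1 del: int_pow_0 int_pow_1)
    have "h [^] (1::int) \<noteq> h [^] (-1::int)" by (simp add: int_pow_eq[OF h(1)] Dh o1 del: int_pow_1)
    moreover have h1: "h [^] (1::int) \<noteq> g [^] k" for k :: int using hk h(1) by simp
    ultimately have "distinct [?p 0, ?p 2, ?p (-2), ?p 1, ?p (-1), h [^] (1::int), h [^] (-1::int)]"
      using d1 hm by (simp del: int_pow_0 int_pow_1) (metis hm h1)
    then have d: "distinct [\<one>, ?p 2, ?p (-2), ?p 1, ?p (-1), h [^] (1::int), h [^] (-1::int)]" by (simp only: int_pow_0)
    have lh: "linked G (?p k) (h [^] c)" if "k = 2 \<or> k = - 2" "c = 1 \<or> c = - 1" for k c :: int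
    proof -
      have "?p k = h [^] (2::int) \<or> ?p k = h [^] (-2::int)" using that(1) gh gh' by blast
      moreover have "linked G (h [^] (2::int)) (h [^] c)" "linked G (h [^] (-2::int)) (h [^] c)"
        using that(2) by (elim disjE; simp add: linked_pow[OF h(1)] del: int_pow_1)+
      ultimately show ?thesis by (elim disjE) simp_all
    qed
    show False
      by (rule projective_no_K7_minus_C4[OF S d])
         (use g(1) h(1) lh in \<open>simp_all add: linked_pow[OF g(1)] linked_pow[OF h(1)] del: int_pow_0 int_pow_1\<close>)
  next
    case False
    let ?p = "\<lambda>k::int. g [^] k" and ?q = "\<lambda>k::int. h [^] k"
    have d1: "distinct [?p 0, ?p 1, ?p (-1), ?p 2, ?p (-2)]"
      by (simp add: int_pow_eq[OF g(1)] Dg o1 del: int_pow_0 int_pow_1)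
    have d2: "distinct [?q 0, ?q 1, ?q (-1), ?q 2, ?q (-2)]"
      by (simp add: int_pow_eq[OF h(1)] Dh o1 del: int_pow_0 int_pow_1)
    have d3: "set [?p 1, ?p (-1), ?p 2, ?p (-2)] \<inter> set [?q 1, ?q (-1), ?q 2, ?q (-2)] = {}"
      using False by (auto simp del: int_pow_0 int_pow_1)
    have "distinct (\<one> # [?p 1, ?p (-1), ?p 2, ?p (-2)] @ [?q 1, ?q (-1), ?q 2, ?q (-2)])"
      using d1 d2 d3 unfolding distinct.simps distinct_append set_append int_pow_0 by blast
    then have d: "distinct [\<one>, ?p 1, ?p (-1), ?p 2, ?p (-2), ?q 1, ?q (-1), ?q 2, ?q (-2)]" by (simp only: append.simps)
    show False
      by (rule projective_no_two_K5[OF S d])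
         (use g(1) h(1) in \<open>simp_all add: linked_pow[OF g(1)] linked_pow[OF h(1)] del: int_pow_0 int_pow_1\<close>)
  qed
qed

end

section \<open>Embedding power graphs by fan and pentagon\<close>

lemma pent_edge_exists: "i < j \<Longrightarrow> j \<le> 4 \<Longrightarrow> \<exists>A B. pent_edge A B i j"
proof -
  assume ij: "i < j" "j \<le> 4"
  have "i = 0 \<or> i = 1 \<or> i = 2 \<or> i = 3" using ij by linarith
  moreover have "j = 1 \<or> j = 2 \<or> j = 3 \<or> j = 4" using ij by linarith
  ultimately have "(i, j) \<in> {(0, 1), (1, 2), (2, 3), (3, 4), (0, 4)} \<or> (i, j) \<in> {(0, 2), (0, 3), (1, 3), (1, 4), (2, 4)}"
    using ij(1) by (elim disjE) simp_all
  then have "pent_edge (pent i) (pent j) i j \<or> pent_edge (pent i) (- pent j) i j"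
    unfolding pent_edge_def by (elim disjE) simp_all
  then show ?thesis by blast
qed

context group
begin

lemma int_pow_small:
  assumes y: "y \<in> carrier G"
  shows "y [^] (2::int) = y \<otimes> y" "y [^] (- 1::int) = inv y"
    "y [^] (3::int) = y \<otimes> y \<otimes> y" "y [^] (4::int) = (y \<otimes> y) \<otimes> (y \<otimes> y)"
proof -
  show 2: "y [^] (2::int) = y \<otimes> y" using int_pow_mult[OF y, of 1 1] y by simp
  show "y [^] (- 1::int) = inv y" using int_pow_neg[OF y, of 1] y by simp
  show "y [^] (3::int) = y \<otimes> y \<otimes> y" using int_pow_mult[OF y, of 2 1] y unfolding 2 by simp
  show "y [^] (4::int) = (y \<otimes> y) \<otimes> (y \<otimes> y)" using int_pow_mult[OF y, of 2 2] y unfolding 2 by simp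
qed

text \<open>The hypothesis \<open>sq\<close> spells out y^2 = 1, y^3 = 1 or y^4 = 1.\<close>

lemma generate_small:
  assumes y: "y \<in> carrier G" and sq: "y \<otimes> y = \<one> \<or> y \<otimes> y = inv y \<or> (y \<otimes> y) \<otimes> (y \<otimes> y) = \<one>"
    and x: "x \<in> generate G {y}"
  shows "x = \<one> \<or> x = y \<or> x = y \<otimes> y \<or> x = inv y"
proof -
  obtain k :: int where k: "x = y [^] k" using x unfolding generate_pow[OF y] by blast
  have m: "y [^] k = y [^] r" if "y [^] m = \<one>" "m dvd r - k" for m r :: int
    using that int_pow_eq_id[OF y, of m] int_pow_eq[OF y, of k r] dvd_trans by blast
  have "y [^] (3::int) = \<one> \<or> y [^] (4::int) = \<one>"
    using sq y unfolding int_pow_small[OF y] by (elim disjE) simp_all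
  then have "y [^] k = y [^] (0::int) \<or> y [^] k = y [^] (1::int) \<or> y [^] k = y [^] (2::int) \<or> y [^] k = y [^] (-1::int)"
  proof
    assume 3: "y [^] (3::int) = \<one>"
    have "3 dvd 0 - k \<or> 3 dvd 1 - k \<or> 3 dvd - 1 - k" by presburger
    then show ?thesis using m[OF 3] by blast
  next
    assume 4: "y [^] (4::int) = \<one>"
    have "4 dvd 0 - k \<or> 4 dvd 1 - k \<or> 4 dvd 2 - k \<or> 4 dvd - 1 - k" by presburger
    then show ?thesis using m[OF 4] by blast
  qed
  then show ?thesis unfolding k int_pow_small(1,2)[OF y] int_pow_0 int_pow_1[OF y] by blast
qed

lemma square_if_ord_le_4:
  assumes fin: "finite (carrier G)" and y: "y \<in> carrier G" "ord y \<le> 4"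
  shows "y \<otimes> y = \<one> \<or> y \<otimes> y = inv y \<or> (y \<otimes> y) \<otimes> (y \<otimes> y) = \<one>"
proof -
  have "ord y = 1 \<or> ord y = 2 \<or> ord y = 3 \<or> ord y = 4" using ord_ge_1[OF fin y(1)] y(2) by linarith
  then have "int (ord y) dvd 2 \<or> int (ord y) dvd - 1 - 2 \<or> int (ord y) dvd 4" by (elim disjE) simp_all
  then have "y [^] (2::int) = \<one> \<or> y [^] (2::int) = y [^] (- 1::int) \<or> y [^] (4::int) = \<one>"
    unfolding int_pow_eq_id[OF y(1)] int_pow_eq[OF y(1)] .
  then show ?thesis unfolding int_pow_small[OF y(1)] .
qed

text \<open>Every fan element gets a hub: an involution itself, an element of order 3 one member of
  the pair it forms with its inverse, an element of order 4 its square. Slopes come in blocks, one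
  per hub, with inverse non-hubs next to each other; edges inside the fan are then spokes and rims.
  By \<open>core\<close>, powers of core elements leave the core only for \<open>zz\<close>, and
  only from corners 1 and 4.\<close>

theorem power_graph_fan_embeds:
  fixes c :: "nat \<Rightarrow> 'a" and \<Phi> :: "real^3 \<Rightarrow> 'x::metric_space"
  assumes fin: "finite (carrier G)"
    and car: "carrier G = F \<union> c ` (if b then {..4} else {0})"
    and c0: "c 0 = \<one>" and c_inj: "inj_on c (if b then {..4} else {0})"
    and c_F: "c ` (if b then {..4} else {0}) \<inter> F = {}"
    and F_inv: "\<And>x. x \<in> F \<Longrightarrow> inv x \<in> F"
    and F_sq: "\<And>x. x \<in> F \<Longrightarrow> x \<otimes> x = \<one> \<or> x \<otimes> x = inv x \<or> (x \<otimes> x \<in> F \<and> (x \<otimes> x) \<otimes> (x \<otimes> x) = \<one>)"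
    and core: "\<And>x y. y \<in> c ` (if b then {..4} else {0}) \<Longrightarrow> x \<in> carrier G \<Longrightarrow> x \<noteq> y \<Longrightarrow> x \<in> generate G {y} \<Longrightarrow>
      x \<in> c ` (if b then {..4} else {0}) \<or> (b \<and> x = zz \<and> zz \<in> F \<and> zz \<otimes> zz = \<one> \<and> (y = c 1 \<or> y = c 4))"
    and cont: "continuous_on (sphere 0 1) \<Phi>"
    and inj: "\<And>x y. x \<in> sphere 0 1 \<Longrightarrow> y \<in> sphere 0 1 \<Longrightarrow> \<Phi> x = \<Phi> y \<Longrightarrow> x = y \<or> x = - y"
    and even: "b \<Longrightarrow> \<forall>x\<in>sphere 0 1. \<Phi> (- x) = \<Phi> x"
  shows "graph_embeds_in (power_graph G) (top_of_set (\<Phi> ` sphere 0 1))"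
proof -
  have K0: "(0::nat) \<in> (if b then {..4} else {0})" by (cases b) simp_all
  have ne1: "x \<noteq> \<one>" if "x \<in> F" for x using imageI[OF K0, of c] c0 c_F that by auto
  have Fc: "x \<in> carrier G" if "x \<in> F" for x using car that by blast
  have "finite F" using fin car by simp
  then obtain cc :: "'a \<Rightarrow> nat" and N where cc: "cc ` F = {i. i < N}" "inj_on cc F"
    using finite_imp_inj_to_nat_seg by metis
  have ccN: "cc x < N" if "x \<in> F" for x using imageI[OF that, of cc] cc(1) by simp
  have cceq: "x = y" if "cc x = cc y" "x \<in> F" "y \<in> F" for x y using inj_onD[OF cc(2) that] .
  \<comment> \<open>For order 3 the numbering \<open>cc\<close> decides between an element and its
    inverse.\<close>
  define \<eta> where "\<eta> x = (if x \<otimes> x = \<one> then x else if x \<otimes> x = inv x then (if cc x < cc (inv x) then x else inv x)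
    else x \<otimes> x)" for x
  define H where "H = {x \<in> F. \<eta> x = x}"
  \<comment> \<open>The offset in a block: 0 is kept for the hub, and a pair of inverse elements
    gets two consecutive numbers determined by its smaller \<open>cc\<close>.\<close>
  define d where "d x = (if x \<in> H then 0 else 1 + 2 * min (cc x) (cc (inv x)) + (if cc x \<le> cc (inv x) then 0 else 1))" for x
  \<comment> \<open>All offsets are below this block length, so blocks do not overlap.\<close>
  define K where "K = 2 * N + 2"
  define S where "S x = K * cc (\<eta> x) + d x" for x
  \<comment> \<open>On \<open>F\<close> the values of \<open>S\<close> are below K N, so slopes stay
    below 1.\<close>
  define s where "s x = real (S x) / real (K * N + 1)" for x
  have inv_sq: "inv x \<otimes> inv x = inv (x \<otimes> x)" if "x \<in> F" for x using Fc[OF that] by (simp add: inv_mult_group)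
  have three: "inv x \<otimes> inv x = inv (inv x)" "inv x \<otimes> inv x \<noteq> \<one>" "x \<noteq> inv x" "cc x \<noteq> cc (inv x)"
    if x: "x \<in> F" "x \<otimes> x \<noteq> \<one>" "x \<otimes> x = inv x" for x
  proof -
    show 1: "inv x \<otimes> inv x = inv (inv x)" using inv_sq[OF x(1)] x(3) by simp
    show "inv x \<otimes> inv x \<noteq> \<one>" unfolding 1 using Fc[OF x(1)] ne1[OF x(1)] by simp
    show 2: "x \<noteq> inv x"
    proof
      assume "x = inv x"
      then have "x \<otimes> x = x \<otimes> inv x" by (rule arg_cong)
      then show False using x(2) Fc[OF x(1)] by simp
    qed
    show "cc x \<noteq> cc (inv x)" using cceq[OF _ x(1) F_inv[OF x(1)]] 2 by blast
  qed
  have \<eta>3: "cc x < cc (inv x) \<Longrightarrow> \<eta> x = x \<and> \<eta> (inv x) = x"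
    "\<not> cc x < cc (inv x) \<Longrightarrow> \<eta> x = inv x \<and> \<eta> (inv x) = inv x"
    if x: "x \<in> F" "x \<otimes> x \<noteq> \<one>" "x \<otimes> x = inv x" for x
    using three[OF x] x(2,3) Fc[OF x(1)] unfolding \<eta>_def by simp_all
  have four: "\<eta> x = x \<otimes> x" "\<eta> (inv x) = x \<otimes> x" "x \<otimes> x \<noteq> x" "x \<otimes> x \<in> F" "\<eta> (x \<otimes> x) = x \<otimes> x"
    if x: "x \<in> F" "x \<otimes> x \<noteq> \<one>" "x \<otimes> x \<noteq> inv x" for x
  proof -
    have x2: "x \<otimes> x \<in> F" "(x \<otimes> x) \<otimes> (x \<otimes> x) = \<one>" using F_sq[OF x(1)] x(2,3) by blast+
    show "\<eta> x = x \<otimes> x" using x(2,3) by (simp add: \<eta>_def)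
    show ne: "x \<otimes> x \<noteq> x"
    proof
      assume "x \<otimes> x = x"
      then have "x \<otimes> x = x \<otimes> \<one>" using Fc[OF x(1)] by simp
      then have "x = \<one>" using Fc[OF x(1)] Units_l_cancel[of x x \<one>] Units_eq by simp
      then show False using ne1[OF x(1)] by blast
    qed
    have i: "inv x \<otimes> inv x = x \<otimes> x" unfolding inv_sq[OF x(1)] using inv_equality[OF x2(2)] Fc[OF x2(1)] by simp
    show "\<eta> (inv x) = x \<otimes> x" unfolding \<eta>_def i using x(2) ne Fc[OF x(1)] by simp
    show "x \<otimes> x \<in> F" by (rule x2)
    show "\<eta> (x \<otimes> x) = x \<otimes> x" using x2(2) by (simp add: \<eta>_def)
  qed
  have \<eta>H: "\<eta> x \<in> H" if x: "x \<in> F" for x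
  proof -
    consider "x \<otimes> x = \<one>" | "x \<otimes> x \<noteq> \<one>" "x \<otimes> x = inv x" | "x \<otimes> x \<noteq> \<one>" "x \<otimes> x \<noteq> inv x" by blast
    then show ?thesis
    proof cases
      case 1 then show ?thesis using x by (simp add: H_def \<eta>_def)
    next
      case 2
      show ?thesis using \<eta>3[OF x 2] x F_inv[OF x] by (cases "cc x < cc (inv x)") (simp_all add: H_def)
    next
      case 3
      show ?thesis using four[OF x 3] by (simp add: H_def)
    qed
  qed
  have HF: "x \<in> F" "\<eta> x = x" "d x = 0" if "x \<in> H" for x using that by (simp_all add: H_def d_def)
  have dK: "d x < K" if "x \<in> F" for x
    using ccN[OF that] by (auto simp: d_def K_def min_def)
  have d0: "0 < d x" if "x \<notin> H" for x using that by (simp add: d_def)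
  have step: "K * a + d x < K * a'" if "a < a'" "x \<in> F" for a a' x
  proof -
    have "K * a + d x < K * Suc a" using dK[OF that(2)] by simp
    also have "\<dots> \<le> K * a'" by (rule mult_le_mono2) (use that(1) in simp)
    finally show ?thesis .
  qed
  have SKN: "S x < K * N" if "x \<in> F" for x
    unfolding S_def by (rule step[OF ccN[OF HF(1)[OF \<eta>H[OF that]]] that])
  have pos: "0 < real (K * N + 1)" by (rule of_nat_0_less_iff[THEN iffD2]) simp
  have div_less: "a / R < a' / R \<longleftrightarrow> a < a'" if "0 < R" for a a' R :: real
    using that by (simp add: divide_less_cancel)
  have s_less: "s x < s y \<longleftrightarrow> S x < S y" for x y
    by (simp only: s_def div_less[OF pos] of_nat_less_iff)
  have S_inj: "x = y" if xy: "x \<in> F" "y \<in> F" "S x = S y" for x y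
  proof -
    have "\<not> cc (\<eta> x) < cc (\<eta> y)"
      using step[of "cc (\<eta> x)" "cc (\<eta> y)" x] xy unfolding S_def by linarith
    moreover have "\<not> cc (\<eta> y) < cc (\<eta> x)"
      using step[of "cc (\<eta> y)" "cc (\<eta> x)" y] xy unfolding S_def by linarith
    ultimately have e: "cc (\<eta> x) = cc (\<eta> y)" by simp
    then have \<eta>e: "\<eta> x = \<eta> y" using cceq HF(1)[OF \<eta>H] xy(1,2) by blast
    have de: "d x = d y" using xy(3) e unfolding S_def by simp
    show ?thesis
    proof (cases "x \<in> H")
      case True
      then have "y \<in> H" using de d0[of y] HF(3)[of x] by (cases "y \<in> H") simp_all
      then show ?thesis using HF(2) True \<eta>e by metis
    next
      case False
      then have yH: "y \<notin> H" using de d0[of x] HF(3)[of y] by (cases "y \<in> H") simp_all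
      have "2 * min (cc x) (cc (inv x)) + (if cc x \<le> cc (inv x) then 0 else 1) =
          2 * min (cc y) (cc (inv y)) + (if cc y \<le> cc (inv y) then 0 else (1::nat))"
        using de False yH unfolding d_def by simp
      \<comment> \<open>The parity of the offset tells which of the two inverses attains the
        minimum. In either case one of the two numbers agrees.\<close>
      then have "cc x = cc y \<or> cc (inv x) = cc (inv y)"
        unfolding min_def by (cases "cc x \<le> cc (inv x)"; cases "cc y \<le> cc (inv y)"; simp; presburger)
      then have "x = y \<or> inv x = inv y" using cceq xy(1,2) F_inv by blast
      then show ?thesis using inv_inv Fc xy(1,2) by metis
    qed
  qed
  interpret fan: fan_template F H s c b zz
  proof unfold_locales
    show "H \<subseteq> F" by (auto simp: H_def)
    show "0 \<le> s v \<and> s v < 1" if "v \<in> F" for v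
    proof
      show "0 \<le> s v" unfolding s_def by simp
      have "S v < K * N + 1" using SKN[OF that] by simp
      then have "real (S v) < real (K * N + 1)" by (rule of_nat_less_iff[THEN iffD2])
      then show "s v < 1" unfolding s_def using pos by (simp only: divide_less_eq_1_pos)
    qed
    show "inj_on s F"
    proof (rule inj_onI)
      fix x y assume xy: "x \<in> F" "y \<in> F" "s x = s y"
      then have "\<not> S x < S y" "\<not> S y < S x" using s_less[of x y] s_less[of y x] by simp_all
      then show "x = y" using S_inj[OF xy(1,2)] by linarith
    qed
  qed (rule c_inj, rule c_F)
  have spoke: "fan.spoke (\<eta> w) w" if w: "w \<in> F" "w \<notin> H" for w
  proof -
    have Sz: "S (\<eta> w) = K * cc (\<eta> w)" using HF(2,3)[OF \<eta>H[OF w(1)]] by (simp add: S_def)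
    have "S (\<eta> w) < S w" unfolding Sz using d0[OF w(2)] by (simp add: S_def)
    moreover have "S w < S u" if u: "u \<in> H" "S (\<eta> w) < S u" for u
    proof -
      have "S u = K * cc u" using HF(2,3)[OF u(1)] by (simp add: S_def)
      moreover have "cc (\<eta> w) < cc u" using u(2) unfolding Sz calculation by simp
      ultimately show ?thesis using step[OF _ w(1)] unfolding S_def[of w] by simp
    qed
    ultimately show ?thesis unfolding fan.spoke_def s_less using \<eta>H[OF w(1)] w by blast
  qed
  have rim: "fan.rim w (inv w)" if w: "w \<in> F" "w \<otimes> w \<noteq> \<one>" "w \<otimes> w \<noteq> inv w" "cc w < cc (inv w)" for w
  proof -
    note f = four[OF w(1,2,3)]
    have nH: "w \<notin> H" "inv w \<notin> H" using f w(3) by (auto simp: H_def)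
    have "S (inv w) = Suc (S w)"
      using nH w(4) Fc[OF w(1)] by (simp add: S_def d_def f min_def)
    then show ?thesis unfolding fan.rim_def s_less using nH w(1) F_inv[OF w(1)] by auto
  qed
  have dspoke: "\<exists>A B. fan.drawn {\<eta> w, w} A B" if "w \<in> F" "w \<notin> H" for w
    using spoke[OF that] unfolding fan.drawn_def by blast
  have drim: "\<exists>A B. fan.drawn {w, inv w} A B" if "w \<in> F" "w \<otimes> w \<noteq> \<one>" "w \<otimes> w \<noteq> inv w" "cc w < cc (inv w)" for w
    using rim[OF that] unfolding fan.drawn_def by blast
  have dpent: "\<exists>A B. fan.drawn {c i, c j} A B" if ij: "i < j" "j \<le> 4" b for i j
  proof -
    obtain A B where "pent_edge A B i j" using pent_edge_exists[OF ij(1,2)] by blast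
    then have "fan.drawn {c i, c j} A B" unfolding fan.drawn_def using ij(3) by blast
    then show ?thesis by blast
  qed
  have dchord: "\<exists>A B. fan.drawn {zz, c k} A B" if "b" "zz \<in> H" "k = 1 \<or> k = 4" for k
  proof -
    have "k \<in> {1, 4}" using that(3) by simp
    then have "fan.drawn {zz, c k} (fan.pos zz) (fan.pos (c k))" unfolding fan.drawn_def using that(1,2) by blast
    then show ?thesis by blast
  qed
  have done_F: "\<exists>A B. fan.drawn {x, y} A B" if y: "y \<in> F" and x: "x \<noteq> y" "x \<in> generate G {y}" for x y
  proof -
    have c3: "x = \<one> \<or> x = y \<otimes> y \<or> x = inv y"
      using generate_small[OF Fc[OF y] _ x(2)] F_sq[OF y] x(1) by blast
    have d1: "\<exists>A B. fan.drawn {\<one>, y} A B" unfolding fan.drawn_def c0 using y by blast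
    have d2: "\<exists>A B. fan.drawn {x, y} A B" if x1: "x \<noteq> \<one>" "x = y \<otimes> y \<or> x = inv y"
    proof -
      consider "y \<otimes> y = \<one>" | "y \<otimes> y \<noteq> \<one>" "y \<otimes> y = inv y" | "y \<otimes> y \<noteq> \<one>" "y \<otimes> y \<noteq> inv y" by blast
      then show ?thesis
      proof cases
        case 1
        then have "inv y = y" using inv_equality[OF 1] Fc[OF y] by simp
        then show ?thesis using x1 x(1) 1 by simp
      next
        case 2
        then have xi: "x = inv y" using x1(2) by simp
        note ny = three(3)[OF y 2]
        show ?thesis
        proof (cases "cc y < cc (inv y)")
          case True
          note e = \<eta>3(1)[OF y 2 True]
          have "inv y \<notin> H" using e ny by (auto simp: H_def)
          from dspoke[OF F_inv[OF y] this] show ?thesis using e by (simp add: xi insert_commute)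
        next
          case False
          note e = \<eta>3(2)[OF y 2 False]
          have "y \<notin> H" using e ny by (auto simp: H_def)
          from dspoke[OF y this] show ?thesis using e by (simp add: xi)
        qed
      next
        case 3
        note f = four[OF y 3]
        have iy: "inv y \<otimes> inv y = y \<otimes> y"
          unfolding inv_sq[OF y] using F_sq[OF y] 3 inv_equality[of "y \<otimes> y" "y \<otimes> y"] Fc[OF f(4)] by blast
        have yy: "inv (inv y) = y" using Fc[OF y] by simp
        from x1(2) show ?thesis
        proof
          assume "x = y \<otimes> y"
          moreover have "y \<notin> H" using f by (auto simp: H_def)
          ultimately show ?thesis using dspoke[OF y] f(1) by simp
        next
          assume xi: "x = inv y"
          have "cc y \<noteq> cc (inv y)"
          proof
            assume e: "cc y = cc (inv y)"
            have "y = x" unfolding xi by (rule cceq[OF e y F_inv[OF y]])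
            then show False using x(1) by simp
          qed
          then consider "cc y < cc (inv y)" | "cc (inv y) < cc y" by linarith
          then show ?thesis
          proof cases
            case 1
            from drim[OF y 3 1] show ?thesis by (simp add: xi insert_commute)
          next
            case 2
            have "\<exists>A B. fan.drawn {inv y, inv (inv y)} A B"
              by (rule drim[OF F_inv[OF y]]; simp only: iy yy) (use 3 f(3) 2 in simp_all)
            then show ?thesis unfolding yy xi .
          qed
        qed
      qed
    qed
    show ?thesis
    proof (cases "x = \<one>")
      case True
      show ?thesis unfolding True by (rule d1)
    next
      case False
      show ?thesis by (rule d2[OF False]) (use c3 False in blast)
    qed
  qed
  have done_c: "\<exists>A B. fan.drawn {x, y} A B"
    if y: "y \<in> c ` (if b then {..4} else {0})" and x: "x \<in> carrier G" "x \<noteq> y" "x \<in> generate G {y}" for x y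
  proof -
    from core[OF y x] show ?thesis
    proof
      assume "x \<in> c ` (if b then {..4} else {0})"
      then obtain i where i: "i \<in> (if b then {..4} else {0})" "x = c i" by (rule imageE)
      obtain j where j: "j \<in> (if b then {..4} else {0})" "y = c j" using y by (rule imageE)
      have ij: "i \<noteq> j" using i j x(2) by blast
      have b using i(1) j(1) ij by (cases b) simp_all
      then have "i \<le> 4" "j \<le> 4" using i(1) j(1) by simp_all
      then show ?thesis using dpent[of i j] dpent[of j i] ij \<open>b\<close> unfolding i(2) j(2)
        by (cases "i < j") (simp_all add: insert_commute)
    next
      assume z: "b \<and> x = zz \<and> zz \<in> F \<and> zz \<otimes> zz = \<one> \<and> (y = c 1 \<or> y = c 4)"
      then have "zz \<in> H" by (simp add: H_def \<eta>_def)
      then show ?thesis using z dchord[of 1] dchord[of 4] by blast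
    qed
  qed
  have main: "\<exists>A B. fan.drawn {x, y} A B"
    if "x \<in> carrier G" "y \<in> carrier G" "x \<noteq> y" "x \<in> generate G {y}" for x y
    using that(2) unfolding car using done_F[OF _ that(3,4)] done_c[OF _ that(1,3,4)] by (elim UnE)
  have "\<exists>A B. fan.drawn e A B" if eE: "e \<in> power_edges G" for e
  proof -
    obtain x y where xy: "e = {x, y}" "x \<in> carrier G" "y \<in> carrier G" "x \<noteq> y" "linked G x y"
      using eE unfolding power_edge_iff by blast
    from xy(5) show ?thesis unfolding linked_def
    proof
      assume "x \<in> generate G {y}" then show ?thesis unfolding xy(1) by (rule main[OF xy(2,3,4)])
    next
      assume "y \<in> generate G {x}"
      then have "\<exists>A B. fan.drawn {y, x} A B" by (rule main[OF xy(3,2) xy(4)[symmetric]])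
      then show ?thesis unfolding xy(1) by (simp only: insert_commute)
    qed
  qed
  from fan.embeds[OF cont inj even this] show ?thesis unfolding car[symmetric] power_graph_eq[symmetric] by (smt (verit, ccfv_threshold) power_graph_eq)
qed

text \<open>The core shrinks to the identity, so all edges lie in the fan and nothing has to pass
  through infinity.\<close>

lemma power_graph_embeds_sphere:
  assumes fin: "finite (carrier G)" and o: "\<And>x. x \<in> carrier G \<Longrightarrow> ord x \<le> 4"
  shows "graph_embeds_in (power_graph G) (top_of_set (sphere_map ` sphere 0 1))"
proof (rule power_graph_fan_embeds[where F = "carrier G - {\<one>}" and c = "\<lambda>_. \<one>" and b = False and zz = \<one>])
  fix x assume x: "x \<in> carrier G - {\<one>}"
  then show "inv x \<in> carrier G - {\<one>}" by simp
  show "x \<otimes> x = \<one> \<or> x \<otimes> x = inv x \<or> (x \<otimes> x \<in> carrier G - {\<one>} \<and> (x \<otimes> x) \<otimes> (x \<otimes> x) = \<one>)"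
    using square_if_ord_le_4[OF fin _ o, of x] x by auto
next
  fix x y assume y: "y \<in> (\<lambda>_::nat. \<one>) ` (if False then {..4} else {0})" and xy: "x \<noteq> y" "x \<in> generate G {y}"
  have "y = \<one>" using y by auto
  moreover have "x = \<one> \<or> x = y \<or> x = y \<otimes> y \<or> x = inv y"
    by (rule generate_small[OF _ _ xy(2)]) (simp_all add: calculation)
  ultimately have False using xy(1) by simp
  then show "x \<in> (\<lambda>_::nat. \<one>) ` (if False then {..4} else {0}) \<or>
    (False \<and> x = \<one> \<and> \<one> \<in> carrier G - {\<one>} \<and> \<one> \<otimes> \<one> = \<one> \<and> (y = \<one> \<or> y = \<one>))" ..
next
  fix x y :: "real^3" assume "sphere_map x = sphere_map y"
  then show "x = y \<or> x = - y" using sphere_map_inj by blast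
qed (use fin continuous_on_sphere_map in auto)

lemma power_graph_embeds_projective_plane:
  assumes fin: "finite (carrier G)" and g: "g \<in> carrier G" and n: "ord g = 5 \<or> ord g = 6"
    and o: "\<And>x. x \<in> carrier G \<Longrightarrow> x \<notin> generate G {g} \<Longrightarrow> ord x \<le> 4"
  shows "graph_embeds_in (power_graph G) (top_of_set (projective_map ` sphere 0 1))"
proof -
  \<comment> \<open>Exponents in the order around the pentagon: g and its inverse are the corners
    next to the identity, which chords from g^3 in the fan can reach.\<close>
  define e where "e i = (if i = 0 then 0 else if i = 1 then 1 else if i = 2 then 2 else if i = 3 then - 2 else - 1 :: int)" for i :: nat
  define c where "c i = g [^] e i" for i
  have eA: "e ` {..4} = {0, 1, 2, - 2, - 1}"
  proof -
    have "{..4} = {0, 1, 2, 3, 4::nat}" by auto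
    then have "e ` {..4} = {e 0, e 1, e 2, e 3, e 4}" by (simp only: image_insert image_empty)
    also have "\<dots> = {0, 1, 2, - 2, - 1}" by (simp add: e_def insert_commute)
    finally show ?thesis .
  qed
  have c_iff: "x \<in> c ` {..4} \<longleftrightarrow> (\<exists>a\<in>{0, 1, 2, - 2, - 1}. x = g [^] (a::int))" for x
    unfolding eA[symmetric] c_def by blast
  have geq: "g [^] a = g [^] k \<longleftrightarrow> int (ord g) dvd k - a" for a k :: int by (rule int_pow_eq[OF g])
  have gid: "g [^] k = \<one> \<longleftrightarrow> int (ord g) dvd k" for k :: int by (rule int_pow_eq_id[OF g])
  have small: "k = 0" if "int (ord g) dvd k" "\<bar>k\<bar> \<le> 4" for k
    using int_dvd_small[of k "ord g"] that n by auto
  \<comment> \<open>For order 5 the core is the whole cyclic subgroup; for order 6 only g^3 is left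
    over, and it joins the fan.\<close>
  have rest: "ord g = 6 \<and> 6 dvd 3 - k" if "g [^] k \<notin> c ` {..4}" for k :: int
  proof -
    have nd: "\<not> int (ord g) dvd a - k" if "a = 0 \<or> a = 1 \<or> a = 2 \<or> a = - 2 \<or> a = - 1" for a
      using \<open>g [^] k \<notin> c ` {..4}\<close> that unfolding c_iff geq by blast
    have nd5: "\<not> int (ord g) dvd 0 - k" "\<not> int (ord g) dvd 1 - k" "\<not> int (ord g) dvd 2 - k"
      "\<not> int (ord g) dvd - 2 - k" "\<not> int (ord g) dvd - 1 - k"
      by (rule nd; simp)+
    from n show ?thesis
    proof
      assume 5: "ord g = 5"
      have "5 dvd 0 - k \<or> 5 dvd 1 - k \<or> 5 dvd 2 - k \<or> 5 dvd - 2 - k \<or> 5 dvd - 1 - k" by presburger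
      then show ?thesis using nd5 unfolding 5 of_nat_numeral by blast
    next
      assume 6: "ord g = 6"
      have "6 dvd 0 - k \<or> 6 dvd 1 - k \<or> 6 dvd 2 - k \<or> 6 dvd - 2 - k \<or> 6 dvd - 1 - k \<or> 6 dvd 3 - k" by presburger
      then show ?thesis using nd5 6 unfolding 6 of_nat_numeral by blast
    qed
  qed
  let ?F = "carrier G - c ` {..4}"
  have cG: "c ` {..4} \<subseteq> carrier G" using g by (auto simp: c_def)
  have c_inv: "inv x \<in> c ` {..4}" if xc: "x \<in> c ` {..4}" for x
  proof -
    obtain a :: int where a: "a = 0 \<or> a = 1 \<or> a = 2 \<or> a = - 2 \<or> a = - 1" "x = g [^] a" using xc unfolding c_iff by blast
    have "inv x = g [^] (- a)" unfolding a(2) by (rule int_pow_neg[OF g, symmetric])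
    moreover have "- a \<in> {0, 1, 2, - 2, - 1}" using a(1) by (elim disjE) simp_all
    ultimately show ?thesis unfolding c_iff by blast
  qed
  show ?thesis
  proof (rule power_graph_fan_embeds[where F = ?F and c = c and b = True and zz = "g [^] (3::int)", unfolded if_True])
    show "finite (carrier G)" by (rule fin)
    show "carrier G = ?F \<union> c ` {..4}" using cG by blast
    show "c 0 = \<one>" by (simp add: c_def e_def)
    show "inj_on c {..4}"
    proof (rule inj_onI)
      fix i j assume ij: "i \<in> {..4::nat}" "j \<in> {..4}" "c i = c j"
      have "e i \<in> {0, 1, 2, - 2, - 1}" "e j \<in> {0, 1, 2, - 2, - 1}" unfolding eA[symmetric] using ij(1,2) by blast+
      then have "\<bar>e j - e i\<bar> \<le> 4" by auto
      then have "e i = e j" using small[of "e j - e i"] ij(3) unfolding c_def geq by simp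
      moreover have "i = 0 \<or> i = 1 \<or> i = 2 \<or> i = 3 \<or> i = 4" "j = 0 \<or> j = 1 \<or> j = 2 \<or> j = 3 \<or> j = 4"
        using ij(1,2) by auto
      ultimately show "i = j" by (elim disjE) (simp_all add: e_def)
    qed
    show "c ` {..4} \<inter> ?F = {}" by blast
  next
    fix x assume x: "x \<in> ?F"
    then have xG: "x \<in> carrier G" by blast
    show "inv x \<in> ?F" using x c_inv[of "inv x"] xG by auto
    show "x \<otimes> x = \<one> \<or> x \<otimes> x = inv x \<or> (x \<otimes> x \<in> ?F \<and> (x \<otimes> x) \<otimes> (x \<otimes> x) = \<one>)"
    proof (cases "x \<in> generate G {g}")
      case True
      then obtain k :: int where k: "x = g [^] k" unfolding generate_pow[OF g] by blast
      then have r: "ord g = 6" "6 dvd 3 - k" using rest[of k] x by blast+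
      have "6 dvd k * 2" using r(2) by presburger
      then have "g [^] (k * 2) = \<one>" unfolding gid r(1) by simp
      then have "x [^] (2::int) = \<one>" unfolding k int_pow_pow[OF g] .
      then show ?thesis unfolding int_pow_small(1)[OF xG] by blast
    next
      case False
      \<comment> \<open>An outer element of order 4 cannot have its square in the core: g^(2 a) = 1
        with |2 a| at most 4 forces a = 0.\<close>
      have "x \<otimes> x = \<one>" if "x \<otimes> x \<in> c ` {..4}" "(x \<otimes> x) \<otimes> (x \<otimes> x) = \<one>"
      proof -
        obtain a :: int where a: "a = 0 \<or> a = 1 \<or> a = 2 \<or> a = - 2 \<or> a = - 1" "x \<otimes> x = g [^] a"
          using \<open>x \<otimes> x \<in> c ` {..4}\<close> unfolding c_iff by blast
        have "g [^] (a + a) = \<one>" unfolding int_pow_mult[OF g] using that(2) unfolding a(2) .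
        then have "a + a = 0" using small[of "a + a"] a(1) unfolding gid by auto
        then show ?thesis using a(2) by simp
      qed
      then show ?thesis using square_if_ord_le_4[OF fin xG o[OF xG False]] xG by blast
    qed
  next
    fix x y assume y: "y \<in> c ` {..4}" and x: "x \<in> carrier G" "x \<noteq> y" "x \<in> generate G {y}"
    obtain a :: int where a: "a = 0 \<or> a = 1 \<or> a = 2 \<or> a = - 2 \<or> a = - 1" "y = g [^] a" using y unfolding c_iff by blast
    obtain k :: int where "x = y [^] k" using x(3) unfolding generate_pow[OF subsetD[OF cG y]] by blast
    then have xk: "x = g [^] (a * k)" unfolding a(2) int_pow_pow[OF g] .
    have "x = g [^] (3::int) \<and> g [^] (3::int) \<in> ?F \<and> g [^] (3::int) \<otimes> g [^] (3::int) = \<one> \<and> (y = c 1 \<or> y = c 4)"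
      if nx: "x \<notin> c ` {..4}"
    proof -
      have r: "ord g = 6" "6 dvd 3 - a * k" using rest[of "a * k"] nx xk by blast+
      have x3: "x = g [^] (3::int)" unfolding xk geq using r by simp
      \<comment> \<open>3 is a k modulo 6, so \<open>a\<close> is odd; hence only g and its inverse
        generate g^3 among the core elements.\<close>
      have "odd a" 
      proof
        assume "even a"
        then have "even (a * k)" by simp
        moreover have "even (3 - a * k)" using r(2) by (meson dvd_trans even_numeral)
        ultimately have "even ((3 - a * k) + a * k)" by (intro dvd_add)
        then show False by simp
      qed
      then have "y = c 1 \<or> y = c 4" using a(1) unfolding a(2) c_def e_def by (elim disjE) simp_all
      moreover have "g [^] (3::int) \<otimes> g [^] (3::int) = \<one>"
        unfolding int_pow_mult[OF g, symmetric] gid r(1) by simp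
      ultimately show ?thesis using x3 x(1) nx by blast
    qed
    then show "x \<in> c ` {..4} \<or> True \<and> x = g [^] (3::int) \<and> g [^] (3::int) \<in> ?F \<and>
      g [^] (3::int) \<otimes> g [^] (3::int) = \<one> \<and> (y = c 1 \<or> y = c 4)" by blast
  next
    show "continuous_on (sphere 0 1) projective_map" by (rule continuous_on_projective_map)
  next
    fix x y :: "real^3" assume "x \<in> sphere 0 1" "y \<in> sphere 0 1" "projective_map x = projective_map y"
    then show "x = y \<or> x = - y" by (rule projective_map_inj)
  next
    show "\<forall>x\<in>sphere 0 1. projective_map (- x) = projective_map x" using projective_map_minus by blast
  qed
qed

section \<open>The classification\<close>

lemma projective_power_graph_iff:
  assumes fin: "finite (carrier G)"
  shows "projective_graph (power_graph G) \<longleftrightarrow> has_big_cyclic G"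
proof
  assume "projective_graph (power_graph G)"
  then obtain S :: "(real^4) topology" where S: "real_projective_plane S" "graph_embeds_in (power_graph G) S"
    and ns: "\<not> (\<exists>S :: (real^4) topology. S homeomorphic_space top_of_set (sphere (0 :: real^3) 1) \<and>
      graph_embeds_in (power_graph G) S)"
    unfolding projective_graph_iff by blast
  have "\<exists>g\<in>carrier G. 5 \<le> ord g"
  proof (rule ccontr)
    assume no: "\<not> (\<exists>g\<in>carrier G. 5 \<le> ord g)"
    have "ord x \<le> 4" if "x \<in> carrier G" for x using no that by force
    from power_graph_embeds_sphere[OF fin this] show False using ns sphere_image by blast
  qed
  then obtain g where g: "g \<in> carrier G" "5 \<le> ord g" by blast
  have "ord g = 5 \<or> ord g = 6" using projective_ord[OF S g(1)] g(2) by linarith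
  moreover have "ord x \<le> 4" if "x \<in> carrier G" "x \<notin> generate G {g}" for x
    using projective_unique[OF S g that(1)] that(2) by linarith
  ultimately show "has_big_cyclic G" unfolding has_big_cyclic_def using g(1) by blast
next
  assume "has_big_cyclic G"
  then obtain g where g: "g \<in> carrier G" "ord g = 5 \<or> ord g = 6"
    "\<And>x. x \<in> carrier G \<Longrightarrow> x \<notin> generate G {g} \<Longrightarrow> ord x \<le> 4" unfolding has_big_cyclic_def by blast
  have "5 \<le> ord g" using g(2) by auto
  then have "\<not> (\<exists>S :: (real^4) topology. S homeomorphic_space top_of_set (sphere (0 :: real^3) 1) \<and>
      graph_embeds_in (power_graph G) S)" using sphere_ord[OF _ _ g(1)] by blast
  moreover note power_graph_embeds_projective_plane[OF fin g] real_projective_plane_image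
  ultimately show "projective_graph (power_graph G)" unfolding projective_graph_iff by blast
qed

end

theorem theorem4p1:
  fixes G :: "('a, 'b) monoid_scheme"
  assumes "group G" and "finite (carrier G)"
  shows "projective_graph (power_graph G) \<longleftrightarrow>
           G \<cong> integer_mod_group 5 \<or>
           G \<cong> integer_mod_group 6 \<or>
           G \<cong> dihedral_group 5 \<or>
           G \<cong> dihedral_group 6 \<or>
           G \<cong> Z3_semidirect_Z4 \<or>
           is_frobenius_product G (integer_mod_group 5) (integer_mod_group 4)"
proof -
  interpret group G by fact
  show ?thesis
    unfolding projective_power_graph_iff[OF assms(2)] by (rule has_big_cyclic_iff[OF assms])
qed

end
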